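(* Let $G=([n],E)$ be a finite simple graph. Then $\gamma_2(\mathcal{P}_G)\geq 0$. Moreover, if $G$ is $2$-connected, then $\gamma_2(\mathcal{P}_G)=0$ if and only if either $n<5$, or $n\geq 5$ and $G$ is isomorphic to one of the following two graphs: (1) the graph $G_n$ on vertex set $[n]$ with edge set $\{12\}\cup\{1k,2k : k\in\{3,\dots,n\}\}$; or (2) the complete bipartite graph $K_{2,n-2}$.
   Context: For a finite simple graph $G=([n],E)$, the symmetric edge polytope is $\mathcal{P}_G=\mathrm{conv}(\pm(e_i-e_j) : ij\in E)\subset\mathbb{R}^n$, where $e_1,\dots,e_n$ is the standard basis (if $E=\emptyset$, $\mathcal{P}_G$ is understood to be the single point $0$). It is a lattice polytope; let $d=\dim\mathcal{P}_G$. Its $h^*$-vector $(h_0^*,\dots,h_d^* )$ is defined by $|m\mathcal{P}_G\cap\mathbb{Z}^n|=\sum_{j=0}^d h_j^*\binom{m+d-j}{d}$ for all integers $m\ge 0$. It is known that $\mathcal{P}_G$ is reflexive, so $h_j^*=h_{d-j}^*$, and the $\gamma$-vector $(\gamma_0(\mathcal{P}_G),\dots,\gamma_{\lfloor d/2\rfloor}(\mathcal{P}_G))$ is defined by $\sum_{i=0}^{\lfloor d/2\rfloor}\gamma_i t^i(1+t)^{d-2i}=\sum_{j=0}^d h_j^*t^j$. We set $\gamma_i(\mathcal{P}_G)=0$ for $i>\lfloor d/2\rfloor$. A graph is $2$-connected if it has an open ear decomposition, i.e. it is a cycle or is obtained from a cycle by successively attaching paths whose internal vertices are new and whose two distinct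 end vertices belong to the graph built so far. *)

theory Defs
  imports "HOL-Analysis.Analysis" "HOL-Computational_Algebra.Polynomial"
begin

type_synonym 'a ugraph = "'a set \<times> 'a set set"

abbreviation verts :: "'a ugraph \<Rightarrow> 'a set" where "verts \<equiv> fst"
abbreviation edges :: "'a ugraph \<Rightarrow> 'a set set" where "edges \<equiv> snd"

definition simple_graph :: "'a ugraph \<Rightarrow> bool" where
  "simple_graph G \<longleftrightarrow> finite (verts G) \<and> (\<forall>e\<in>edges G. e \<subseteq> verts G \<and> card e = 2)"

definition graph_isomorphic :: "'a ugraph \<Rightarrow> 'b ugraph \<Rightarrow> bool" where
  "graph_isomorphic G H \<longleftrightarrow>
     (\<exists>f. bij_betw f (verts G) (verts H) \<and> (\<lambda>e. f ` e) ` edges G = edges H)"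

definition path_edges :: "'a list \<Rightarrow> 'a set set" where
  "path_edges p = {{p ! i, p ! Suc i} | i. Suc i < length p}"

definition cycle_edges :: "'a list \<Rightarrow> 'a set set" where
  "cycle_edges p = insert {last p, hd p} (path_edges p)"

text \<open>In rule \<open>ear\<close> the attached path is \<open>u # xs @ [v]\<close>, with internal vertices \<open>xs\<close>. The condition
  that its edges are new matters only for \<open>xs = []\<close>, where the ear is a single edge.\<close>

inductive two_connected :: "'a ugraph \<Rightarrow> bool" where
  cycle: "distinct p \<Longrightarrow> length p \<ge> 3 \<Longrightarrow> two_connected (set p, cycle_edges p)"
| ear: "two_connected (V, E) \<Longrightarrow> u \<in> V \<Longrightarrow> v \<in> V \<Longrightarrow> u \<noteq> v \<Longrightarrow>
        distinct xs \<Longrightarrow> set xs \<inter> V = {} \<Longrightarrow> path_edges (u # xs @ [v]) \<inter> E = {} \<Longrightarrow>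
        two_connected (V \<union> set xs, E \<union> path_edges (u # xs @ [v]))"

definition graph_Gn :: "nat \<Rightarrow> nat ugraph" where
  "graph_Gn n = ({1..n}, {{1, 2}} \<union> (\<Union>k\<in>{3..n}. {{1, k}, {2, k}}))"

definition complete_bipartite :: "nat \<Rightarrow> nat \<Rightarrow> nat ugraph" where
  "complete_bipartite a b = ({1..a + b}, {{i, j} | i j. i \<in> {1..a} \<and> j \<in> {a + 1..a + b}})"

text \<open>Since \<open>{i, j} = {j, i}\<close>, the generating set below contains both signs of every edge vector.\<close>

definition symmetric_edge_polytope :: "('n::finite) ugraph \<Rightarrow> (real ^ 'n) set" where
  "symmetric_edge_polytope G =
     (if edges G = {} then {0}
      else convex hull {axis i 1 - axis j 1 | i j. {i, j} \<in> edges G})"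

definition lattice_point_count :: "(real ^ 'n) set \<Rightarrow> nat \<Rightarrow> nat" where
  "lattice_point_count P m =
     card ((\<lambda>x. real m *\<^sub>R x) ` P \<inter> {x. \<forall>i. x $ i \<in> \<int>})"

definition polytope_dim :: "(real ^ 'n) set \<Rightarrow> nat" where
  "polytope_dim P = nat (aff_dim P)"

text \<open>Both vectors are extended by zero, which makes them functions on \<^typ>\<open>nat\<close>
  and makes the solutions of their defining identities unique.\<close>

definition h_star :: "(real ^ 'n) set \<Rightarrow> nat \<Rightarrow> int" where
  "h_star P = (let d = polytope_dim P in
     THE h. (\<forall>j>d. h j = 0) \<and>
       (\<forall>m. int (lattice_point_count P m) = (\<Sum>j=0..d. h j * int ((m + d - j) choose d))))"

definition gamma_vector :: "(real ^ 'n) set \<Rightarrow> nat \<Rightarrow> int" where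
  "gamma_vector P = (let d = polytope_dim P in
     THE g. (\<forall>i>d div 2. g i = 0) \<and>
       (\<Sum>i=0..d div 2. smult (g i) (monom 1 i * [:1, 1:] ^ (d - 2 * i))) =
       (\<Sum>j=0..d. monom (h_star P j) j))"

end

theory Submission
  imports Defs
begin

text \<open>
  A point lies in the \<open>m\<close>-th dilate of the symmetric edge polytope iff it is the net vector of a flow of
  cost at most \<open>m\<close> along the edges of the graph (\<open>symmetric_edge_polytope_eq_flows\<close>). Generic weights
  close to 1 give every net vector a unique cheapest flow, and whether a flow is cheapest depends only
  on its set of arcs. Perturb a lattice point by a small multiple of the demand that sends one unit
  from every vertex to an anchor of its component: the cheapest flow then uses all arcs of an oriented
  spanning forest, a facet, and undoing the perturbation leaves nonnegative integers on these arcs that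
  are positive where the perturbation runs backwards. Hence the lattice points of the \<open>m\<close>-th dilate
  are counted by \<open>\<Sum>C. (m + d - r C) choose d\<close>, summed over the facets \<open>C\<close>, where \<open>r C\<close> is the number
  of backward arcs (\<open>card_lattice_points\<close>), and \<open>h\<^sup>*\<^sub>j\<close> is the number of facets with \<open>r C = j\<close>. Reversing all
  arcs turns \<open>r C\<close> into \<open>d - r C\<close>, so the \<open>h\<^sup>*\<close>-vector is symmetric and the gamma vector exists.

  The dilates by 1 and 2 determine \<open>\<gamma>\<^sub>2\<close>. Let \<open>c = E - d\<close> be the nullity of a graph with \<open>E\<close> edges, and
  let the defect count the coincidences among sums of two edge vectors. If \<open>d \<ge> 4\<close> then
  \<open>\<gamma>\<^sub>2 = 2 c (c + 2) - defect\<close> (\<open>gamma_2_eq_gap\<close>), and if \<open>d < 4\<close> then \<open>\<gamma>\<^sub>2 = 0\<close> by definition.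

  The expression \<open>2 c (c + 2) - defect\<close>, the gap, does not increase when a vertex \<open>v\<close> is deleted, so it
  is nonnegative. Indeed, let \<open>N\<close> be the set of neighbours of \<open>v\<close>, let \<open>W\<close> be the set of vertices at
  distance two, and let \<open>H\<close> consist of the edges inside \<open>N\<close> and between \<open>N\<close> and \<open>W\<close>. The change of the
  defect is computed exactly (\<open>defect_after\<close>) and depends on \<open>H\<close> only. If \<open>M\<close> is the nullity of \<open>H\<close>
  together with the edges at \<open>v\<close>, and \<open>s\<close> of these \<open>M\<close> independent cycles need an edge at \<open>v\<close>, then the
  defect changes by at most \<open>2 s (2 M - s + 2)\<close> (\<open>local_inequality\<close>), whereas \<open>c\<close> grows by at least \<open>s\<close>
  from a value of at least \<open>M - s\<close>.

  If the gap of a connected bridgeless graph vanishes then equality holds at every vertex. This forces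
  \<open>c = M\<close>, so that every edge meets \<open>v\<close> or a neighbour of \<open>v\<close>; as \<open>v\<close> is arbitrary, non-adjacency is
  transitive and the graph is complete multipartite. Comparing the terms of the equality leaves only the
  two graphs of the theorem (\<open>book_structure\<close>), and for these the gap is zero (\<open>gap_book\<close>).
\<close>

section \<open>Flows on a symmetric relation and their costs\<close>

text \<open>An antisymmetric matrix encodes a flow without choosing an orientation of the edges.\<close>

definition flows :: "('n::finite \<times> 'n) set \<Rightarrow> (real ^ 'n ^ 'n) set" where
  "flows E = {g. transpose g = - g \<and> (\<forall>i j. g $ i $ j \<noteq> 0 \<longrightarrow> (i, j) \<in> E)}"

definition net :: "real ^ 'n ^ 'n::finite \<Rightarrow> real ^ 'n" where
  "net g = (\<chi> i. \<Sum>j\<in>UNIV. g $ i $ j)"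

text \<open>Every edge contributes two entries of opposite sign, hence the factor one half.\<close>

definition cost :: "('n \<Rightarrow> 'n \<Rightarrow> real) \<Rightarrow> real ^ 'n ^ 'n::finite \<Rightarrow> real" where
  "cost w g = (\<Sum>i\<in>UNIV. \<Sum>j\<in>UNIV. w i j * \<bar>g $ i $ j\<bar>) / 2"

definition arcs :: "real ^ 'n ^ 'n::finite \<Rightarrow> ('n \<times> 'n) set" where
  "arcs g = {(i, j). g $ i $ j > 0}"

definition strictly_optimal ::
  "('n \<Rightarrow> 'n \<Rightarrow> real) \<Rightarrow> ('n \<times> 'n) set \<Rightarrow> real ^ 'n ^ 'n::finite \<Rightarrow> bool" where
  "strictly_optimal w E g \<longleftrightarrow>
     g \<in> flows E \<and> (\<forall>h\<in>flows E. net h = net g \<longrightarrow> h \<noteq> g \<longrightarrow> cost w g < cost w h)"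

lemma flows_antisym: "g \<in> flows E \<Longrightarrow> g $ i $ j = - g $ j $ i"
proof -
  assume "g \<in> flows E"
  hence "transpose g $ j $ i = - g $ j $ i" by (simp add: flows_def)
  thus ?thesis by (simp add: transpose_def)
qed

lemma flowsI:
  assumes "\<And>i j. g $ i $ j = - g $ j $ i" "\<And>i j. g $ i $ j \<noteq> 0 \<Longrightarrow> (i, j) \<in> E"
  shows "g \<in> flows E"
proof -
  have "transpose g $ i $ j = (- g) $ i $ j" for i j
    using assms(1)[of j i] by (simp add: transpose_def)
  hence "transpose g = - g" unfolding vec_eq_iff by blast
  thus ?thesis using assms(2) by (simp add: flows_def)
qed

lemma flows_support: "g \<in> flows E \<Longrightarrow> g $ i $ j \<noteq> 0 \<Longrightarrow> (i, j) \<in> E"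
  unfolding flows_def by blast

lemma subspace_flows: "subspace (flows E)"
proof (rule subspaceI)
  show "0 \<in> flows E" by (rule flowsI) simp_all
  fix x y :: "real ^ 'a ^ 'a" and c :: real
  assume x: "x \<in> flows E"
  show "c *\<^sub>R x \<in> flows E"
  proof (rule flowsI)
    show "(c *\<^sub>R x) $ i $ j = - (c *\<^sub>R x) $ j $ i" for i j
      using flows_antisym[OF x, of i j] by simp
    show "(c *\<^sub>R x) $ i $ j \<noteq> 0 \<Longrightarrow> (i, j) \<in> E" for i j
      using flows_support[OF x, of i j] by auto
  qed
  assume y: "y \<in> flows E"
  show "x + y \<in> flows E"
  proof (rule flowsI)
    show "(x + y) $ i $ j = - (x + y) $ j $ i" for i j
      using flows_antisym[OF x, of i j] flows_antisym[OF y, of i j] by simp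
    show "(x + y) $ i $ j \<noteq> 0 \<Longrightarrow> (i, j) \<in> E" for i j
      using flows_support[OF x, of i j] flows_support[OF y, of i j] by fastforce
  qed
qed

lemmas flows_add = subspace_add[OF subspace_flows]
  and flows_diff = subspace_diff[OF subspace_flows]
  and flows_scale = subspace_scale[OF subspace_flows]
  and flows_zero = subspace_0[OF subspace_flows]
  and flows_neg = subspace_neg[OF subspace_flows]

lemma linear_net: "linear net"
  by (rule linearI) (simp_all add: net_def vec_eq_iff sum.distrib sum_distrib_left)

lemmas net_add = linear_add[OF linear_net]
  and net_diff = linear_diff[OF linear_net]
  and net_scale = linear_scale[OF linear_net]
  and net_neg = linear_neg[OF linear_net]
  and net_zero = linear_0[OF linear_net]

lemma net_nth: "net g $ i = (\<Sum>j\<in>UNIV. g $ i $ j)"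
  by (simp add: net_def)

lemma cost_scale: "0 \<le> c \<Longrightarrow> cost w (c *\<^sub>R g) = c * cost w g"
  by (simp add: cost_def abs_mult sum_distrib_left mult_ac)

lemma cost_minus: "cost w (- g) = cost w g"
  by (simp add: cost_def)

lemma cost_add_le:
  assumes "\<And>i j. 0 \<le> w i j"
  shows "cost w (g + h) \<le> cost w g + cost w h"
proof -
  have "(\<Sum>i\<in>UNIV. \<Sum>j\<in>UNIV. w i j * \<bar>(g + h) $ i $ j\<bar>)
      \<le> (\<Sum>i\<in>UNIV. \<Sum>j\<in>UNIV. w i j * \<bar>g $ i $ j\<bar> + w i j * \<bar>h $ i $ j\<bar>)"
    by (intro sum_mono) (simp add: assms mult_left_mono flip: distrib_left)
  thus ?thesis
    by (simp add: cost_def sum.distrib add_divide_distrib)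
qed

lemma entry_le_double_sum:
  fixes f :: "'n::finite \<Rightarrow> 'n \<Rightarrow> real"
  assumes "\<And>i j. 0 \<le> f i j"
  shows "f a b \<le> (\<Sum>i\<in>UNIV. \<Sum>j\<in>UNIV. f i j)"
proof -
  have "f a b \<le> (\<Sum>j\<in>UNIV. f a j)"
    by (rule member_le_sum) (auto simp: assms)
  also have "\<dots> \<le> (\<Sum>i\<in>UNIV. \<Sum>j\<in>UNIV. f i j)"
    by (rule member_le_sum[of a _ "\<lambda>i. \<Sum>j\<in>UNIV. f i j"]) (auto simp: assms sum_nonneg)
  finally show ?thesis .
qed

lemma dominating_factor:
  fixes g h :: "real ^ 'n ^ 'n::finite"
  assumes "\<And>i j. h $ i $ j \<noteq> 0 \<Longrightarrow> g $ i $ j \<noteq> 0"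
  obtains K where "K > 0" "\<And>i j. \<bar>h $ i $ j\<bar> \<le> K * \<bar>g $ i $ j\<bar>"
proof
  let ?f = "\<lambda>i j. \<bar>h $ i $ j\<bar> / \<bar>g $ i $ j\<bar>"
  let ?K = "1 + (\<Sum>i\<in>UNIV. \<Sum>j\<in>UNIV. ?f i j)"
  show "?K > 0"
    by (intro add_pos_nonneg sum_nonneg) auto
  fix i j
  show "\<bar>h $ i $ j\<bar> \<le> ?K * \<bar>g $ i $ j\<bar>"
  proof (cases "g $ i $ j = 0")
    case True
    thus ?thesis using assms by auto
  next
    case False
    have "?f i j \<le> ?K"
      using entry_le_double_sum[of ?f i j] by simp
    thus ?thesis using False by (simp add: divide_le_eq)
  qed
qed

text \<open>Whether a flow is strictly optimal depends only on its arcs: a cheaper or equally cheap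
  rerouting of \<open>h\<close> can be carried out, after scaling down, inside any flow that uses at least
  the arcs of \<open>h\<close>.\<close>

lemma strictly_optimal_mono:
  assumes w: "\<And>i j. 0 \<le> w i j" and g: "strictly_optimal w E g"
    and h: "h \<in> flows E" and sub: "arcs h \<subseteq> arcs g"
  shows "strictly_optimal w E h"
  unfolding strictly_optimal_def
proof (intro conjI ballI impI)
  fix h' assume h': "h' \<in> flows E" "net h' = net h" "h' \<noteq> h"
  have gE: "g \<in> flows E" using g by (simp add: strictly_optimal_def)
  have pos: "h $ i $ j > 0 \<Longrightarrow> g $ i $ j > 0" for i j
    using sub by (auto simp: arcs_def)
  have neg: "h $ i $ j < 0 \<Longrightarrow> g $ i $ j < 0" for i j
    using pos[of j i] flows_antisym[OF gE, of i j] flows_antisym[OF h, of i j] by simp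
  have supp: "h $ i $ j \<noteq> 0 \<Longrightarrow> g $ i $ j \<noteq> 0" for i j
    using pos[of i j] neg[of i j] by fastforce
  obtain K where K: "K > 0" "\<And>i j. \<bar>h $ i $ j\<bar> \<le> K * \<bar>g $ i $ j\<bar>"
    using dominating_factor[of h g] supp by metis
  define g' where "g' = g + (1 / K) *\<^sub>R (h' - h)"
  have "g' \<in> flows E"
    unfolding g'_def by (intro flows_add flows_scale flows_diff gE h h')
  moreover have "net g' = net g"
    by (simp add: g'_def net_add net_scale net_diff h')
  moreover have "g' \<noteq> g"
    using h' K by (simp add: g'_def)
  ultimately have less: "cost w g < cost w g'"
    using g by (simp add: strictly_optimal_def)
  have Kg': "K *\<^sub>R g' = (K *\<^sub>R g - h) + h'"
    using K by (simp add: g'_def algebra_simps)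
  have "w i j * \<bar>(K *\<^sub>R g - h) $ i $ j\<bar> = K * (w i j * \<bar>g $ i $ j\<bar>) - w i j * \<bar>h $ i $ j\<bar>" for i j
  proof -
    have "\<bar>K * g $ i $ j - h $ i $ j\<bar> = K * \<bar>g $ i $ j\<bar> - \<bar>h $ i $ j\<bar>"
      using K(2)[of i j] pos[of i j] neg[of i j] K(1)
      by (cases "h $ i $ j > 0"; cases "h $ i $ j < 0") (auto simp: abs_mult)
    thus ?thesis by (simp add: right_diff_distrib mult.left_commute)
  qed
  hence "cost w (K *\<^sub>R g - h) = K * cost w g - cost w h"
    by (simp add: cost_def sum_subtractf sum_distrib_left diff_divide_distrib)
  moreover have "K * cost w g' \<le> cost w (K *\<^sub>R g - h) + cost w h'"
    using cost_add_le[of w "K *\<^sub>R g - h" h'] w cost_scale[of K w g'] K by (simp add: Kg')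
  moreover have "K * cost w g < K * cost w g'"
    using less K by simp
  ultimately show "cost w h < cost w h'" by linarith
qed (rule h)

text \<open>As long as no entry changes its sign, the cost is an affine function. The conclusion covers both
  directions, as an optimality argument compares them.\<close>

lemma cost_locally_affine:
  fixes g y :: "real ^ 'n ^ 'n::finite"
  assumes "\<And>i j. y $ i $ j \<noteq> 0 \<Longrightarrow> g $ i $ j \<noteq> 0"
  obtains t where "t > 0"
    "cost w (g + t *\<^sub>R y) = cost w g + t * ((\<Sum>i\<in>UNIV. \<Sum>j\<in>UNIV. w i j * (sgn (g $ i $ j) * y $ i $ j)) / 2)"
    "cost w (g - t *\<^sub>R y) = cost w g - t * ((\<Sum>i\<in>UNIV. \<Sum>j\<in>UNIV. w i j * (sgn (g $ i $ j) * y $ i $ j)) / 2)"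
proof -
  obtain K where K: "K > 0" "\<And>i j. \<bar>y $ i $ j\<bar> \<le> K * \<bar>g $ i $ j\<bar>"
    using dominating_factor[of y g] assms by metis
  define t where "t = 1 / K"
  have t: "t > 0" using K by (simp add: t_def)
  have ty: "\<bar>t * y $ i $ j\<bar> \<le> \<bar>g $ i $ j\<bar>" for i j
    using K(2)[of i j] K(1) by (simp add: t_def abs_mult field_simps)
  have plus: "\<bar>(g + t *\<^sub>R y) $ i $ j\<bar> = \<bar>g $ i $ j\<bar> + t * (sgn (g $ i $ j) * y $ i $ j)" for i j
    using ty[of i j] by (cases "g $ i $ j" "0 :: real" rule: linorder_cases) auto
  have minus: "\<bar>(g - t *\<^sub>R y) $ i $ j\<bar> = \<bar>g $ i $ j\<bar> - t * (sgn (g $ i $ j) * y $ i $ j)" for i j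
    using ty[of i j] by (cases "g $ i $ j" "0 :: real" rule: linorder_cases) auto
  show ?thesis
  proof
    show "t > 0" by (rule t)
  qed (simp_all add: cost_def plus minus del: vector_add_component vector_minus_component
      add: distrib_left right_diff_distrib sum.distrib sum_subtractf sum_distrib_left
        add_divide_distrib diff_divide_distrib mult_ac)
qed

text \<open>A strictly optimal flow uses no cycle: pushing flow around a cycle inside its support
  changes the cost linearly, so one of the two directions would not raise it.\<close>

lemma strictly_optimal_acyclic:
  assumes g: "strictly_optimal w E g" and y: "y \<in> flows E" "net y = 0"
    and supp: "\<And>i j. y $ i $ j \<noteq> 0 \<Longrightarrow> g $ i $ j \<noteq> 0"
  shows "y = 0"
proof (rule ccontr)
  assume y0: "y \<noteq> 0"
  define d where "d = (\<Sum>i\<in>UNIV. \<Sum>j\<in>UNIV. w i j * (sgn (g $ i $ j) * y $ i $ j)) / 2"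
  obtain t where t: "t > 0" "cost w (g + t *\<^sub>R y) = cost w g + t * d"
    "cost w (g - t *\<^sub>R y) = cost w g - t * d"
    unfolding d_def by (rule cost_locally_affine[of y g w, OF supp])
  have gE: "g \<in> flows E" using g by (simp add: strictly_optimal_def)
  have "cost w g < cost w (g + t *\<^sub>R y)"
    using g t(1) y0 y gE unfolding strictly_optimal_def
    by (auto simp: net_add net_scale flows_add flows_scale)
  moreover have "cost w g < cost w (g - t *\<^sub>R y)"
    using g t(1) y0 y gE unfolding strictly_optimal_def
    by (auto simp: net_diff net_scale flows_diff flows_scale)
  ultimately show False using t by linarith
qed

text \<open>Closedness and the coercivity of the cost give a cheapest flow.\<close>

lemma closed_flows_with_net: "closed {g \<in> flows E. net g = x}"
proof -
  have "linear (transpose :: real ^ 'a ^ 'a \<Rightarrow> real ^ 'a ^ 'a)"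
    by (rule linearI) (simp_all add: transpose_def vec_eq_iff)
  hence "continuous_on UNIV (transpose :: real ^ 'a ^ 'a \<Rightarrow> real ^ 'a ^ 'a)"
    by (simp add: linear_continuous_on linear_conv_bounded_linear)
  moreover have "continuous_on UNIV (net :: real ^ 'a ^ 'a \<Rightarrow> real ^ 'a)"
    by (intro linear_continuous_on linear_conv_bounded_linear[THEN iffD1] linear_net)
  moreover have "{g \<in> flows E. net g = x} =
     {g. transpose g = - g} \<inter> (\<Inter>p\<in>-E. {g. g $ fst p $ snd p = 0}) \<inter> {g. net g = x}"
  proof -
    have "(\<forall>i j. g $ i $ j \<noteq> 0 \<longrightarrow> (i, j) \<in> E) \<longleftrightarrow> (\<forall>p\<in>-E. g $ fst p $ snd p = 0)"
      for g :: "real ^ 'a ^ 'a" by force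
    thus ?thesis unfolding flows_def by auto
  qed
  ultimately show ?thesis
    by (simp only:) (intro closed_Int closed_INT ballI closed_Collect_eq continuous_intros)
qed

lemma optimal_flow_exists:
  fixes w :: "'n::finite \<Rightarrow> 'n \<Rightarrow> real"
  assumes w: "\<And>i j. 1 \<le> w i j" and x: "x \<in> net ` flows E"
  obtains g where "g \<in> flows E" "net g = x" "\<And>h. h \<in> flows E \<Longrightarrow> net h = x \<Longrightarrow> cost w g \<le> cost w h"
proof -
  obtain g0 where g0: "g0 \<in> flows E" "net g0 = x" using x by auto
  define S where "S = {g \<in> flows E. net g = x} \<inter> {g. cost w g \<le> cost w g0}"
  have cont: "continuous_on A (cost w)" for A
    unfolding cost_def by (intro continuous_intros) auto
  have "closed {g. cost w g \<le> cost w g0}"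
    by (intro closed_Collect_le cont continuous_on_const)
  hence "closed S"
    unfolding S_def by (intro closed_Int closed_flows_with_net)
  moreover have "bounded S"
  proof -
    have w0: "0 \<le> w i j" for i j using w[of i j] by linarith
    have "norm g \<le> real CARD('n) * (real CARD('n) * (2 * cost w g0))" if "g \<in> S" for g
    proof -
      have entry: "\<bar>g $ i $ j\<bar> \<le> 2 * cost w g0" for i j
      proof -
        have "\<bar>g $ i $ j\<bar> \<le> w i j * \<bar>g $ i $ j\<bar>"
          using w[of i j] by (simp add: mult_le_cancel_right1)
        also have "\<dots> \<le> 2 * cost w g"
          using entry_le_double_sum[of "\<lambda>i j. w i j * \<bar>g $ i $ j\<bar>" i j] w0 by (simp add: cost_def)
        also have "\<dots> \<le> 2 * cost w g0" using that by (simp add: S_def)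
        finally show ?thesis .
      qed
      have "norm (g $ i) \<le> real CARD('n) * (2 * cost w g0)" for i
      proof -
        have "norm (g $ i) \<le> (\<Sum>j\<in>UNIV. norm (g $ i $ j))"
          unfolding norm_vec_def by (rule L2_set_le_sum) simp
        also have "\<dots> \<le> (\<Sum>j\<in>(UNIV::'n set). 2 * cost w g0)"
          by (intro sum_mono) (simp add: entry)
        finally show ?thesis by simp
      qed
      hence "(\<Sum>i\<in>UNIV. norm (g $ i)) \<le> (\<Sum>i\<in>(UNIV::'n set). real CARD('n) * (2 * cost w g0))"
        by (intro sum_mono)
      moreover have "norm g \<le> (\<Sum>i\<in>UNIV. norm (g $ i))"
        unfolding norm_vec_def[of g] by (rule L2_set_le_sum) simp
      ultimately show ?thesis by simp
    qed
    thus ?thesis unfolding bounded_iff by blast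
  qed
  ultimately have "compact S" by (simp add: compact_eq_bounded_closed)
  moreover have "S \<noteq> {}" using g0 by (auto simp: S_def)
  ultimately obtain g where g: "g \<in> S" "\<And>h. h \<in> S \<Longrightarrow> cost w g \<le> cost w h"
    using continuous_attains_inf[of S "cost w"] cont by blast
  show ?thesis
  proof
    show "g \<in> flows E" "net g = x" using g(1) by (auto simp: S_def)
    fix h assume "h \<in> flows E" "net h = x"
    thus "cost w g \<le> cost w h"
      using g(1) g(2)[of h] by (cases "cost w h \<le> cost w g0") (auto simp: S_def)
  qed
qed

text \<open>Follow the positive entries from row to row: a set of rows that the successor map permutes
  yields a circulation with entries \<open>-1, 0, 1\<close>.\<close>

lemma circulation_contains_unit_circulation:
  fixes z :: "real ^ 'n ^ 'n::finite"
  assumes z: "z \<in> flows E" "net z = 0" "z \<noteq> 0"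
  obtains y where "y \<in> flows E" "net y = 0" "y \<noteq> 0" "\<And>i j. y $ i $ j \<in> {-1, 0, 1}"
    "\<And>i j. y $ i $ j \<noteq> 0 \<Longrightarrow> z $ i $ j \<noteq> 0"
proof -
  define X where "X = {i. \<exists>j. z $ i $ j > 0}"
  obtain i0 j0 where "z $ i0 $ j0 \<noteq> 0"
    using z(3) by (auto simp: vec_eq_iff)
  hence "z $ i0 $ j0 > 0 \<or> z $ j0 $ i0 > 0"
    using flows_antisym[OF z(1), of i0 j0] by linarith
  hence X: "X \<noteq> {}" by (auto simp: X_def)
  have "\<forall>i\<in>X. \<exists>j. z $ i $ j > 0" by (auto simp: X_def)
  then obtain s where s: "\<And>i. i \<in> X \<Longrightarrow> z $ i $ s i > 0" by metis
  have sX: "s i \<in> X" if "i \<in> X" for i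
  proof (rule ccontr)
    assume "s i \<notin> X"
    hence le: "z $ s i $ j \<le> 0" for j by (auto simp: X_def not_less)
    have "(\<Sum>j\<in>UNIV. - z $ s i $ j) = 0"
      using z(2) by (simp add: net_def vec_eq_iff sum_negf)
    hence "- z $ s i $ i = 0"
      using le by (subst (asm) sum_nonneg_eq_0_iff) auto
    thus False using s[OF that] flows_antisym[OF z(1), of i "s i"] by simp
  qed
  \<comment> \<open>A smallest nonempty set of rows closed under the successor map is permuted by it.\<close>
  define P where "P C \<longleftrightarrow> C \<subseteq> X \<and> C \<noteq> {} \<and> s ` C \<subseteq> C" for C
  have "P X" using X sX by (auto simp: P_def)
  then obtain C where C: "P C" "\<And>C'. P C' \<Longrightarrow> card C \<le> card C'"
    using exists_least_iff[of "\<lambda>k. \<exists>C. P C \<and> card C = k"] by (metis not_less)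
  have "P (s ` C)" using C(1) by (auto simp: P_def)
  hence "card C \<le> card (s ` C)" by (rule C(2))
  hence sC: "s ` C = C"
    using C(1) by (intro card_seteq) (auto simp: P_def)
  hence inj: "inj_on s C"
    by (intro eq_card_imp_inj_on) auto
  have pos: "z $ i $ s i > 0" if "i \<in> C" for i
    using s that C(1) by (auto simp: P_def)
  define y :: "real ^ 'n ^ 'n" where
    "y = (\<chi> i j. of_bool (i \<in> C \<and> j = s i) - of_bool (j \<in> C \<and> i = s j))"
  have y: "y $ i $ j = of_bool (i \<in> C \<and> j = s i) - of_bool (j \<in> C \<and> i = s j)" for i j
    by (simp add: y_def)
  have supp: "z $ i $ j \<noteq> 0" if "y $ i $ j \<noteq> 0" for i j
  proof -
    have "(i \<in> C \<and> j = s i) \<or> (j \<in> C \<and> i = s j)"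
      using that by (auto simp: y of_bool_def split: if_splits)
    thus ?thesis
      using pos[of i] pos[of j] flows_antisym[OF z(1), of i j] by auto
  qed
  show ?thesis
  proof
    show "y \<in> flows E"
      using supp flows_support[OF z(1)] by (intro flowsI) (auto simp: y)
    show "net y = 0"
    proof (simp add: vec_eq_iff net_nth, rule)
      fix i
      have "(\<Sum>j\<in>UNIV. of_bool (i \<in> C \<and> j = s i) :: real) = of_bool (i \<in> C)"
        by (cases "i \<in> C") (simp_all add: of_bool_def)
      moreover have "(\<Sum>j\<in>UNIV. of_bool (j \<in> C \<and> i = s j) :: real) = of_bool (i \<in> C)"
      proof -
        have "(\<Sum>j\<in>UNIV. of_bool (j \<in> C \<and> i = s j) :: real) = (\<Sum>j\<in>C. of_bool (i = s j))"
          by (rule sum.mono_neutral_cong_right) auto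
        also have "\<dots> = (\<Sum>k\<in>s ` C. of_bool (i = k))"
          by (simp add: sum.reindex[OF inj])
        also have "\<dots> = of_bool (i \<in> C)"
          by (simp add: sC of_bool_def)
        finally show ?thesis .
      qed
      ultimately show "(\<Sum>j\<in>UNIV. y $ i $ j) = 0"
        by (simp add: y sum_subtractf)
    qed
    show "y \<noteq> 0"
    proof -
      obtain i where i: "i \<in> C" using C(1) by (auto simp: P_def)
      have "s i \<in> C" using i sC by auto
      have "s (s i) \<noteq> i"
        using pos[OF i] pos[OF \<open>s i \<in> C\<close>] flows_antisym[OF z(1), of i "s i"] by auto
      hence "y $ i $ s i = 1" using i by (simp add: y)
      thus ?thesis by auto
    qed
    show "y $ i $ j \<in> {-1, 0, 1}" for i j by (auto simp: y)
  qed (rule supp)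
qed

section \<open>Generic weights and the support of optimal flows\<close>

text \<open>Two cheapest flows with the same net would yield a vanishing signed sum of weights.\<close>

definition generic :: "('n::finite \<Rightarrow> 'n \<Rightarrow> real) \<Rightarrow> bool" where
  "generic w \<longleftrightarrow> (\<forall>\<tau>::'n \<Rightarrow> 'n \<Rightarrow> int. (\<forall>i j. \<bar>\<tau> i j\<bar> \<le> 1) \<longrightarrow>
     (\<Sum>i\<in>UNIV. \<Sum>j\<in>UNIV. w i j * of_int (\<tau> i j)) = 0 \<longrightarrow> (\<forall>i j. \<tau> i j = 0))"

text \<open>The weights are \<open>1 + 3 ^ f / 3 ^ K\<close> with distinct exponents \<open>f < K\<close>. In a signed sum of
  such numbers, scaled by \<open>3 ^ K\<close>, the term with the smallest \<open>f\<close> has the smallest 3-adic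
  valuation, so the sum does not vanish.\<close>

lemma generic_weights_exist:
  assumes "\<eta> > (0::real)"
  obtains w :: "'n::finite \<Rightarrow> 'n \<Rightarrow> real"
  where "generic w" "\<And>i j. 1 \<le> w i j" "\<And>i j. w i j \<le> 1 + \<eta>"
proof -
  obtain f :: "'n \<times> 'n \<Rightarrow> nat" where f: "inj f"
    using finite_imp_inj_to_nat_seg[of "UNIV :: ('n \<times> 'n) set"] by auto
  define B where "B = Suc (Max (range f))"
  have fB: "f p < B" for p by (simp add: B_def less_Suc_eq_le)
  obtain K' :: nat where K': "(1/3) ^ K' < \<eta>"
    using real_arch_pow_inv[of \<eta> "1/3"] assms by auto
  define K where "K = B + K'"
  define w :: "'n \<Rightarrow> 'n \<Rightarrow> real" where "w i j = 1 + 3 ^ f (i, j) / 3 ^ K" for i j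
  show ?thesis
  proof
    show "1 \<le> w i j" for i j by (simp add: w_def)
    show "w i j \<le> 1 + \<eta>" for i j
    proof -
      have "(3::real) ^ f (i, j) \<le> 3 ^ B" using fB[of "(i, j)"] by (intro power_increasing) auto
      hence "(3::real) ^ f (i, j) / 3 ^ K \<le> 3 ^ B / 3 ^ K" by (rule divide_right_mono) simp
      also have "\<dots> = (1/3) ^ K'" by (simp add: K_def power_add power_one_over)
      finally show ?thesis using K' by (simp add: w_def)
    qed
    show "generic w"
      unfolding generic_def
    proof (rule allI, intro impI, rule ccontr)
      fix \<tau> :: "'n \<Rightarrow> 'n \<Rightarrow> int"
      assume \<tau>: "\<forall>i j. \<bar>\<tau> i j\<bar> \<le> 1"
        and zero: "(\<Sum>i\<in>UNIV. \<Sum>j\<in>UNIV. w i j * of_int (\<tau> i j)) = 0"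
        and nz: "\<not> (\<forall>i j. \<tau> i j = 0)"
      define t where "t p = \<tau> (fst p) (snd p)" for p
      define T where "T = {p. t p \<noteq> 0}"
      have "T \<noteq> {}" using nz by (force simp: T_def t_def)
      \<comment> \<open>All other terms are divisible by a higher power of 3 than the term at \<open>p\<close>.\<close>
      then obtain p where p: "p \<in> T" "\<And>q. q \<in> T \<Longrightarrow> f p \<le> f q"
        using ex_min_if_finite[of "f ` T"] finite_subset[of T UNIV] by (force simp: not_less)
      have "(\<Sum>q\<in>UNIV. w (fst q) (snd q) * of_int (t q)) = 0"
        using zero by (simp add: sum.cartesian_product t_def split_def)
      hence "3 ^ K * (\<Sum>q\<in>UNIV. w (fst q) (snd q) * of_int (t q)) = 0" by simp
      also have "3 ^ K * (\<Sum>q\<in>UNIV. w (fst q) (snd q) * of_int (t q))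
          = real_of_int (\<Sum>q\<in>UNIV. (3 ^ K + 3 ^ f q) * t q)"
      proof -
        have "3 ^ K * (w (fst q) (snd q) * of_int (t q)) = real_of_int ((3 ^ K + 3 ^ f q) * t q)" for q
          by (simp add: w_def field_simps)
        thus ?thesis by (simp only: sum_distrib_left of_int_sum)
      qed
      finally have 0: "(\<Sum>q\<in>UNIV. (3 ^ K + 3 ^ f q) * t q) = 0"
        by (simp only: of_int_eq_0_iff)
      have K3: "(3::int) ^ Suc (f p) dvd 3 ^ K"
        using fB[of p] by (intro le_imp_power_dvd) (simp add: K_def)
      have "3 ^ Suc (f p) dvd (\<Sum>q\<in>UNIV - {p}. (3 ^ K + 3 ^ f q) * t q)"
      proof (intro dvd_sum)
        fix q assume q: "q \<in> UNIV - {p}"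
        show "3 ^ Suc (f p) dvd (3 ^ K + 3 ^ f q) * t q"
        proof (cases "t q = 0")
          case False
          hence "f p \<le> f q" using p(2) by (simp add: T_def)
          moreover have "f p \<noteq> f q" using q injD[OF f, of p q] by auto
          ultimately have "(3::int) ^ Suc (f p) dvd 3 ^ f q" by (intro le_imp_power_dvd) simp
          thus ?thesis using K3 by (intro dvd_mult2 dvd_add)
        qed simp
      qed
      moreover have "(\<Sum>q\<in>UNIV. (3 ^ K + 3 ^ f q) * t q)
          = (3 ^ K + 3 ^ f p) * t p + (\<Sum>q\<in>UNIV - {p}. (3 ^ K + 3 ^ f q) * t q)"
        by (rule sum.remove) auto
      hence "(3 ^ K + 3 ^ f p) * t p = - (\<Sum>q\<in>UNIV - {p}. (3 ^ K + 3 ^ f q) * t q)"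
        using 0 by linarith
      ultimately have "3 ^ Suc (f p) dvd (3 ^ K + 3 ^ f p) * t p"
        by (simp only: dvd_minus_iff)
      hence "3 ^ Suc (f p) dvd 3 ^ K * t p + 3 ^ f p * t p"
        by (simp add: distrib_right)
      moreover have "3 ^ Suc (f p) dvd 3 ^ K * t p"
        using K3 by (rule dvd_mult2)
      ultimately have "3 ^ f p * 3 dvd 3 ^ f p * t p"
        by (simp only: dvd_add_right_iff power_Suc2)
      hence "3 dvd t p" by (simp only: dvd_mult_cancel_left) simp
      moreover have "\<bar>t p\<bar> \<le> 1" "t p \<noteq> 0" using \<tau> p(1) by (simp_all add: t_def T_def)
      hence "t p = 1 \<or> t p = - 1" by arith
      ultimately show False by auto
    qed
  qed
qed

text \<open>The midpoint of two optimal flows is optimal and its support contains the support of their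
  difference, hence a unit circulation. Moving the midpoint along this circulation must not change
  the cost, which is a vanishing signed sum of weights.\<close>

lemma strictly_optimal_flow_exists:
  fixes w :: "'n::finite \<Rightarrow> 'n \<Rightarrow> real"
  assumes w: "\<And>i j. 1 \<le> w i j" and gen: "generic w" and x: "x \<in> net ` flows E"
  obtains g where "strictly_optimal w E g" "net g = x"
proof -
  obtain g where g: "g \<in> flows E" "net g = x"
    and opt: "\<And>h. h \<in> flows E \<Longrightarrow> net h = x \<Longrightarrow> cost w g \<le> cost w h"
    using optimal_flow_exists[of w x E] w x by metis
  have w0: "0 \<le> w i j" "0 < w i j" for i j using w[of i j] by linarith+
  have "strictly_optimal w E g"
    unfolding strictly_optimal_def
  proof (intro conjI ballI impI, rule g, rule ccontr)
    fix h assume h: "h \<in> flows E" "net h = net g" "h \<noteq> g" and "\<not> cost w g < cost w h"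
    hence eq: "cost w h = cost w g" using opt[of h] g by simp
    define m where "m = (1 / 2) *\<^sub>R (g + h)"
    have m: "m \<in> flows E" "net m = x"
      using g h by (auto simp: m_def flows_add flows_scale net_add net_scale simp flip: scaleR_2)
    have "cost w (g + h) = 2 * cost w m"
      using cost_scale[of 2 w m] by (simp add: m_def)
    also have "\<dots> \<ge> 2 * cost w g" using opt[OF m] by simp
    finally have le: "cost w g + cost w h \<le> cost w (g + h)" using eq by simp
    have same_sign: "\<bar>g $ i $ j\<bar> + \<bar>h $ i $ j\<bar> = \<bar>g $ i $ j + h $ i $ j\<bar>" for i j
    proof -
      let ?f = "\<lambda>i j. w i j * (\<bar>g $ i $ j\<bar> + \<bar>h $ i $ j\<bar> - \<bar>g $ i $ j + h $ i $ j\<bar>)"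
      have nn: "0 \<le> ?f i j" for i j
        using w0 abs_triangle_ineq[of "g $ i $ j" "h $ i $ j"] by simp
      have "(\<Sum>i\<in>UNIV. \<Sum>j\<in>UNIV. ?f i j) = 2 * (cost w g + cost w h - cost w (g + h))"
        by (simp add: cost_def sum.distrib sum_subtractf algebra_simps)
      hence "?f i j \<le> 0"
        using entry_le_double_sum[of ?f i j] nn le by simp
      hence "\<bar>g $ i $ j\<bar> + \<bar>h $ i $ j\<bar> \<le> \<bar>g $ i $ j + h $ i $ j\<bar>"
        using w0(2)[of i j] by (simp add: mult_le_0_iff)
      thus ?thesis using abs_triangle_ineq[of "g $ i $ j" "h $ i $ j"] by simp
    qed
    obtain y where y: "y \<in> flows E" "net y = 0" "y \<noteq> 0" "\<And>i j. y $ i $ j \<in> {-1, 0, 1}"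
      "\<And>i j. y $ i $ j \<noteq> 0 \<Longrightarrow> (h - g) $ i $ j \<noteq> 0"
      using circulation_contains_unit_circulation[of "h - g" E] g h
      by (metis flows_diff net_diff right_minus_eq)
    have supp: "m $ i $ j \<noteq> 0" if "y $ i $ j \<noteq> 0" for i j
      using y(5)[OF that] same_sign[of i j] by (auto simp: m_def)
    define d where "d = (\<Sum>i\<in>UNIV. \<Sum>j\<in>UNIV. w i j * (sgn (m $ i $ j) * y $ i $ j)) / 2"
    obtain t where t: "t > 0" "cost w (m + t *\<^sub>R y) = cost w m + t * d"
      "cost w (m - t *\<^sub>R y) = cost w m - t * d"
      unfolding d_def by (rule cost_locally_affine[of y m w, OF supp])
    have "cost w m \<le> cost w g"
      using cost_add_le[of w g h] w0 eq cost_scale[of "1/2" w "g + h"] by (simp add: m_def)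
    moreover have "cost w g \<le> cost w (m + t *\<^sub>R y)"
      using m y by (intro opt) (auto simp: flows_add flows_scale net_add net_scale)
    moreover have "cost w g \<le> cost w (m - t *\<^sub>R y)"
      using m y by (intro opt) (auto simp: flows_diff flows_scale net_diff net_scale)
    ultimately have "0 \<le> t * d \<and> t * d \<le> 0" using t by linarith
    hence "d = 0" using t(1) by (simp add: zero_le_mult_iff mult_le_0_iff)
    have "\<exists>k. real_of_int k = sgn (m $ i $ j) * y $ i $ j \<and> \<bar>k\<bar> \<le> 1" for i j
    proof -
      have "sgn (m $ i $ j) * y $ i $ j \<in> real_of_int ` {-1, 0, 1}"
        using y(4)[of i j] by (auto simp: sgn_if)
      thus ?thesis by force
    qed
    then obtain \<tau> where \<tau>: "\<And>i j. real_of_int (\<tau> i j) = sgn (m $ i $ j) * y $ i $ j"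
      "\<And>i j. \<bar>\<tau> i j\<bar> \<le> 1"
      by metis
    have "(\<Sum>i\<in>UNIV. \<Sum>j\<in>UNIV. w i j * of_int (\<tau> i j)) = 0"
      using \<open>d = 0\<close> by (simp add: d_def \<tau>(1))
    hence "\<tau> i j = 0" for i j
      using gen \<tau>(2) by (simp add: generic_def)
    hence "y $ i $ j = 0" for i j
      using \<tau>(1)[of i j] supp[of i j] by (auto simp: sgn_zero_iff)
    hence "y = 0" by (simp add: vec_eq_iff)
    thus False using y(3) by contradiction
  qed
  thus ?thesis using that g by blast
qed

lemma strictly_optimal_unique:
  assumes "strictly_optimal w E g" "strictly_optimal w E h" "net g = net h"
  shows "g = h"
proof (rule ccontr)
  assume "g \<noteq> h"
  hence "cost w g < cost w h" "cost w h < cost w g"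
    using assms by (simp_all add: strictly_optimal_def)
  thus False by simp
qed

definition unit_flow :: "'n \<Rightarrow> 'n \<Rightarrow> real ^ 'n ^ 'n::finite" where
  "unit_flow a b = (\<chi> i j. of_bool (i = a \<and> j = b) - of_bool (i = b \<and> j = a))"

lemma unit_flow_in_flows: "sym E \<Longrightarrow> (a, b) \<in> E \<Longrightarrow> unit_flow a b \<in> flows E"
proof (rule flowsI)
  show "unit_flow a b $ i $ j = - unit_flow a b $ j $ i" for i j
    by (simp add: unit_flow_def conj_commute)
  assume E: "sym E" "(a, b) \<in> E"
  fix i j assume "unit_flow a b $ i $ j \<noteq> 0"
  hence "(i, j) = (a, b) \<or> (i, j) = (b, a)"
    by (cases "i = a \<and> j = b") (simp_all add: unit_flow_def)
  thus "(i, j) \<in> E" using E by (auto dest: symD)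
qed

lemma net_unit_flow: "net (unit_flow a b) = axis a 1 - axis b 1"
proof -
  have "(\<Sum>j\<in>UNIV. of_bool (i = a \<and> j = b)) = (of_bool (i = a) :: real)" for i a b :: 'a
    by (cases "i = a") (simp_all add: of_bool_def)
  thus ?thesis
    by (simp add: vec_eq_iff net_nth unit_flow_def axis_def sum_subtractf)
qed

lemma path_flow:
  assumes "sym E" "(a, b) \<in> E\<^sup>*"
  obtains y where "y \<in> flows E" "net y = axis a 1 - axis b 1"
proof -
  have "\<exists>y. y \<in> flows E \<and> net y = axis a 1 - axis b 1"
    using assms(2)
  proof induction
    case base
    show ?case by (rule exI[of _ 0]) (simp add: flows_zero net_zero)
  next
    case (step b c)
    then obtain y where "y \<in> flows E" "net y = axis a 1 - axis b 1" by blast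
    thus ?case
      using step(2) assms(1)
      by (intro exI[of _ "y + unit_flow b c"])
        (simp add: flows_add unit_flow_in_flows net_add net_unit_flow)
  qed
  thus ?thesis using that by blast
qed

lemma net_sum_cut:
  assumes "h \<in> flows E"
  shows "(\<Sum>i\<in>S. net h $ i) = (\<Sum>i\<in>S. \<Sum>j\<in>-S. h $ i $ j)"
proof -
  have "(\<Sum>i\<in>S. \<Sum>j\<in>S. h $ i $ j) = (\<Sum>i\<in>S. \<Sum>j\<in>S. - h $ j $ i)"
    by (intro sum.cong refl) (simp add: flows_antisym[OF assms, symmetric])
  also have "\<dots> = - (\<Sum>i\<in>S. \<Sum>j\<in>S. h $ i $ j)"
    by (subst sum.swap) (simp add: sum_negf)
  finally have 0: "(\<Sum>i\<in>S. \<Sum>j\<in>S. h $ i $ j) = 0" by simp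
  have "(\<Sum>i\<in>S. net h $ i) = (\<Sum>i\<in>S. (\<Sum>j\<in>S. h $ i $ j) + (\<Sum>j\<in>-S. h $ i $ j))"
    by (intro sum.cong refl) (simp add: net_nth sum.union_disjoint[symmetric])
  thus ?thesis using 0 by (simp add: sum.distrib)
qed

text \<open>For the support of a flow this says that the edges form a forest.\<close>

definition circulation_free :: "('n::finite \<times> 'n) set \<Rightarrow> bool" where
  "circulation_free F \<longleftrightarrow> (\<forall>y\<in>flows F. net y = 0 \<longrightarrow> y = 0)"

text \<open>The component of \<open>a\<close> after the edge between \<open>a\<close> and \<open>b\<close> has been removed.\<close>

definition side :: "('n \<times> 'n) set \<Rightarrow> 'n \<Rightarrow> 'n \<Rightarrow> 'n set" where
  "side F a b = (F - {(a, b), (b, a)})\<^sup>* `` {a}"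

lemma other_end_not_in_side:
  assumes "sym F" "circulation_free F" "(a, b) \<in> F" "a \<noteq> b"
  shows "b \<notin> side F a b"
proof
  let ?F = "F - {(a, b), (b, a)}"
  assume "b \<in> side F a b"
  moreover have "sym ?F" using assms(1) by (auto simp: sym_def)
  ultimately obtain y where y: "y \<in> flows ?F" "net y = axis a 1 - axis b 1"
    using path_flow[of ?F a b] by (auto simp: side_def)
  have "y \<in> flows F" using y(1) by (auto simp: flows_def)
  hence "y - unit_flow a b \<in> flows F"
    using assms by (intro flows_diff unit_flow_in_flows)
  moreover have "net (y - unit_flow a b) = 0"
    using y(2) by (simp add: net_diff net_unit_flow)
  ultimately have "y - unit_flow a b = 0"
    using assms(2) unfolding circulation_free_def by blast
  hence "y $ a $ b = unit_flow a b $ a $ b" by simp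
  moreover have "y $ a $ b = 0" using flows_support[OF y(1), of a b] by auto
  ultimately show False using assms(4) by (simp add: unit_flow_def)
qed

text \<open>In a forest the flow on an arc is the total net flow on one side of it. This is where the
  integrality of the optimal flows comes from.\<close>

lemma forest_flow_eq_side_sum:
  assumes "sym F" "circulation_free F" "(a, b) \<in> F" "a \<noteq> b" "h \<in> flows F"
  shows "h $ a $ b = (\<Sum>i\<in>side F a b. net h $ i)"
proof -
  let ?F = "F - {(a, b), (b, a)}"
  let ?S = "side F a b"
  have a: "a \<in> ?S" by (simp add: side_def)
  have b: "b \<notin> ?S" using assms by (intro other_end_not_in_side)
  have cross: "h $ i $ j = 0" if "i \<in> ?S" "j \<notin> ?S" "\<not> (i = a \<and> j = b)" for i j
  proof (rule ccontr)
    assume "h $ i $ j \<noteq> 0"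
    hence "(i, j) \<in> F" by (rule flows_support[OF assms(5)])
    hence "(i, j) \<in> ?F" using that a b by auto
    hence "j \<in> ?S" using that(1) by (auto simp: side_def intro: rtrancl_into_rtrancl)
    thus False using that by blast
  qed
  have "(\<Sum>i\<in>?S. net h $ i) = (\<Sum>i\<in>?S. \<Sum>j\<in>-?S. h $ i $ j)"
    by (rule net_sum_cut[OF assms(5)])
  also have "\<dots> = (\<Sum>i\<in>{a}. \<Sum>j\<in>-?S. h $ i $ j)"
    using a b cross by (intro sum.mono_neutral_right) (auto intro!: sum.neutral)
  also have "\<dots> = (\<Sum>j\<in>-?S. h $ a $ j)" by simp
  also have "\<dots> = (\<Sum>j\<in>{b}. h $ a $ j)"
    using a b cross by (intro sum.mono_neutral_right) auto
  finally show ?thesis by simp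
qed

section \<open>Lattice points as fillings of facets\<close>

subsection \<open>Counting fillings\<close>

text \<open>The integral flows along the arcs of a facet \<open>C\<close>; on the arcs in \<open>R\<close> the value zero is excluded, so
  that every lattice point comes from one facet only.\<close>

definition fillings :: "'a set \<Rightarrow> 'a set \<Rightarrow> nat \<Rightarrow> ('a \<Rightarrow> nat) set" where
  "fillings C R m = {f. (\<forall>p. p \<notin> C \<longrightarrow> f p = 0) \<and> (\<forall>p\<in>R. 1 \<le> f p) \<and> sum f C \<le> m}"

lemma hockey_stick:
  assumes "a \<le> D"
  shows "(\<Sum>j\<le>M. (j + a) choose D) = (M + a + 1) choose Suc D"
  using assms by (induction M) (auto simp: le_less)

lemma fillings_insert:
  assumes "finite C" "c \<notin> C" "R \<subseteq> insert c C"
  shows "fillings (insert c C) R m =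
    (\<lambda>(k, f). f(c := k)) ` (SIGMA k:{of_bool (c \<in> R)..m}. fillings C (R - {c}) (m - k))"
    (is "?L = ?g ` ?S")
proof
  show "?L \<subseteq> ?g ` ?S"
  proof
    fix f assume f: "f \<in> ?L"
    have sum: "(\<Sum>x\<in>C. if x = c then 0 else f x) = sum f C"
      using assms by (intro sum.cong) auto
    have "f = ?g (f c, f(c := 0))" by simp
    moreover have "(f c, f(c := 0)) \<in> ?S"
      using f assms unfolding fillings_def by (auto simp: sum of_bool_def)
    ultimately show "f \<in> ?g ` ?S" by blast
  qed
  show "?g ` ?S \<subseteq> ?L"
  proof (clarify)
    fix k f assume k: "k \<in> {of_bool (c \<in> R)..m}" and f: "f \<in> fillings C (R - {c}) (m - k)"
    have sum: "(\<Sum>x\<in>C. if x = c then k else f x) = sum f C"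
      using assms by (intro sum.cong) auto
    show "f(c := k) \<in> ?L"
      using k f assms unfolding fillings_def by (auto simp: sum of_bool_def split: if_splits)
  qed
qed

text \<open>Induction on \<open>C\<close>: split off the value at one arc and sum the remaining counts along a diagonal of
  Pascal's triangle.\<close>

lemma card_fillings:
  assumes "finite C" "R \<subseteq> C"
  shows "finite (fillings C R m) \<and> card (fillings C R m) = (m + card C - card R) choose card C"
  using assms
proof (induction C arbitrary: R m rule: finite_induct)
  case empty
  have "fillings {} R m = {\<lambda>_. 0}" using empty by (auto simp: fillings_def)
  thus ?case using empty by simp
next
  case (insert c C)
  let ?r = "of_bool (c \<in> R) :: nat"
  let ?S = "SIGMA k:{?r..m}. fillings C (R - {c}) (m - k)"
  have R': "R - {c} \<subseteq> C" using insert by auto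
  have fin: "finite R" using insert finite_subset by blast
  have cardR: "card R = card (R - {c}) + ?r"
    using card_Suc_Diff1[OF fin, of c] by (cases "c \<in> R") auto
  have \<rho>: "card (R - {c}) \<le> card C"
    using R' insert by (intro card_mono) auto
  have "inj_on (\<lambda>(k, f). f(c := k)) ?S"
  proof (rule inj_onI, clarify)
    fix k f k' f'
    assume f: "f \<in> fillings C (R - {c}) (m - k)" "f' \<in> fillings C (R - {c}) (m - k')"
      and eq: "f(c := k) = f'(c := k')"
    have "f c = 0" "f' c = 0" using f insert by (auto simp: fillings_def)
    thus "k = k' \<and> f = f'" using eq by (metis fun_upd_same fun_upd_triv fun_upd_upd)
  qed
  hence "card (fillings (insert c C) R m) = card ?S"
    using fillings_insert[OF insert(1,2,4)] by (simp add: card_image)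
  also have "\<dots> = (\<Sum>k\<in>{?r..m}. card (fillings C (R - {c}) (m - k)))"
    using insert.IH[OF R'] by (intro card_SigmaI) auto
  also have "\<dots> = (\<Sum>k\<in>{?r..m}. (m - k + card C - card (R - {c})) choose card C)"
    using insert.IH[OF R'] by simp
  also have "\<dots> = (m + card (insert c C) - card R) choose card (insert c C)"
  proof -
    obtain r D \<rho>' where abbr: "r = ?r" "D = card C" "\<rho>' = card (R - {c})" by blast
    have facts: "\<rho>' \<le> D" "card R = \<rho>' + r" "card (insert c C) = Suc D" "r \<le> 1"
      using \<rho> cardR insert(1,2) by (simp_all add: abbr)
    have "(\<Sum>k\<in>{r..m}. (m - k + D - \<rho>') choose D) = (m + Suc D - (\<rho>' + r)) choose Suc D"
    proof (cases "r \<le> m")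
      case True
      have "(\<Sum>k\<in>{r..m}. (m - k + D - \<rho>') choose D) = (\<Sum>j\<le>m - r. (j + (D - \<rho>')) choose D)"
        using True facts(1) by (intro sum.reindex_bij_witness[of _ "\<lambda>j. m - j" "\<lambda>k. m - k"]) auto
      also have "\<dots> = (m - r + (D - \<rho>') + 1) choose Suc D"
        by (rule hockey_stick) simp
      also have "m - r + (D - \<rho>') + 1 = m + Suc D - (\<rho>' + r)"
        using True facts(1) by simp
      finally show ?thesis .
    next
      case False
      hence "m = 0" "r = 1" using facts(4) by simp_all
      thus ?thesis using facts(1) by simp
    qed
    thus ?thesis unfolding facts(2,3) by (simp only: abbr)
  qed
  finally have "card (fillings (insert c C) R m) = \<dots>" .
  moreover have "finite (fillings (insert c C) R m)"
    unfolding fillings_insert[OF insert(1,2,4)]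
    using insert.IH[OF R'] by (intro finite_imageI finite_SigmaI) auto
  ultimately show ?case by blast
qed

subsection \<open>The perturbing demand\<close>

text \<open>Each vertex sends one unit to an anchor of its component. No nonempty proper subset of a component
  has net demand zero.\<close>

definition anchor :: "('n \<times> 'n) set \<Rightarrow> 'n \<Rightarrow> 'n" where
  "anchor E i = (SOME j. j \<in> E\<^sup>* `` {i})"

definition anchor_demand :: "('n::finite \<times> 'n) set \<Rightarrow> real ^ 'n" where
  "anchor_demand E = (\<Sum>i\<in>UNIV. axis i 1 - axis (anchor E i) 1)"

lemma anchor_reachable: "(i, anchor E i) \<in> E\<^sup>*"
  using someI[of "\<lambda>j. j \<in> E\<^sup>* `` {i}" i] by (simp add: anchor_def)

lemma anchor_eq:
  assumes "sym E" "(i, j) \<in> E\<^sup>*"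
  shows "anchor E i = anchor E j"
proof -
  have "(j, i) \<in> E\<^sup>*" using assms by (metis sym_rtrancl symD)
  hence "E\<^sup>* `` {i} = E\<^sup>* `` {j}"
    using assms(2) by (auto intro: rtrancl_trans)
  thus ?thesis by (simp add: anchor_def)
qed

lemma sum_anchor_demand:
  "(\<Sum>k\<in>S. anchor_demand E $ k) = real (card S) - real (card {i. anchor E i \<in> S})"
proof -
  have eq: "(\<Sum>k\<in>S. axis a 1 $ k) = (of_bool (a \<in> S) :: real)" for a :: 'a
    by (simp add: axis_def of_bool_def)
  have "(\<Sum>k\<in>S. anchor_demand E $ k)
      = (\<Sum>k\<in>S. \<Sum>i\<in>UNIV. axis i 1 $ k - axis (anchor E i) 1 $ k)"
    by (simp add: anchor_demand_def)
  also have "\<dots> = (\<Sum>i\<in>UNIV. \<Sum>k\<in>S. axis i 1 $ k - axis (anchor E i) 1 $ k)"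
    by (rule sum.swap)
  also have "\<dots> = (\<Sum>i\<in>UNIV. of_bool (i \<in> S)) - (\<Sum>i\<in>UNIV. of_bool (anchor E i \<in> S))"
    by (simp add: sum_subtractf eq)
  finally show ?thesis by (simp add: of_bool_def sum.If_cases)
qed

lemma abs_sum_anchor_demand_le: "\<bar>\<Sum>k\<in>S. anchor_demand E $ k\<bar> \<le> real CARD('n)"
  for E :: "('n::finite \<times> 'n) set"
proof -
  have "card A \<le> CARD('n)" for A :: "'n set" by (rule card_mono) auto
  hence "real (card S) \<le> real CARD('n)" "real (card {i. anchor E i \<in> S}) \<le> real CARD('n)"
    by simp_all
  thus ?thesis unfolding sum_anchor_demand by linarith
qed

text \<open>The demand of \<open>S\<close> is its size minus the number of vertices whose anchor lies in \<open>S\<close>, and the latter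
  is either zero or the size of the whole component of \<open>a\<close>.\<close>

lemma sum_anchor_demand_neq_0:
  assumes "sym E" "a \<in> S" "S \<subseteq> E\<^sup>* `` {a}" "anchor E a \<in> S \<Longrightarrow> \<exists>b. (a, b) \<in> E\<^sup>* \<and> b \<notin> S"
  shows "(\<Sum>k\<in>S. anchor_demand E $ k) \<noteq> 0"
proof -
  have root: "anchor E i = anchor E a" if "(a, i) \<in> E\<^sup>*" for i
    using anchor_eq[OF assms(1) that] by simp
  show ?thesis
  proof (cases "anchor E a \<in> S")
    case True
    then obtain b where "(a, b) \<in> E\<^sup>*" "b \<notin> S" using assms(4) by blast
    have mem: "anchor E i \<in> S" if "(a, i) \<in> E\<^sup>*" for i
      using root[OF that] True by simp
    have "S \<subseteq> {i. anchor E i \<in> S}" using assms(3) mem by blast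
    moreover have "b \<in> {i. anchor E i \<in> S}" using mem[OF \<open>(a, b) \<in> E\<^sup>*\<close>] by blast
    ultimately have "S \<subset> {i. anchor E i \<in> S}" using \<open>b \<notin> S\<close> by blast
    hence "card S < card {i. anchor E i \<in> S}" by (intro psubset_card_mono) auto
    thus ?thesis by (simp add: sum_anchor_demand)
  next
    case False
    have "i \<notin> S" if "anchor E j = i" for i j
    proof
      assume i: "i \<in> S"
      have "(a, i) \<in> E\<^sup>*" using i assms(3) by auto
      moreover have "(j, i) \<in> E\<^sup>*" using anchor_reachable[of j E] that by simp
      ultimately have "anchor E j = anchor E a"
        using anchor_eq[OF assms(1)] by metis
      thus False using that i False by simp
    qed
    hence "{i. anchor E i \<in> S} = {}" by blast
    moreover have "S \<noteq> {}" using assms(2) by auto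
    ultimately show ?thesis by (simp add: sum_anchor_demand)
  qed
qed

lemma anchor_demand_in_net:
  assumes "sym F" "\<And>i. (i, anchor E i) \<in> F\<^sup>*"
  shows "anchor_demand E \<in> net ` flows F"
proof -
  have "\<exists>y. y \<in> flows F \<and> net y = axis i 1 - axis (anchor E i) 1" for i
    using path_flow[OF assms(1) assms(2)[of i]] by metis
  then obtain y where y: "\<And>i. y i \<in> flows F" "\<And>i. net (y i) = axis i 1 - axis (anchor E i) 1"
    by metis
  have "net (\<Sum>i\<in>UNIV. y i) = anchor_demand E"
    by (simp add: linear_sum[OF linear_net] y anchor_demand_def)
  moreover have "(\<Sum>i\<in>UNIV. y i) \<in> flows F"
    by (intro subspace_sum subspace_flows y)
  ultimately show ?thesis by (metis imageI)
qed

subsection \<open>Facets\<close>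

lemma flows_mono: "F \<subseteq> E \<Longrightarrow> flows F \<subseteq> flows E"
  by (auto simp: flows_def)

lemma arcs_sym_closure:
  assumes "g \<in> flows E"
  shows "arcs g \<union> (arcs g)\<inverse> = {(i, j). g $ i $ j \<noteq> 0}"
proof -
  have "(i, j) \<in> arcs g \<union> (arcs g)\<inverse> \<longleftrightarrow> g $ i $ j \<noteq> 0" for i j
    using flows_antisym[OF assms, of i j] by (auto simp: arcs_def)
  thus ?thesis by auto
qed

definition lattice_points :: "('n::finite \<times> 'n) set \<Rightarrow> nat \<Rightarrow> (real ^ 'n) set" where
  "lattice_points E m =
    {x. (\<forall>i. x $ i \<in> \<int>) \<and> (\<exists>h\<in>flows E. net h = x \<and> cost (\<lambda>_ _. 1) h \<le> real m)}"

definition flow_of :: "('n \<times> 'n \<Rightarrow> nat) \<Rightarrow> real ^ 'n ^ 'n::finite" where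
  "flow_of f = (\<chi> i j. real (f (i, j)) - real (f (j, i)))"

text \<open>The bound on \<open>\<epsilon>\<close> keeps the perturbation of every arc of a forest below 1, so that it cannot change
  an integral flow to the next integer.\<close>

locale weighted_relation =
  fixes E :: "('n::finite \<times> 'n) set" and w :: "'n \<Rightarrow> 'n \<Rightarrow> real" and \<epsilon> :: real
  assumes sym: "sym E" and irrefl: "irrefl E" and w1: "\<And>i j. 1 \<le> w i j" and generic: "generic w"
    and \<epsilon>_pos: "\<epsilon> > 0" and \<epsilon>_small: "\<epsilon> * real CARD('n) < 1"
begin

text \<open>Oriented spanning forests: being the arcs of a strictly optimal flow excludes cycles, and the second
  condition makes the forest connect whatever \<open>E\<close> connects.\<close>

definition facets :: "('n \<times> 'n) set set" where
  "facets = {C. \<exists>g. strictly_optimal w E g \<and> C = arcs g \<and> E \<subseteq> (C \<union> C\<inverse>)\<^sup>*}"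

definition tree_flow :: "('n \<times> 'n) set \<Rightarrow> real ^ 'n ^ 'n" where
  "tree_flow C = (THE y. y \<in> flows (C \<union> C\<inverse>) \<and> net y = anchor_demand E)"

text \<open>On these arcs the perturbation runs backwards, so the unperturbed flow has to be positive.\<close>

definition down_arcs :: "('n \<times> 'n) set \<Rightarrow> ('n \<times> 'n) set" where
  "down_arcs C = {(i, j) \<in> C. tree_flow C $ i $ j < 0}"

lemma w0: "0 \<le> w i j" using w1[of i j] by linarith

lemma sym_closure: "sym (C \<union> C\<inverse>)" for C :: "('n \<times> 'n) set"
  by (auto simp: sym_def)

lemma facet_antisym: "C \<in> facets \<Longrightarrow> (i, j) \<in> C \<Longrightarrow> (j, i) \<notin> C"
proof -
  assume "C \<in> facets" "(i, j) \<in> C"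
  then obtain g where g: "g \<in> flows E" "C = arcs g"
    by (auto simp: facets_def strictly_optimal_def)
  thus ?thesis
    using \<open>(i, j) \<in> C\<close> flows_antisym[OF g(1), of i j] by (auto simp: arcs_def)
qed

lemma facet_subset: "C \<in> facets \<Longrightarrow> C \<union> C\<inverse> \<subseteq> E"
proof -
  assume "C \<in> facets"
  then obtain g where g: "g \<in> flows E" "C = arcs g"
    by (auto simp: facets_def strictly_optimal_def)
  thus ?thesis
    using flows_support[OF g(1)] symD[OF sym] by (force simp: arcs_def)
qed

lemma facet_spans: "C \<in> facets \<Longrightarrow> E\<^sup>* = (C \<union> C\<inverse>)\<^sup>*"
proof -
  assume C: "C \<in> facets"
  hence "E \<subseteq> (C \<union> C\<inverse>)\<^sup>*" by (auto simp: facets_def)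
  thus ?thesis using facet_subset[OF C]
    by (metis rtrancl_subset)
qed

lemma arcs_circulation_free:
  assumes g: "strictly_optimal w E g"
  shows "circulation_free (arcs g \<union> (arcs g)\<inverse>)"
  unfolding circulation_free_def
proof (intro ballI impI)
  have gE: "g \<in> flows E" using g by (simp add: strictly_optimal_def)
  fix y assume y: "y \<in> flows (arcs g \<union> (arcs g)\<inverse>)" "net y = 0"
  have supp: "g $ i $ j \<noteq> 0" if "y $ i $ j \<noteq> 0" for i j
    using flows_support[OF y(1) that] unfolding arcs_sym_closure[OF gE] by simp
  have "arcs g \<union> (arcs g)\<inverse> \<subseteq> E"
    unfolding arcs_sym_closure[OF gE] using flows_support[OF gE] by auto
  hence "y \<in> flows E" using y flows_mono by blast
  thus "y = 0" using strictly_optimal_acyclic[OF g _ y(2) supp] by blast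
qed

lemma facet_circulation_free: "C \<in> facets \<Longrightarrow> circulation_free (C \<union> C\<inverse>)"
  using arcs_circulation_free by (auto simp: facets_def)

lemma tree_flow:
  assumes C: "C \<in> facets"
  shows "tree_flow C \<in> flows (C \<union> C\<inverse>)" "net (tree_flow C) = anchor_demand E"
proof -
  have "anchor_demand E \<in> net ` flows (C \<union> C\<inverse>)"
    using anchor_demand_in_net[OF sym_closure[of C], of E] anchor_reachable[of _ E]
    by (simp add: facet_spans[OF C])
  then obtain y where y: "y \<in> flows (C \<union> C\<inverse>)" "net y = anchor_demand E" by auto
  have "tree_flow C \<in> flows (C \<union> C\<inverse>) \<and> net (tree_flow C) = anchor_demand E"
    unfolding tree_flow_def
  proof (rule theI[of _ y], rule conjI[OF y])
    fix z assume z: "z \<in> flows (C \<union> C\<inverse>) \<and> net z = anchor_demand E"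
    hence "z - y \<in> flows (C \<union> C\<inverse>)" "net (z - y) = 0"
      using y by (auto simp: flows_diff net_diff)
    hence "z - y = 0"
      using facet_circulation_free[OF C] unfolding circulation_free_def by blast
    thus "z = y" by simp
  qed
  thus "tree_flow C \<in> flows (C \<union> C\<inverse>)" "net (tree_flow C) = anchor_demand E" by auto
qed

lemma tree_flow_antisym: "C \<in> facets \<Longrightarrow> tree_flow C $ i $ j = - tree_flow C $ j $ i"
  by (rule flows_antisym[OF tree_flow(1)])

lemma facet_arc_neq: "C \<in> facets \<Longrightarrow> (i, j) \<in> C \<union> C\<inverse> \<Longrightarrow> i \<noteq> j"
  using facet_subset irrefl by (auto simp: irrefl_def)

lemma facet_flow_eq_side_sum:
  assumes "C \<in> facets" "(i, j) \<in> C \<union> C\<inverse>" "h \<in> flows (C \<union> C\<inverse>)"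
  shows "h $ i $ j = (\<Sum>k\<in>side (C \<union> C\<inverse>) i j. net h $ k)"
  using assms
  by (intro forest_flow_eq_side_sum sym_closure facet_circulation_free facet_arc_neq)

lemma tree_flow_small:
  assumes C: "C \<in> facets"
  shows "\<bar>\<epsilon> * tree_flow C $ i $ j\<bar> < 1"
proof (cases "(i, j) \<in> C \<union> C\<inverse>")
  case True
  have "tree_flow C $ i $ j = (\<Sum>k\<in>side (C \<union> C\<inverse>) i j. anchor_demand E $ k)"
    using facet_flow_eq_side_sum[OF C True] tree_flow[OF C] by simp
  hence "\<bar>tree_flow C $ i $ j\<bar> \<le> real CARD('n)"
    using abs_sum_anchor_demand_le[of E "side (C \<union> C\<inverse>) i j"] by (simp only:)
  hence "\<epsilon> * \<bar>tree_flow C $ i $ j\<bar> \<le> \<epsilon> * real CARD('n)"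
    using \<epsilon>_pos by (intro mult_left_mono) auto
  thus ?thesis using \<epsilon>_small \<epsilon>_pos by (simp only: abs_mult abs_of_pos)
next
  case False
  hence "tree_flow C $ i $ j = 0" using flows_support[OF tree_flow(1)[OF C]] by blast
  thus ?thesis by simp
qed

lemma tree_flow_neq_0:
  assumes C: "C \<in> facets" and ij: "(i, j) \<in> C \<union> C\<inverse>"
  shows "tree_flow C $ i $ j \<noteq> 0"
proof -
  let ?F = "C \<union> C\<inverse>" and ?S = "side (C \<union> C\<inverse>) i j"
  have "?S \<subseteq> ?F\<^sup>* `` {i}"
    unfolding side_def by (intro Image_mono rtrancl_mono) auto
  hence S: "?S \<subseteq> E\<^sup>* `` {i}" by (simp add: facet_spans[OF C])
  have "(i, j) \<in> E\<^sup>*" using ij facet_subset[OF C] by blast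
  moreover have "j \<notin> ?S"
    by (intro other_end_not_in_side sym_closure facet_circulation_free[OF C] ij
        facet_arc_neq[OF C ij])
  ultimately have "\<exists>b. (i, b) \<in> E\<^sup>* \<and> b \<notin> ?S" by blast
  hence "(\<Sum>k\<in>?S. anchor_demand E $ k) \<noteq> 0"
    using S by (intro sum_anchor_demand_neq_0[OF sym, of i]) (auto simp: side_def)
  thus ?thesis
    using facet_flow_eq_side_sum[OF C ij] tree_flow[OF C] by simp
qed

text \<open>The perturbed demand is met by a flow that uses every arc of the facet: an arc may carry
  an unperturbed flow of zero only if the perturbation pushes flow forward along it.\<close>

lemma flow_of_filling:
  assumes C: "C \<in> facets" and f: "f \<in> fillings C (down_arcs C) m"
  shows "flow_of f \<in> flows (C \<union> C\<inverse>)"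
    and "(i, j) \<in> C \<Longrightarrow> flow_of f $ i $ j = real (f (i, j))"
    and "strictly_optimal w E (flow_of f + \<epsilon> *\<^sub>R tree_flow C)"
    and "arcs (flow_of f + \<epsilon> *\<^sub>R tree_flow C) = C"
proof -
  have f0: "f p = 0" if "p \<notin> C" for p using f that unfolding fillings_def by blast
  show fl: "flow_of f \<in> flows (C \<union> C\<inverse>)"
  proof (rule flowsI)
    fix i j assume "flow_of f $ i $ j \<noteq> 0"
    hence "f (i, j) \<noteq> 0 \<or> f (j, i) \<noteq> 0" by (auto simp: flow_of_def)
    hence "(i, j) \<in> C \<or> (j, i) \<in> C" using f0 by metis
    thus "(i, j) \<in> C \<union> C\<inverse>" by blast
  qed (simp add: flow_of_def)
  show val: "flow_of f $ i $ j = real (f (i, j))" if "(i, j) \<in> C" for i j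
    using f0 facet_antisym[OF C that] by (simp add: flow_of_def)
  let ?g = "flow_of f + \<epsilon> *\<^sub>R tree_flow C"
  have g: "?g \<in> flows (C \<union> C\<inverse>)"
    by (intro flows_add flows_scale fl tree_flow C)
  have pos: "?g $ i $ j > 0" if ij: "(i, j) \<in> C" for i j
  proof (cases "tree_flow C $ i $ j < 0")
    case True
    hence "1 \<le> f (i, j)" using f ij by (auto simp: fillings_def down_arcs_def)
    hence "1 \<le> real (f (i, j))" by simp
    thus ?thesis using tree_flow_small[OF C, of i j] val[OF ij] by (simp add: abs_less_iff)
  next
    case False
    hence "tree_flow C $ i $ j > 0"
      using tree_flow_neq_0[OF C, of i j] ij by fastforce
    thus ?thesis using val[OF ij] \<epsilon>_pos by (simp add: add_nonneg_pos)
  qed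
  show arcs: "arcs ?g = C"
  proof
    show "C \<subseteq> arcs ?g" using pos by (auto simp: arcs_def)
    show "arcs ?g \<subseteq> C"
    proof (clarify)
      fix i j assume "(i, j) \<in> arcs ?g"
      hence gt: "?g $ i $ j > 0" by (simp add: arcs_def)
      hence "(i, j) \<in> C \<union> C\<inverse>" using flows_support[OF g, of i j] by simp
      moreover have "(j, i) \<notin> C"
        using pos[of j i] gt flows_antisym[OF g, of i j] by linarith
      ultimately show "(i, j) \<in> C" by blast
    qed
  qed
  obtain g0 where g0: "strictly_optimal w E g0" "C = arcs g0"
    using C by (auto simp: facets_def)
  show "strictly_optimal w E ?g"
  proof (rule strictly_optimal_mono[OF _ g0(1)])
    show "?g \<in> flows E" using g flows_mono[OF facet_subset[OF C]] by blast
    show "arcs ?g \<subseteq> arcs g0" using arcs g0(2) by simp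
  qed (rule w0)
qed

lemma cost_flow_of:
  assumes C: "C \<in> facets" and f: "\<And>p. p \<notin> C \<Longrightarrow> f p = 0"
  shows "cost (\<lambda>_ _. 1) (flow_of f) = real (sum f C)"
proof -
  have "\<bar>real (f (i, j)) - real (f (j, i))\<bar> = real (f (i, j)) + real (f (j, i))" for i j
    using f[of "(i, j)"] f[of "(j, i)"] facet_antisym[OF C, of i j]
    by (cases "(i, j) \<in> C") auto
  hence "2 * cost (\<lambda>_ _. 1) (flow_of f)
      = (\<Sum>i\<in>UNIV. \<Sum>j\<in>UNIV. real (f (i, j))) + (\<Sum>i\<in>UNIV. \<Sum>j\<in>UNIV. real (f (j, i)))"
    by (simp add: cost_def flow_of_def sum.distrib)
  also have "(\<Sum>i\<in>UNIV. \<Sum>j\<in>UNIV. real (f (j, i))) = (\<Sum>i\<in>UNIV. \<Sum>j\<in>UNIV. real (f (i, j)))"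
    by (rule sum.swap)
  also have "(\<Sum>i\<in>UNIV. \<Sum>j\<in>UNIV. real (f (i, j))) = real (sum f UNIV)"
    by (simp add: sum.cartesian_product)
  also have "sum f UNIV = sum f C"
    using f by (intro sum.mono_neutral_right) auto
  finally show ?thesis by simp
qed

lemma net_flow_of_integer: "net (flow_of f) $ i \<in> \<int>"
  by (auto simp: net_nth flow_of_def intro!: Ints_diff)

text \<open>If a vertex were separated from its anchor, then the net flow of its component would be an integer plus
  a nonzero perturbation of absolute value less than 1, although no flow leaves the component.\<close>

lemma spanning_of_perturbed:
  assumes g: "g \<in> flows E" "net g = x + \<epsilon> *\<^sub>R anchor_demand E" and x: "\<And>i. x $ i \<in> \<int>"
  shows "E \<subseteq> (arcs g \<union> (arcs g)\<inverse>)\<^sup>*"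
proof -
  let ?F = "arcs g \<union> (arcs g)\<inverse>"
  have F: "?F = {(i, j). g $ i $ j \<noteq> 0}" by (rule arcs_sym_closure[OF g(1)])
  have FE: "?F \<subseteq> E" unfolding F using flows_support[OF g(1)] by auto
  have reach: "(i, anchor E i) \<in> ?F\<^sup>*" for i
  proof (rule ccontr)
    assume no: "(i, anchor E i) \<notin> ?F\<^sup>*"
    let ?S = "?F\<^sup>* `` {i}"
    have "g $ a $ b = 0" if "a \<in> ?S" "b \<notin> ?S" for a b
    proof (rule ccontr)
      assume "g $ a $ b \<noteq> 0"
      hence "(a, b) \<in> ?F" unfolding F by simp
      hence "b \<in> ?S" using that(1) by (auto intro: rtrancl_into_rtrancl)
      thus False using that(2) by contradiction
    qed
    hence "(\<Sum>k\<in>?S. net g $ k) = 0"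
      unfolding net_sum_cut[OF g(1)] by (intro sum.neutral ballI) auto
    hence 0: "(\<Sum>k\<in>?S. x $ k) + \<epsilon> * (\<Sum>k\<in>?S. anchor_demand E $ k) = 0"
      by (simp add: g(2) sum.distrib sum_distrib_left)
    have "\<bar>\<epsilon> * (\<Sum>k\<in>?S. anchor_demand E $ k)\<bar> < 1"
    proof -
      have "\<epsilon> * \<bar>\<Sum>k\<in>?S. anchor_demand E $ k\<bar> \<le> \<epsilon> * real CARD('n)"
        using abs_sum_anchor_demand_le \<epsilon>_pos by (intro mult_left_mono) auto
      also have "\<dots> < 1" by (rule \<epsilon>_small)
      finally show ?thesis using \<epsilon>_pos by (simp only: abs_mult abs_of_pos)
    qed
    hence "\<bar>\<Sum>k\<in>?S. x $ k\<bar> < 1" using 0 by linarith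
    moreover have "(\<Sum>k\<in>?S. x $ k) \<in> \<int>" using x by (intro Ints_sum) auto
    ultimately have "(\<Sum>k\<in>?S. x $ k) = 0" by (metis Ints_nonzero_abs_less1)
    hence "(\<Sum>k\<in>?S. anchor_demand E $ k) = 0" using 0 \<epsilon>_pos by simp
    moreover have "?S \<subseteq> E\<^sup>* `` {i}" using FE by (intro Image_mono rtrancl_mono) auto
    hence "(\<Sum>k\<in>?S. anchor_demand E $ k) \<noteq> 0"
      using no by (intro sum_anchor_demand_neq_0[OF sym, of i]) auto
    ultimately show False by contradiction
  qed
  show ?thesis
  proof (clarify)
    fix i j assume "(i, j) \<in> E"
    hence "anchor E i = anchor E j" by (intro anchor_eq[OF sym]) auto
    hence "(anchor E i, j) \<in> ?F\<^sup>*"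
      using reach[of j] sym_rtrancl[OF sym_closure[of "arcs g"]] by (auto dest: symD)
    thus "(i, j) \<in> ?F\<^sup>*" using reach[of i] by (rule rtrancl_trans[rotated])
  qed
qed

end

context weighted_relation
begin

text \<open>Inverting the filling map: the flow that is optimal for the perturbed demand has a facet as
  its set of arcs, and removing the perturbation leaves a nonnegative integral flow.\<close>

lemma lattice_point_has_filling:
  assumes x: "x \<in> lattice_points E m"
    and \<eta>: "\<And>i j. w i j \<le> 1 + \<eta>" "\<eta> * real m < 1"
  obtains C f where "C \<in> facets" "f \<in> fillings C (down_arcs C) m" "x = net (flow_of f)"
proof -
  have int: "x $ i \<in> \<int>" for i using x by (simp add: lattice_points_def)
  obtain h where h: "h \<in> flows E" "net h = x" "cost (\<lambda>_ _. 1) h \<le> real m"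
    using x by (auto simp: lattice_points_def)
  obtain h' where h': "h' \<in> flows E" "net h' = anchor_demand E"
    using anchor_demand_in_net[OF sym anchor_reachable] by (metis imageE)
  have "x + \<epsilon> *\<^sub>R anchor_demand E = net (h + \<epsilon> *\<^sub>R h')"
    by (simp add: net_add net_scale h h')
  moreover have "h + \<epsilon> *\<^sub>R h' \<in> flows E" by (intro flows_add flows_scale h h')
  ultimately have "x + \<epsilon> *\<^sub>R anchor_demand E \<in> net ` flows E" by blast
  then obtain g where g: "strictly_optimal w E g" "net g = x + \<epsilon> *\<^sub>R anchor_demand E"
    using strictly_optimal_flow_exists[of w] w1 generic by metis
  have gE: "g \<in> flows E" using g by (simp add: strictly_optimal_def)
  define C where "C = arcs g"
  have C: "C \<in> facets"
    unfolding facets_def C_def using g(1) spanning_of_perturbed[OF gE g(2) int] by blast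
  have F: "C \<union> C\<inverse> = {(i, j). g $ i $ j \<noteq> 0}"
    unfolding C_def by (rule arcs_sym_closure[OF gE])
  have "g \<in> flows (C \<union> C\<inverse>)"
    unfolding F by (intro flowsI flows_antisym[OF gE]) auto
  define k where "k = g - \<epsilon> *\<^sub>R tree_flow C"
  have k: "k \<in> flows (C \<union> C\<inverse>)"
    unfolding k_def by (intro flows_diff flows_scale tree_flow C) fact
  have netk: "net k = x"
    by (simp add: k_def net_diff net_scale g(2) tree_flow[OF C])
  have kint: "k $ i $ j \<in> \<int>" if "(i, j) \<in> C" for i j
  proof -
    have "k $ i $ j = (\<Sum>l\<in>side (C \<union> C\<inverse>) i j. x $ l)"
      using facet_flow_eq_side_sum[OF C _ k, of i j] that netk by simp
    also have "\<dots> \<in> \<int>" using int by (intro Ints_sum)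
    finally show ?thesis .
  qed
  have gpos: "g $ i $ j > 0" if "(i, j) \<in> C" for i j
    using that by (simp add: C_def arcs_def)
  have kval: "k $ i $ j = g $ i $ j - \<epsilon> * tree_flow C $ i $ j" for i j
    by (simp add: k_def)
  have k0: "k $ i $ j \<ge> 0" if ij: "(i, j) \<in> C" for i j
  proof -
    have "k $ i $ j > - 1"
      using gpos[OF ij] tree_flow_small[OF C, of i j] unfolding kval by linarith
    thus ?thesis using kint[OF ij] by (auto elim!: Ints_cases)
  qed
  have k1: "k $ i $ j \<ge> 1" if ij: "(i, j) \<in> down_arcs C" for i j
  proof -
    have ijC: "(i, j) \<in> C" and "tree_flow C $ i $ j < 0"
      using ij by (auto simp: down_arcs_def)
    hence "\<epsilon> * tree_flow C $ i $ j < 0" using \<epsilon>_pos by (simp add: mult_pos_neg)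
    hence "k $ i $ j > 0" using gpos[OF ijC] unfolding kval by linarith
    thus ?thesis using kint[OF ijC] by (auto elim!: Ints_cases)
  qed
  define f where "f p = (if p \<in> C then nat \<lfloor>k $ fst p $ snd p\<rfloor> else 0)" for p
  have f0: "f p = 0" if "p \<notin> C" for p using that by (simp add: f_def)
  have fval: "real (f (i, j)) = k $ i $ j" if "(i, j) \<in> C" for i j
    using kint[OF that] k0[OF that] that by (auto simp: f_def elim!: Ints_cases)
  have flow_k: "flow_of f = k"
  proof -
    have "real (f (i, j)) - real (f (j, i)) = k $ i $ j" for i j
    proof -
      consider "(i, j) \<in> C" | "(j, i) \<in> C" | "(i, j) \<notin> C \<union> C\<inverse>" by blast
      thus ?thesis
      proof cases
        case 1
        thus ?thesis using fval f0 facet_antisym[OF C 1] by simp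
      next
        case 2
        thus ?thesis using fval f0 facet_antisym[OF C 2] flows_antisym[OF k, of i j] by simp
      next
        case 3
        hence "k $ i $ j = 0" using flows_support[OF k] by blast
        thus ?thesis using 3 f0 by simp
      qed
    qed
    thus ?thesis by (simp add: flow_of_def vec_eq_iff)
  qed
  have "real (sum f C) = cost (\<lambda>_ _. 1) k"
    using cost_flow_of[OF C, of f, OF f0] by (simp add: flow_k)
  also have "\<dots> \<le> cost w k"
    unfolding cost_def using w1 by (intro divide_right_mono sum_mono mult_right_mono) auto
  also have "\<dots> \<le> cost w h"
  proof (cases "h = k")
    case False
    have "arcs k \<subseteq> arcs g"
    proof (clarify)
      fix i j assume "(i, j) \<in> arcs k"
      hence gt: "k $ i $ j > 0" by (simp add: arcs_def)
      hence "(i, j) \<in> C \<union> C\<inverse>" using flows_support[OF k, of i j] by simp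
      moreover have "(j, i) \<notin> C" using gt k0[of j i] flows_antisym[OF k, of i j] by auto
      ultimately show "(i, j) \<in> arcs g" unfolding C_def by blast
    qed
    moreover have "k \<in> flows E" using k flows_mono[OF facet_subset[OF C]] by blast
    ultimately have "strictly_optimal w E k"
      using strictly_optimal_mono[OF _ g(1)] w0 by blast
    thus ?thesis using h netk False by (simp add: strictly_optimal_def less_imp_le)
  qed simp
  also have "\<dots> \<le> (1 + \<eta>) * cost (\<lambda>_ _. 1) h"
  proof -
    have "cost w h \<le> cost (\<lambda>_ _. 1 + \<eta>) h"
      unfolding cost_def using \<eta>(1) by (intro divide_right_mono sum_mono mult_right_mono) auto
    thus ?thesis by (simp add: cost_def sum_distrib_left)
  qed
  also have "\<dots> \<le> (1 + \<eta>) * real m"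
  proof (rule mult_left_mono[OF h(3)])
    show "0 \<le> 1 + \<eta>" using order_trans[OF w1 \<eta>(1)] by simp
  qed
  also have "\<dots> < real m + 1" using \<eta>(2) by (simp add: distrib_right)
  finally have "real (sum f C) < real m + 1" .
  hence "sum f C \<le> m" by linarith
  moreover have "1 \<le> f p" if "p \<in> down_arcs C" for p
  proof -
    have "p \<in> C" using that by (auto simp: down_arcs_def)
    thus ?thesis using fval[of "fst p" "snd p"] k1[of "fst p" "snd p"] that
      by (metis of_nat_1 of_nat_le_iff prod.collapse)
  qed
  ultimately have "f \<in> fillings C (down_arcs C) m"
    using f0 by (simp add: fillings_def)
  moreover have "x = net (flow_of f)" by (simp add: flow_k netk)
  ultimately show ?thesis using that C by blast
qed

text \<open>The lattice point determines the flow that is optimal for the perturbed demand, this flow determines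
  the facet, and removing the perturbation recovers the filling.\<close>

lemma filling_injective:
  assumes "C \<in> facets" "f \<in> fillings C (down_arcs C) m"
    and "C' \<in> facets" "f' \<in> fillings C' (down_arcs C') m'"
    and "net (flow_of f) = net (flow_of f')"
  shows "C = C' \<and> f = f'"
proof -
  have "flow_of f + \<epsilon> *\<^sub>R tree_flow C = flow_of f' + \<epsilon> *\<^sub>R tree_flow C'"
    using assms(5)
    by (intro strictly_optimal_unique[OF flow_of_filling(3)[OF assms(1,2)]
          flow_of_filling(3)[OF assms(3,4)]])
      (simp add: net_add net_scale tree_flow assms)
  hence C: "C = C'" "flow_of f = flow_of f'"
    using flow_of_filling(4)[OF assms(1,2)] flow_of_filling(4)[OF assms(3,4)] by auto
  have "f (i, j) = f' (i, j)" for i j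
  proof (cases "(i, j) \<in> C")
    case True
    thus ?thesis
      using flow_of_filling(2)[OF assms(1,2), of i j] flow_of_filling(2)[OF assms(3,4), of i j] C
      by simp
  next
    case False
    thus ?thesis using assms(2,4) C(1) by (simp add: fillings_def)
  qed
  thus ?thesis using C by auto
qed

lemma filling_lattice_point:
  assumes "C \<in> facets" "f \<in> fillings C (down_arcs C) m"
  shows "net (flow_of f) \<in> lattice_points E m"
proof -
  have "flow_of f \<in> flows E"
    using flow_of_filling(1)[OF assms] flows_mono[OF facet_subset[OF assms(1)]] by blast
  moreover have c: "cost (\<lambda>_ _. 1) (flow_of f) = real (sum f C)"
    using assms(2) unfolding fillings_def by (intro cost_flow_of[OF assms(1)]) blast
  moreover have "sum f C \<le> m" using assms(2) by (simp add: fillings_def)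
  hence "cost (\<lambda>_ _. 1) (flow_of f) \<le> real m"
    unfolding c by (simp only: of_nat_le_iff)
  ultimately show ?thesis
    unfolding lattice_points_def mem_Collect_eq
    by (intro conjI allI net_flow_of_integer bexI[of _ "flow_of f"]) simp_all
qed

lemma finite_facets: "finite facets"
  by (rule finite_subset[of _ UNIV]) auto

lemma card_lattice_points:
  assumes "\<And>i j. w i j \<le> 1 + \<eta>" "\<eta> * real m < 1"
  shows "card (lattice_points E m)
    = (\<Sum>C\<in>facets. (m + card C - card (down_arcs C)) choose card C)"
proof -
  have fillings: "finite (fillings C (down_arcs C) m)
      \<and> card (fillings C (down_arcs C) m) = (m + card C - card (down_arcs C)) choose card C" for C
    by (rule card_fillings) (auto simp: down_arcs_def)
  have "bij_betw (\<lambda>(C, f). net (flow_of f)) (SIGMA C:facets. fillings C (down_arcs C) m)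
      (lattice_points E m)"
    unfolding bij_betw_def
  proof
    show "inj_on (\<lambda>(C, f). net (flow_of f)) (SIGMA C:facets. fillings C (down_arcs C) m)"
      using filling_injective by (intro inj_onI) (clarify, blast)
    show "(\<lambda>(C, f). net (flow_of f)) ` (SIGMA C:facets. fillings C (down_arcs C) m)
        = lattice_points E m"
    proof (rule subset_antisym)
      show "(\<lambda>(C, f). net (flow_of f)) ` (SIGMA C:facets. fillings C (down_arcs C) m)
          \<subseteq> lattice_points E m"
        using filling_lattice_point by (clarify, blast)
      show "lattice_points E m
          \<subseteq> (\<lambda>(C, f). net (flow_of f)) ` (SIGMA C:facets. fillings C (down_arcs C) m)"
      proof
        fix x assume "x \<in> lattice_points E m"
        then obtain C f where "C \<in> facets" "f \<in> fillings C (down_arcs C) m" "x = net (flow_of f)"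
          by (rule lattice_point_has_filling[OF _ assms])
        thus "x \<in> (\<lambda>(C, f). net (flow_of f)) ` (SIGMA C:facets. fillings C (down_arcs C) m)"
          by (intro rev_image_eqI[of "(C, f)"] SigmaI) simp_all
      qed
    qed
  qed
  from bij_betw_same_card[OF this]
  have "card (lattice_points E m) = card (SIGMA C:facets. fillings C (down_arcs C) m)" by simp
  also have "\<dots> = (\<Sum>C\<in>facets. card (fillings C (down_arcs C) m))"
    using fillings by (intro card_SigmaI finite_facets) auto
  finally show ?thesis using fillings by simp
qed

lemma path_in_span:
  assumes "(i, j) \<in> (C \<union> C\<inverse>)\<^sup>*"
  shows "(axis i 1 - axis j 1 :: real ^ 'n) \<in> span ((\<lambda>(a, b). axis a 1 - axis b 1) ` C)"
  using assms
proof induction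
  case base
  show ?case by (simp add: span_zero)
next
  case (step j k)
  let ?B = "(\<lambda>(a, b). axis a 1 - axis b 1 :: real ^ 'n) ` C"
  have "axis j 1 - axis k 1 \<in> span ?B"
  proof (cases "(j, k) \<in> C")
    case True
    thus ?thesis by (intro span_base) force
  next
    case False
    hence "axis k 1 - axis j 1 \<in> span ?B" using step(2) by (intro span_base) force
    from span_neg[OF this] show ?thesis by simp
  qed
  from span_add[OF step.IH this] show ?case by simp
qed

text \<open>The edge vectors of a facet are a basis of the span of all edge vectors.\<close>

lemma card_facet:
  assumes C: "C \<in> facets"
  shows "card C = dim ((\<lambda>(i, j). axis i 1 - axis j 1 :: real ^ 'n) ` E)"
proof -
  let ?\<psi> = "\<lambda>(i, j). axis i 1 - axis j 1 :: real ^ 'n"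
  have inj: "inj_on ?\<psi> C"
  proof (rule inj_onI, clarify)
    fix i j k l assume ij: "(i, j) \<in> C" and kl: "(k, l) \<in> C"
      and eq: "axis i 1 - axis j 1 = (axis k 1 - axis l 1 :: real ^ 'n)"
    have ne: "i \<noteq> j" "k \<noteq> l" using facet_arc_neq[OF C] ij kl by blast+
    have "(axis i 1 - axis j 1) $ a = (axis k 1 - axis l 1 :: real ^ 'n) $ a" for a
      using eq by simp
    from this[of i] this[of j] show "i = k \<and> j = l"
      using ne by (auto simp: axis_def split: if_splits)
  qed
  have "independent (?\<psi> ` C)"
  proof (rule independent_if_scalars_zero)
    show "finite (?\<psi> ` C)" by simp
    fix u x assume u: "(\<Sum>x\<in>?\<psi> ` C. u x *\<^sub>R x) = 0" and x: "x \<in> ?\<psi> ` C"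
    define y where "y = (\<Sum>p\<in>C. u (?\<psi> p) *\<^sub>R unit_flow (fst p) (snd p))"
    have y: "y \<in> flows (C \<union> C\<inverse>)"
      unfolding y_def
      by (intro subspace_sum subspace_flows flows_scale unit_flow_in_flows sym_closure) auto
    have "net y = (\<Sum>p\<in>C. u (?\<psi> p) *\<^sub>R ?\<psi> p)"
      by (simp add: y_def linear_sum[OF linear_net] net_scale net_unit_flow split_def)
    also have "\<dots> = 0" using u by (simp add: sum.reindex[OF inj])
    finally have "y = 0"
      using facet_circulation_free[OF C] y unfolding circulation_free_def by blast
    obtain i j where ij: "(i, j) \<in> C" "x = ?\<psi> (i, j)" using x by auto
    have "y $ i $ j = (\<Sum>p\<in>C. u (?\<psi> p) * unit_flow (fst p) (snd p) $ i $ j)"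
      by (simp add: y_def)
    also have "\<dots> = (\<Sum>p\<in>{(i, j)}. u (?\<psi> p) * unit_flow (fst p) (snd p) $ i $ j)"
      using ij(1) facet_antisym[OF C ij(1)]
      by (intro sum.mono_neutral_right) (auto simp: unit_flow_def)
    also have "\<dots> = u x"
      using ij facet_arc_neq[OF C, of i j] by (simp add: unit_flow_def)
    finally show "u x = 0" using \<open>y = 0\<close> by simp
  qed
  moreover have "?\<psi> ` C \<subseteq> ?\<psi> ` E" using facet_subset[OF C] by (intro image_mono) auto
  moreover have "?\<psi> ` E \<subseteq> span (?\<psi> ` C)"
  proof (clarify)
    fix i j assume "(i, j) \<in> E"
    hence "(i, j) \<in> (C \<union> C\<inverse>)\<^sup>*" using facet_spans[OF C] by blast
    thus "axis i 1 - axis j 1 \<in> span (?\<psi> ` C)" by (rule path_in_span)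
  qed
  ultimately have "card (?\<psi> ` C) = dim (?\<psi> ` E)" by (intro basis_card_eq_dim)
  thus ?thesis by (simp add: card_image[OF inj])
qed

text \<open>Reversing all arcs exchanges the arcs that the perturbation supports and those that it
  opposes. This is the source of the symmetry of the \<open>h\<^sup>*\<close>-vector.\<close>

lemma facet_converse:
  assumes C: "C \<in> facets"
  shows "C\<inverse> \<in> facets" "card (down_arcs (C\<inverse>)) = card C - card (down_arcs C)"
proof -
  obtain g where g: "strictly_optimal w E g" "C = arcs g" "E \<subseteq> (C \<union> C\<inverse>)\<^sup>*"
    using C by (auto simp: facets_def)
  have gE: "g \<in> flows E" using g by (simp add: strictly_optimal_def)
  have "strictly_optimal w E (- g)"
    unfolding strictly_optimal_def
  proof (intro conjI ballI impI)
    show "- g \<in> flows E" by (intro flows_neg gE)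
    fix h assume h: "h \<in> flows E" "net h = net (- g)" "h \<noteq> - g"
    hence "- h \<in> flows E" "net (- h) = net g" "- h \<noteq> g"
      by (auto simp: flows_neg net_neg)
    hence "cost w g < cost w (- h)" using g(1) by (simp add: strictly_optimal_def)
    thus "cost w (- g) < cost w h" by (simp add: cost_minus)
  qed
  moreover have "C\<inverse> = arcs (- g)"
  proof -
    have "(i, j) \<in> C\<inverse> \<longleftrightarrow> (i, j) \<in> arcs (- g)" for i j
      using flows_antisym[OF gE, of i j] by (simp add: g(2) arcs_def)
    thus ?thesis by auto
  qed
  moreover have un: "C\<inverse> \<union> (C\<inverse>)\<inverse> = C \<union> C\<inverse>" by auto
  ultimately show "C\<inverse> \<in> facets"
    unfolding facets_def using g(3) by auto
  have tf: "tree_flow (C\<inverse>) = tree_flow C" by (simp only: tree_flow_def un)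
  have "(i, j) \<in> down_arcs (C\<inverse>) \<longleftrightarrow> (i, j) \<in> (C - down_arcs C)\<inverse>" for i j
    using tree_flow_neq_0[OF C, of j i] tree_flow_antisym[OF C, of i j]
    by (auto simp: down_arcs_def tf)
  hence "down_arcs (C\<inverse>) = (C - down_arcs C)\<inverse>" by auto
  hence "card (down_arcs (C\<inverse>)) = card (C - down_arcs C)" by simp
  also have "\<dots> = card C - card (down_arcs C)"
    by (intro card_Diff_subset) (auto simp: down_arcs_def)
  finally show "card (down_arcs (C\<inverse>)) = card C - card (down_arcs C)" .
qed

text \<open>The \<open>j\<close>-th entry is the number of facets with \<open>j\<close> backward arcs.\<close>

lemma h_vector_exists:
  assumes "\<And>i j. w i j \<le> 1 + \<eta>" and d: "d = dim ((\<lambda>(i, j). axis i 1 - axis j 1 :: real ^ 'n) ` E)"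
  obtains h :: "nat \<Rightarrow> int" where "\<And>j. j > d \<Longrightarrow> h j = 0" "\<And>j. j \<le> d \<Longrightarrow> h (d - j) = h j"
    "\<And>m. \<eta> * real m < 1 \<Longrightarrow>
       int (card (lattice_points E m)) = (\<Sum>j=0..d. h j * int ((m + d - j) choose d))"
proof
  define H where "H j = {C \<in> facets. card (down_arcs C) = j}" for j
  have card: "card C = d" "card (down_arcs C) \<le> d" if "C \<in> facets" for C
    using card_facet[OF that] d card_mono[of C "down_arcs C"] by (auto simp: down_arcs_def)
  show "int (card (H j)) = 0" if "j > d" for j
  proof -
    have "H j = {}" using card that by (force simp: H_def)
    thus ?thesis by simp
  qed
  show "int (card (H (d - j))) = int (card (H j))" if "j \<le> d" for j
  proof -
    have "bij_betw converse (H j) (H (d - j))"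
      using that facet_converse card
      by (intro bij_betw_byWitness[of _ converse]) (auto simp: H_def)
    thus ?thesis by (simp add: bij_betw_same_card)
  qed
  fix m assume m: "\<eta> * real m < 1"
  have "card (lattice_points E m) = (\<Sum>C\<in>facets. (m + card C - card (down_arcs C)) choose card C)"
    by (rule card_lattice_points[OF assms(1) m])
  also have "\<dots> = (\<Sum>C\<in>facets. (m + d - card (down_arcs C)) choose d)"
    using card by (intro sum.cong) auto
  also have "\<dots> = (\<Sum>j\<in>{0..d}. \<Sum>C\<in>H j. (m + d - card (down_arcs C)) choose d)"
    unfolding H_def using card by (intro sum.group[symmetric] finite_facets) auto
  also have "\<dots> = (\<Sum>j\<in>{0..d}. card (H j) * ((m + d - j) choose d))"
    by (intro sum.cong refl) (simp add: H_def)
  finally show "int (card (lattice_points E m))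
      = (\<Sum>j=0..d. int (card (H j)) * int ((m + d - j) choose d))" by simp
qed

end

text \<open>An expansion in the binomial basis is determined by its first \<open>d + 1\<close> values.\<close>

lemma binomial_expansion_unique:
  fixes h h' :: "nat \<Rightarrow> int"
  assumes "\<And>m. m \<le> d \<Longrightarrow> (\<Sum>j=0..d. h j * int ((m + d - j) choose d))
      = (\<Sum>j=0..d. h' j * int ((m + d - j) choose d))"
    and "j \<le> d"
  shows "h j = h' j"
  using assms(2)
proof (induction j rule: less_induct)
  case (less m)
  define D where "D j = h j - h' j" for j
  have "(\<Sum>j=0..d. D j * int ((m + d - j) choose d)) = 0"
    using assms(1)[OF less.prems] by (simp add: D_def left_diff_distrib sum_subtractf)
  moreover have "(\<Sum>j=0..d. D j * int ((m + d - j) choose d))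
      = (\<Sum>j\<in>{m}. D j * int ((m + d - j) choose d))"
  proof (rule sum.mono_neutral_right)
    show "\<forall>j\<in>{0..d} - {m}. D j * int ((m + d - j) choose d) = 0"
    proof
      fix j assume j: "j \<in> {0..d} - {m}"
      show "D j * int ((m + d - j) choose d) = 0"
      proof (cases "j < m")
        case True
        thus ?thesis using less.IH j by (simp add: D_def)
      next
        case False
        hence "m + d - j < d" using j by auto
        thus ?thesis by (simp add: binomial_eq_0)
      qed
    qed
  qed (use less.prems in auto)
  ultimately show ?case by (simp add: D_def)
qed

text \<open>Weights close to 1 decide which lattice points belong to small dilates only, but the
  \<open>h\<^sup>*\<close>-vector is already determined by the dilates up to the dimension.\<close>

theorem lattice_points_h_vector:
  fixes E :: "('n::finite \<times> 'n) set"
  assumes "sym E" "irrefl E"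
    and d: "d = dim ((\<lambda>(i, j). axis i 1 - axis j 1 :: real ^ 'n) ` E)"
  obtains h :: "nat \<Rightarrow> int" where "\<And>j. j > d \<Longrightarrow> h j = 0" "\<And>j. j \<le> d \<Longrightarrow> h (d - j) = h j"
    "\<And>m. int (card (lattice_points E m)) = (\<Sum>j=0..d. h j * int ((m + d - j) choose d))"
proof -
  have ex: "\<exists>h. (\<forall>j>d. h j = 0) \<and> (\<forall>j\<le>d. h (d - j) = h j) \<and>
     (\<forall>m\<le>M. int (card (lattice_points E m)) = (\<Sum>j=0..d. h j * int ((m + d - j) choose d)))" for M
  proof -
    define \<eta> where "\<eta> = 1 / (real M + 1)"
    have "\<eta> > 0" by (simp add: \<eta>_def add_nonneg_pos)
    then obtain w :: "'n \<Rightarrow> 'n \<Rightarrow> real"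
      where w: "generic w" "\<And>i j. 1 \<le> w i j" "\<And>i j. w i j \<le> 1 + \<eta>"
      using generic_weights_exist[of \<eta>] by metis
    define e where "e = 1 / (real CARD('n) + 1)"
    have e: "e > 0" "e * real CARD('n) < 1" by (simp_all add: e_def add_nonneg_pos)
    interpret weighted_relation E w e
      by unfold_locales (use assms w e in auto)
    have "\<eta> * real m < 1" if "m \<le> M" for m
      using that by (simp add: \<eta>_def field_simps)
    thus ?thesis using h_vector_exists[OF w(3) d] by metis
  qed
  obtain h where h: "\<forall>j>d. h j = 0" "\<forall>j\<le>d. h (d - j) = h j"
    "\<forall>m\<le>d. int (card (lattice_points E m)) = (\<Sum>j=0..d. h j * int ((m + d - j) choose d))"
    using ex[of d] by blast
  have "int (card (lattice_points E m)) = (\<Sum>j=0..d. h j * int ((m + d - j) choose d))" for m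
  proof -
    obtain h' where h': "\<forall>k\<le>max d m. int (card (lattice_points E k))
        = (\<Sum>j=0..d. h' j * int ((k + d - j) choose d))"
      using ex[of "max d m"] by blast
    have "h j = h' j" if "j \<le> d" for j
    proof (rule binomial_expansion_unique[OF _ that])
      fix k assume k: "k \<le> d"
      show "(\<Sum>j=0..d. h j * int ((k + d - j) choose d))
          = (\<Sum>j=0..d. h' j * int ((k + d - j) choose d))"
        by (rule trans[OF h(3)[rule_format, OF k, symmetric] h'[rule_format]]) (use k in simp)
    qed
    hence eq: "(\<Sum>j=0..d. h j * int ((m + d - j) choose d))
        = (\<Sum>j=0..d. h' j * int ((m + d - j) choose d))"
      by (intro sum.cong) auto
    show ?thesis unfolding eq by (rule h'[rule_format]) simp
  qed
  with h(1,2) show ?thesis by (intro that[of h]) blast+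
qed

section \<open>The Ehrhart series of a symmetric edge polytope\<close>

definition adjacency :: "'n ugraph \<Rightarrow> ('n \<times> 'n) set" where
  "adjacency G = {(i, j). {i, j} \<in> edges G}"

definition edge_vector :: "'n \<times> 'n \<Rightarrow> real ^ 'n::finite" where
  "edge_vector p = axis (fst p) 1 - axis (snd p) 1"

lemma sym_adjacency: "sym (adjacency G)"
  by (simp add: sym_def adjacency_def insert_commute)

lemma irrefl_adjacency: "simple_graph G \<Longrightarrow> irrefl (adjacency G)"
  by (force simp: irrefl_def adjacency_def simple_graph_def)

lemma net_eq_combination:
  fixes h :: "real ^ 'n ^ 'n::finite"
  assumes "\<And>a b. h $ a $ b = c (a, b) - c (b, a)"
  shows "net h = (\<Sum>p\<in>UNIV. c p *\<^sub>R edge_vector p)"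
proof -
  have "h = (\<Sum>p\<in>UNIV. c p *\<^sub>R unit_flow (fst p) (snd p))" (is "h = ?s")
  proof -
    have "h $ a $ b = ?s $ a $ b" for a b
    proof -
      have unit: "unit_flow (fst p) (snd p) $ a $ b = of_bool (p = (a, b)) - of_bool (p = (b, a))" for p
      proof -
        have "(a = fst p \<and> b = snd p) = (p = (a, b))" "(a = snd p \<and> b = fst p) = (p = (b, a))"
          unfolding prod_eq_iff fst_conv snd_conv by blast+
        thus ?thesis by (simp only: unit_flow_def vec_lambda_beta)
      qed
      have dist: "x * (of_bool P - of_bool Q) = (if P then x else 0) - (if Q then x else 0)"
        for x :: real and P Q by simp
      have "?s $ a $ b = c (a, b) - c (b, a)"
        by (simp only: sum_component vector_scaleR_component real_scaleR_def unit dist sum_subtractf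
            sum.delta finite UNIV_I if_True)
      thus ?thesis using assms by simp
    qed
    thus ?thesis unfolding vec_eq_iff by blast
  qed
  hence "net h = net ?s" by (rule arg_cong)
  thus ?thesis
    by (simp add: linear_sum[OF linear_net] net_scale net_unit_flow edge_vector_def)
qed

text \<open>Keeping the positive entries only writes the net as a nonnegative combination of edge vectors whose
  coefficients add up to the cost.\<close>

lemma net_nonneg_combination:
  assumes h: "h \<in> flows E"
  shows "net h = (\<Sum>p\<in>E. max 0 (h $ fst p $ snd p) *\<^sub>R edge_vector p)"
    and "cost (\<lambda>_ _. 1) h = (\<Sum>p\<in>E. max 0 (h $ fst p $ snd p))"
proof -
  have outside: "max 0 (h $ fst p $ snd p) = 0" if "p \<notin> E" for p
  proof -
    have "h $ fst p $ snd p = 0"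
      using flows_support[OF h, of "fst p" "snd p"] that by (metis prod.collapse)
    thus ?thesis by simp
  qed
  have "h $ a $ b = max 0 (h $ a $ b) - max 0 (h $ b $ a)" for a b
    using flows_antisym[OF h, of a b] by simp
  hence "net h = (\<Sum>p\<in>UNIV. max 0 (h $ fst p $ snd p) *\<^sub>R edge_vector p)"
    by (intro net_eq_combination) (simp only: fst_conv snd_conv)
  also have "\<dots> = (\<Sum>p\<in>E. max 0 (h $ fst p $ snd p) *\<^sub>R edge_vector p)"
    using outside by (intro sum.mono_neutral_right) auto
  finally show "net h = (\<Sum>p\<in>E. max 0 (h $ fst p $ snd p) *\<^sub>R edge_vector p)" .
  have "\<bar>h $ i $ j\<bar> = max 0 (h $ i $ j) + max 0 (h $ j $ i)" for i j
    using flows_antisym[OF h, of i j] by simp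
  hence "2 * cost (\<lambda>_ _. 1) h
      = (\<Sum>i\<in>UNIV. \<Sum>j\<in>UNIV. max 0 (h $ i $ j)) + (\<Sum>i\<in>UNIV. \<Sum>j\<in>UNIV. max 0 (h $ j $ i))"
    by (simp add: cost_def sum.distrib)
  also have "(\<Sum>i\<in>UNIV. \<Sum>j\<in>UNIV. max 0 (h $ j $ i)) = (\<Sum>i\<in>UNIV. \<Sum>j\<in>UNIV. max 0 (h $ i $ j))"
    by (rule sum.swap)
  also have "(\<Sum>i\<in>UNIV. \<Sum>j\<in>UNIV. max 0 (h $ i $ j)) = (\<Sum>p\<in>UNIV. max 0 (h $ fst p $ snd p))"
    by (simp add: sum.cartesian_product split_def)
  also have "\<dots> = (\<Sum>p\<in>E. max 0 (h $ fst p $ snd p))"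
    using outside by (intro sum.mono_neutral_right) auto
  finally show "cost (\<lambda>_ _. 1) h = (\<Sum>p\<in>E. max 0 (h $ fst p $ snd p))" by simp
qed

lemma cost_unit_flow: "a \<noteq> b \<Longrightarrow> cost (\<lambda>_ _. 1) (unit_flow a b) = 1"
proof -
  assume ne: "a \<noteq> b"
  have "\<bar>unit_flow a b $ i $ j\<bar> = of_bool (i = a \<and> j = b) + of_bool (i = b \<and> j = a)" for i j
    using ne by (auto simp: unit_flow_def)
  moreover have "(\<Sum>i\<in>UNIV. \<Sum>j\<in>UNIV. of_bool (i = k \<and> j = l)) = (1::real)" for k l :: 'a
  proof -
    have "(\<Sum>j\<in>UNIV. of_bool (i = k \<and> j = l)) = (of_bool (i = k) :: real)" for i :: 'a
      by (cases "i = k") (simp_all add: of_bool_def)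
    thus ?thesis by (simp add: of_bool_def)
  qed
  ultimately show ?thesis by (simp add: cost_def sum.distrib)
qed

text \<open>A flow of cost less than one is completed to a convex combination by spreading the missing
  weight evenly over all arcs, which contributes nothing as opposite arcs cancel.\<close>

lemma symmetric_edge_polytope_eq_flows:
  assumes "simple_graph G"
  shows "symmetric_edge_polytope G = {net h |h. h \<in> flows (adjacency G) \<and> cost (\<lambda>_ _. 1) h \<le> 1}"
    (is "_ = ?Q")
proof (cases "edges G = {}")
  case True
  hence "h = 0" if "h \<in> flows (adjacency G)" for h
    using flows_support[OF that] by (auto simp: vec_eq_iff adjacency_def)
  moreover have "0 \<in> flows (adjacency G)" by (rule flows_zero)
  ultimately have "?Q = {0}"
    using net_zero by (auto simp: cost_def intro!: exI[of _ 0])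
  thus ?thesis using True by (simp add: symmetric_edge_polytope_def)
next
  case False
  let ?E = "adjacency G"
  let ?X = "{axis i 1 - axis j 1 | i j. {i, j} \<in> edges G} :: (real ^ 'a) set"
  have X: "?X = edge_vector ` ?E"
  proof -
    have "?X = (\<lambda>(i, j). axis i 1 - axis j 1) ` ?E" by (auto simp: adjacency_def)
    also have "(\<lambda>(i, j). axis i 1 - axis j 1 :: real ^ 'a) = edge_vector"
      by (auto simp: edge_vector_def fun_eq_iff)
    finally show ?thesis .
  qed
  have "convex hull ?X = ?Q"
  proof
    show "convex hull ?X \<subseteq> ?Q"
    proof (rule hull_minimal)
      show "?X \<subseteq> ?Q"
      proof (clarify)
        fix i j assume ij: "{i, j} \<in> edges G"
        hence "i \<noteq> j" using assms by (auto simp: simple_graph_def)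
        moreover have "unit_flow i j \<in> flows ?E"
          using ij by (intro unit_flow_in_flows sym_adjacency) (simp add: adjacency_def)
        ultimately show "\<exists>h. axis i 1 - axis j 1 = net h \<and> h \<in> flows ?E \<and> cost (\<lambda>_ _. 1) h \<le> 1"
          by (intro exI[of _ "unit_flow i j"]) (simp add: net_unit_flow cost_unit_flow)
      qed
      show "convex ?Q"
      proof (rule convexI, clarify)
        fix u v :: real and h k
        assume uv: "0 \<le> u" "0 \<le> v" "u + v = 1"
          and h: "h \<in> flows ?E" "cost (\<lambda>_ _. 1) h \<le> 1" and k: "k \<in> flows ?E" "cost (\<lambda>_ _. 1) k \<le> 1"
        have "cost (\<lambda>_ _. 1) (u *\<^sub>R h + v *\<^sub>R k) \<le> u * cost (\<lambda>_ _. 1) h + v * cost (\<lambda>_ _. 1) k"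
          using cost_add_le[of "\<lambda>_ _. 1" "u *\<^sub>R h" "v *\<^sub>R k"] uv by (simp add: cost_scale)
        also have "\<dots> \<le> u * 1 + v * 1"
          using uv h k by (intro add_mono mult_left_mono) auto
        finally have "cost (\<lambda>_ _. 1) (u *\<^sub>R h + v *\<^sub>R k) \<le> 1" using uv by simp
        thus "\<exists>l. u *\<^sub>R net h + v *\<^sub>R net k = net l \<and> l \<in> flows ?E \<and> cost (\<lambda>_ _. 1) l \<le> 1"
          using h k by (intro exI[of _ "u *\<^sub>R h + v *\<^sub>R k"])
            (simp add: net_add net_scale flows_add flows_scale)
      qed
    qed
    show "?Q \<subseteq> convex hull ?X"
    proof (clarify)
      fix h assume h: "h \<in> flows ?E" "cost (\<lambda>_ _. 1) h \<le> 1"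
      define c where "c = (1 - cost (\<lambda>_ _. 1) h) / real (card ?E)"
      define a where "a p = max 0 (h $ fst p $ snd p) + c" for p
      obtain e where e: "e \<in> edges G" using False by blast
      then obtain i j where "e = {i, j}" using assms by (auto simp: simple_graph_def card_2_iff)
      hence ne: "?E \<noteq> {}" using e by (auto simp: adjacency_def)
      hence card: "real (card ?E) > 0" by (simp add: card_gt_0_iff)
      have c0: "c \<ge> 0" using h card by (simp add: c_def)
      have "(\<Sum>p\<in>?E. edge_vector p) = (\<Sum>p\<in>?E. edge_vector (prod.swap p) :: real ^ 'a)"
        using sym_adjacency[of G]
        by (intro sum.reindex_bij_witness[of _ prod.swap prod.swap]) (auto dest: symD)
      also have "\<dots> = - (\<Sum>p\<in>?E. edge_vector p)"
        unfolding sum_negf[symmetric] by (intro sum.cong refl) (simp add: edge_vector_def)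
      finally have "(\<Sum>p\<in>?E. edge_vector p) = (0 :: real ^ 'a)"
        by (simp add: eq_neg_iff_add_eq_0 flip: scaleR_2)
      hence "net h = (\<Sum>p\<in>?E. a p *\<^sub>R edge_vector p)"
        using net_nonneg_combination(1)[OF h(1)]
        by (simp add: a_def scaleR_add_left sum.distrib flip: scaleR_sum_right)
      also have "\<dots> \<in> convex hull ?X"
      proof (rule convex_sum)
        show "(\<Sum>p\<in>?E. a p) = 1"
          using net_nonneg_combination(2)[OF h(1)] card ne by (simp add: a_def sum.distrib c_def)
        show "edge_vector p \<in> convex hull ?X" if "p \<in> ?E" for p
          using that unfolding X by (intro hull_inc) auto
      qed (use c0 in \<open>auto simp: a_def\<close>)
      finally show "net h \<in> convex hull ?X" .
    qed
  qed
  thus ?thesis using False by (simp add: symmetric_edge_polytope_def)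
qed

lemma cost_eq_0: "cost (\<lambda>_ _. 1) h \<le> 0 \<Longrightarrow> h = 0"
proof -
  assume le: "cost (\<lambda>_ _. 1) h \<le> 0"
  have "\<bar>h $ i $ j\<bar> \<le> 0" for i j
    using entry_le_double_sum[of "\<lambda>i j. \<bar>h $ i $ j\<bar>" i j] le by (simp add: cost_def)
  thus "h = 0" by (simp add: vec_eq_iff)
qed

lemma lattice_point_count_eq:
  assumes "simple_graph G"
  shows "lattice_point_count (symmetric_edge_polytope G) m = card (lattice_points (adjacency G) m)"
proof -
  let ?E = "adjacency G"
  have "(\<lambda>x. real m *\<^sub>R x) ` symmetric_edge_polytope G
      = {net h |h. h \<in> flows ?E \<and> cost (\<lambda>_ _. 1) h \<le> real m}" (is "?L = ?R")
  proof
    show "?L \<subseteq> ?R"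
    proof (clarsimp simp: symmetric_edge_polytope_eq_flows[OF assms])
      fix h assume h: "h \<in> flows ?E" "cost (\<lambda>_ _. 1) h \<le> 1"
      thus "\<exists>k. real m *\<^sub>R net h = net k \<and> k \<in> flows ?E \<and> cost (\<lambda>_ _. 1) k \<le> real m"
        by (intro exI[of _ "real m *\<^sub>R h"])
          (simp add: net_scale flows_scale cost_scale mult_left_le)
    qed
    show "?R \<subseteq> ?L"
    proof (clarify)
      fix h assume h: "h \<in> flows ?E" "cost (\<lambda>_ _. 1) h \<le> real m"
      show "net h \<in> ?L"
      proof (cases "m = 0")
        case True
        hence "h = 0" using h cost_eq_0 by simp
        moreover have "0 \<in> symmetric_edge_polytope G"
          unfolding symmetric_edge_polytope_eq_flows[OF assms]
          using flows_zero[of ?E] net_zero by (auto simp: cost_def intro!: exI[of _ 0])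
        ultimately show ?thesis using net_zero by force
      next
        case False
        hence "net ((1 / real m) *\<^sub>R h) \<in> symmetric_edge_polytope G"
          unfolding symmetric_edge_polytope_eq_flows[OF assms]
          using h by (intro CollectI exI[of _ "(1 / real m) *\<^sub>R h"])
            (simp add: flows_scale cost_scale divide_le_eq)
        moreover have "net h = real m *\<^sub>R net ((1 / real m) *\<^sub>R h)"
          using False by (simp add: net_scale)
        ultimately show ?thesis by blast
      qed
    qed
  qed
  hence "?L \<inter> {x. \<forall>i. x $ i \<in> \<int>} = lattice_points ?E m"
    by (auto simp: lattice_points_def)
  thus ?thesis by (simp add: lattice_point_count_def)
qed

lemma polytope_dim_eq:
  assumes "simple_graph G"
  shows "polytope_dim (symmetric_edge_polytope G) = dim (edge_vector ` adjacency G)"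
proof -
  let ?P = "symmetric_edge_polytope G" and ?E = "adjacency G"
  have P: "?P = {net h |h. h \<in> flows ?E \<and> cost (\<lambda>_ _. 1) h \<le> 1}"
    by (rule symmetric_edge_polytope_eq_flows[OF assms])
  have "0 \<in> ?P"
    unfolding P using flows_zero[of ?E] net_zero by (auto simp: cost_def intro!: exI[of _ 0])
  hence "aff_dim ?P = int (dim ?P)"
    by (intro aff_dim_zero hull_inc)
  moreover have "span ?P = span (edge_vector ` ?E)"
  proof (rule subset_antisym; rule span_minimal)
    show "?P \<subseteq> span (edge_vector ` ?E)"
    proof (unfold P, clarify)
      fix h assume "h \<in> flows ?E"
      thus "net h \<in> span (edge_vector ` ?E)"
        unfolding net_nonneg_combination(1)[OF \<open>h \<in> flows ?E\<close>]
        by (intro span_sum span_scale span_base imageI)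
    qed
    show "edge_vector ` ?E \<subseteq> span ?P"
    proof (clarify)
      fix i j assume ij: "(i, j) \<in> ?E"
      hence "i \<noteq> j" using irrefl_adjacency[OF assms] by (auto simp: irrefl_def)
      moreover have "unit_flow i j \<in> flows ?E" using ij by (intro unit_flow_in_flows sym_adjacency)
      ultimately have "edge_vector (i, j) \<in> ?P"
        unfolding P by (intro CollectI exI[of _ "unit_flow i j"])
          (simp add: net_unit_flow cost_unit_flow edge_vector_def)
      thus "edge_vector (i, j) \<in> span ?P" by (rule span_base)
    qed
  qed auto
  ultimately show ?thesis unfolding polytope_dim_def by (metis nat_int span_eq_dim)
qed

text \<open>The expansion exists and is unique, so it is the one that defines the \<open>h\<^sup>*\<close>-vector.\<close>

lemma h_star_expansion:
  assumes "simple_graph G"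
  defines "d \<equiv> dim (edge_vector ` adjacency G)"
    and "h \<equiv> h_star (symmetric_edge_polytope G)"
  shows "j > d \<Longrightarrow> h j = 0" "j \<le> d \<Longrightarrow> h (d - j) = h j"
    "int (card (lattice_points (adjacency G) m)) = (\<Sum>j=0..d. h j * int ((m + d - j) choose d))"
proof -
  have "(\<lambda>(i, j). axis i 1 - axis j 1 :: real ^ 'a) = edge_vector"
    by (auto simp: edge_vector_def fun_eq_iff)
  hence d': "d = dim ((\<lambda>(i, j). axis i 1 - axis j 1 :: real ^ 'a) ` adjacency G)"
    by (simp add: d_def)
  obtain h0 :: "nat \<Rightarrow> int" where h0: "\<And>j. j > d \<Longrightarrow> h0 j = 0" "\<And>j. j \<le> d \<Longrightarrow> h0 (d - j) = h0 j"
    "\<And>m. int (card (lattice_points (adjacency G) m)) = (\<Sum>j=0..d. h0 j * int ((m + d - j) choose d))"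
    using lattice_points_h_vector[OF sym_adjacency irrefl_adjacency[OF assms(1)] d'] by blast
  have "h = h0"
    unfolding h_def h_star_def polytope_dim_eq[OF assms(1)] lattice_point_count_eq[OF assms(1)]
      Let_def d_def[symmetric]
  proof (rule the_equality)
    show "(\<forall>j>d. h0 j = 0) \<and> (\<forall>m. int (card (lattice_points (adjacency G) m))
        = (\<Sum>j=0..d. h0 j * int ((m + d - j) choose d)))"
      using h0(1,3) by blast
    fix h1 :: "nat \<Rightarrow> int"
    assume h1: "(\<forall>j>d. h1 j = 0) \<and> (\<forall>m. int (card (lattice_points (adjacency G) m))
        = (\<Sum>j=0..d. h1 j * int ((m + d - j) choose d)))"
    show "h1 = h0"
    proof
      fix j
      show "h1 j = h0 j"
      proof (cases "j \<le> d")
        case True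
        show ?thesis
          by (rule binomial_expansion_unique[OF _ True]) (use h1 h0(3) in metis)
      next
        case False
        thus ?thesis using h1 h0(1) by simp
      qed
    qed
  qed
  thus "j > d \<Longrightarrow> h j = 0" "j \<le> d \<Longrightarrow> h (d - j) = h j"
    "int (card (lattice_points (adjacency G) m)) = (\<Sum>j=0..d. h j * int ((m + d - j) choose d))"
    using h0 by blast+
qed

section \<open>The gamma vector\<close>

lemma coeff_one_plus_power: "coeff ([:1, 1:] ^ n :: int poly) k = int (n choose k)"
proof (cases "k \<le> n")
  case True
  thus ?thesis by (simp add: coeff_linear_poly_power)
next
  case False
  have "degree ([:1, 1:] ^ n :: int poly) = n" by (rule degree_linear_power)
  thus ?thesis using False by (simp add: coeff_eq_0 binomial_eq_0)
qed

lemma coeff_gamma_sum: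
  "coeff (\<Sum>i=0..N. smult (g i) (monom 1 i * [:1, 1:] ^ (d - 2 * i))) k
    = (\<Sum>i=0..N. if k < i then 0 else g i * int ((d - 2 * i) choose (k - i)))"
  by (simp add: coeff_sum coeff_monom_mult coeff_one_plus_power if_distrib cong: if_cong)

lemma coeff_monom_sum: "coeff (\<Sum>j=0..d. monom (h j) j) k = (if k \<le> d then h k else (0::int))"
  by (simp add: coeff_sum)

text \<open>Subtracting \<open>h 0\<close> times \<open>(1 + t) ^ d\<close> removes the constant and the leading coefficient; what remains
  is \<open>t\<close> times a polynomial that is symmetric with respect to degree \<open>d - 2\<close>.\<close>

lemma palindromic_gamma_expansion:
  fixes h :: "nat \<Rightarrow> int"
  assumes "\<And>j. j \<le> d \<Longrightarrow> h (d - j) = h j"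
  shows "\<exists>g. (\<forall>i>d div 2. g i = 0) \<and>
    (\<Sum>i=0..d div 2. smult (g i) (monom 1 i * [:1, 1:] ^ (d - 2 * i))) = (\<Sum>j=0..d. monom (h j) j)"
  using assms
proof (induction d arbitrary: h rule: less_induct)
  case (less d)
  show ?case
  proof (cases "d < 2")
    case True
    define g where "g i = (if i = 0 then h 0 else 0)" for i :: nat
    have "(\<Sum>i=0..d div 2. smult (g i) (monom 1 i * [:1, 1:] ^ (d - 2 * i))) = (\<Sum>j=0..d. monom (h j) j)"
    proof (rule poly_eqI)
      fix k :: nat
      consider "d = 0" "k = 0" | "d = 0" "k > 0" | "d = 1" "k = 0" | "d = 1" "k = 1" | "d = 1" "k > 1"
        using True by linarith
      thus "coeff (\<Sum>i=0..d div 2. smult (g i) (monom 1 i * [:1, 1:] ^ (d - 2 * i))) k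
          = coeff (\<Sum>j=0..d. monom (h j) j) k"
        unfolding coeff_gamma_sum coeff_monom_sum
        by cases (use less.prems[of 0] in \<open>auto simp: g_def binomial_eq_0\<close>)
    qed
    thus ?thesis by (intro exI[of _ g]) (simp add: g_def)
  next
    case False
    define h' where "h' j = h (j + 1) - h 0 * int (d choose (j + 1))" for j
    have "h' (d - 2 - j) = h' j" if "j \<le> d - 2" for j
    proof -
      have "d - 2 - j + 1 = d - (j + 1)" using that False by simp
      moreover have "d choose (d - (j + 1)) = d choose (j + 1)"
        using that False by (intro binomial_symmetric[symmetric]) simp
      moreover have "h (d - (j + 1)) = h (j + 1)"
        using that False by (intro less.prems) simp
      ultimately show ?thesis by (simp only: h'_def)
    qed
    then obtain g' where g': "\<forall>i>(d - 2) div 2. g' i = 0"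
      "(\<Sum>i=0..(d - 2) div 2. smult (g' i) (monom 1 i * [:1, 1:] ^ (d - 2 - 2 * i)))
        = (\<Sum>j=0..d - 2. monom (h' j) j)"
      using less.IH[of "d - 2" h'] False by auto
    define g where "g i = (case i of 0 \<Rightarrow> h 0 | Suc i \<Rightarrow> g' i)" for i
    have d2: "d div 2 = Suc ((d - 2) div 2)" using False by simp
    have "(\<Sum>i=0..d div 2. smult (g i) (monom 1 i * [:1, 1:] ^ (d - 2 * i)))
        = smult (h 0) ([:1, 1:] ^ d)
          + (\<Sum>i=0..(d - 2) div 2. smult (g' i) (monom 1 (Suc i) * [:1, 1:] ^ (d - 2 * Suc i)))"
      unfolding d2 by (subst sum.atLeast0_atMost_Suc_shift) (simp add: g_def)
    also have "(\<Sum>i=0..(d - 2) div 2. smult (g' i) (monom 1 (Suc i) * [:1, 1:] ^ (d - 2 * Suc i)))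
        = monom 1 1 * (\<Sum>i=0..(d - 2) div 2. smult (g' i) (monom 1 i * [:1, 1:] ^ (d - 2 - 2 * i)))"
      unfolding sum_distrib_left
    proof (intro sum.cong refl)
      fix i
      have "d - 2 * Suc i = d - 2 - 2 * i" by simp
      moreover have "monom 1 (Suc i) = monom 1 1 * (monom 1 i :: int poly)"
        by (simp add: mult_monom)
      ultimately show "smult (g' i) (monom 1 (Suc i) * [:1, 1:] ^ (d - 2 * Suc i))
          = monom 1 1 * smult (g' i) (monom 1 i * [:1, 1:] ^ (d - 2 - 2 * i))"
        by (simp only: mult_smult_right mult.assoc)
    qed
    also have "\<dots> = monom 1 1 * (\<Sum>j=0..d - 2. monom (h' j) j)" by (simp only: g'(2))
    also have "smult (h 0) ([:1, 1:] ^ d) + monom 1 1 * (\<Sum>j=0..d - 2. monom (h' j) j)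
        = (\<Sum>j=0..d. monom (h j) j)"
    proof (rule poly_eqI)
      fix k
      have "h d = h 0" using less.prems[of 0] by simp
      have "coeff (monom 1 1 * (\<Sum>j=0..d - 2. monom (h' j) j)) k
          = (if 1 \<le> k \<and> k \<le> d - 1 then h' (k - 1) else 0)"
        unfolding coeff_monom_mult coeff_monom_sum using False by auto
      moreover have "k = 0 \<or> (1 \<le> k \<and> k \<le> d - 1) \<or> k = d \<or> d < k" by auto
      ultimately show "coeff (smult (h 0) ([:1, 1:] ^ d) + monom 1 1 * (\<Sum>j=0..d - 2. monom (h' j) j)) k
          = coeff (\<Sum>j=0..d. monom (h j) j) k"
        using False \<open>h d = h 0\<close>
        by (auto simp: coeff_monom_sum coeff_one_plus_power h'_def binomial_eq_0)
    qed
    finally have "(\<Sum>i=0..d div 2. smult (g i) (monom 1 i * [:1, 1:] ^ (d - 2 * i)))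
        = (\<Sum>j=0..d. monom (h j) j)" .
    moreover have "\<forall>i>d div 2. g i = 0"
      using g'(1) unfolding d2 by (auto simp: g_def split: nat.split)
    ultimately show ?thesis by blast
  qed
qed

text \<open>The lowest power of \<open>t\<close> in the \<open>i\<close>-th summand is \<open>t ^ i\<close>, so the system is triangular.\<close>

lemma gamma_expansion_unique:
  fixes g g' :: "nat \<Rightarrow> int"
  assumes "(\<Sum>i=0..N. smult (g i) (monom 1 i * [:1, 1:] ^ (d - 2 * i)))
      = (\<Sum>i=0..N. smult (g' i) (monom 1 i * [:1, 1:] ^ (d - 2 * i)))"
    and "i \<le> N"
  shows "g i = g' i"
  using assms(2)
proof (induction i rule: less_induct)
  case (less k)
  define D where "D i = g i - g' i" for i
  have "(\<Sum>i=0..N. if k < i then 0 else g i * int ((d - 2 * i) choose (k - i)))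
      = (\<Sum>i=0..N. if k < i then 0 else g' i * int ((d - 2 * i) choose (k - i)))"
    using arg_cong[OF assms(1), of "\<lambda>p. coeff p k"] unfolding coeff_gamma_sum .
  hence "0 = (\<Sum>i=0..N. (if k < i then 0 else g i * int ((d - 2 * i) choose (k - i)))
      - (if k < i then 0 else g' i * int ((d - 2 * i) choose (k - i))))"
    by (simp add: sum_subtractf)
  also have "\<dots> = (\<Sum>i\<in>{k}. (if k < i then 0 else g i * int ((d - 2 * i) choose (k - i)))
      - (if k < i then 0 else g' i * int ((d - 2 * i) choose (k - i))))"
    using less by (intro sum.mono_neutral_right) auto
  also have "\<dots> = g k - g' k" by simp
  finally show ?case by simp
qed

lemma gamma_vector_expansion:
  assumes "simple_graph G"
  defines "d \<equiv> dim (edge_vector ` adjacency G)"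
    and "g \<equiv> gamma_vector (symmetric_edge_polytope G)"
  shows "i > d div 2 \<Longrightarrow> g i = 0"
    and "k \<le> d \<Longrightarrow> (\<Sum>i=0..d div 2. if k < i then 0 else g i * int ((d - 2 * i) choose (k - i)))
      = h_star (symmetric_edge_polytope G) k"
proof -
  let ?h = "h_star (symmetric_edge_polytope G)"
  obtain g0 where g0: "\<forall>i>d div 2. g0 i = 0"
    "(\<Sum>i=0..d div 2. smult (g0 i) (monom 1 i * [:1, 1:] ^ (d - 2 * i))) = (\<Sum>j=0..d. monom (?h j) j)"
    using palindromic_gamma_expansion[of d ?h] h_star_expansion(2)[OF assms(1)] unfolding d_def
    by blast
  have "g = g0"
    unfolding g_def gamma_vector_def polytope_dim_eq[OF assms(1)] Let_def d_def[symmetric]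
  proof (rule the_equality)
    show "(\<forall>i>d div 2. g0 i = 0) \<and> (\<Sum>i=0..d div 2. smult (g0 i) (monom 1 i * [:1, 1:] ^ (d - 2 * i)))
        = (\<Sum>j=0..d. monom (?h j) j)"
      using g0 by blast
    fix g1 assume g1: "(\<forall>i>d div 2. g1 i = 0) \<and>
      (\<Sum>i=0..d div 2. smult (g1 i) (monom 1 i * [:1, 1:] ^ (d - 2 * i))) = (\<Sum>j=0..d. monom (?h j) j)"
    show "g1 = g0"
    proof
      fix i
      show "g1 i = g0 i"
      proof (cases "i \<le> d div 2")
        case True
        show ?thesis
          by (rule gamma_expansion_unique[OF _ True, of _ d]) (simp only: g0(2) g1)
      next
        case False
        thus ?thesis using g0(1) g1 by simp
      qed
    qed
  qed
  thus "i > d div 2 \<Longrightarrow> g i = 0" using g0(1) by blast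
  assume "k \<le> d"
  thus "(\<Sum>i=0..d div 2. if k < i then 0 else g i * int ((d - 2 * i) choose (k - i))) = ?h k"
    using arg_cong[OF g0(2), of "\<lambda>p. coeff p k"]
    unfolding coeff_gamma_sum coeff_monom_sum \<open>g = g0\<close> by simp
qed

lemma sum_first_terms:
  fixes f :: "nat \<Rightarrow> int"
  assumes "2 \<le> N"
  shows "(\<Sum>i=0..N. if 0 < i then 0 else f i) = f 0"
    "(\<Sum>i=0..N. if 1 < i then 0 else f i) = f 0 + f 1"
    "(\<Sum>i=0..N. if 2 < i then 0 else f i) = f 0 + f 1 + f 2"
proof -
  have "(\<Sum>i=0..N. if k < i then 0 else f i) = (\<Sum>i=0..k. f i)" if "k \<le> N" for k
    using that by (intro sum.mono_neutral_cong_right) auto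
  from this[of 0] this[of 1] this[of 2] assms
  show "(\<Sum>i=0..N. if 0 < i then 0 else f i) = f 0"
    "(\<Sum>i=0..N. if 1 < i then 0 else f i) = f 0 + f 1"
    "(\<Sum>i=0..N. if 2 < i then 0 else f i) = f 0 + f 1 + f 2"
    by (simp_all add: numeral_2_eq_2)
qed

lemma choose_two_int: "2 * int (n choose 2) = int n * (int n - 1)"
proof -
  have "even (n * (n - 1))" by (cases n) auto
  hence "2 * (n choose 2) = n * (n - 1)" by (simp add: choose_two)
  hence "int (2 * (n choose 2)) = int (n * (n - 1))" by simp
  thus ?thesis by (cases n) (simp_all add: algebra_simps)
qed

lemma choose_diff_two: "(k + d) choose d = (k + d) choose k"
  using binomial_symmetric[of k "k + d"] by simp

lemma gamma_2_small_dim: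
  assumes "simple_graph G" "dim (edge_vector ` adjacency G) < 4"
  shows "gamma_vector (symmetric_edge_polytope G) 2 = 0"
  using assms by (intro gamma_vector_expansion(1)) auto

text \<open>The first three coefficients of both expansions are solved for \<open>\<gamma>\<^sub>2\<close>.\<close>

lemma gamma_2_lattice_points:
  assumes G: "simple_graph G" and d: "d = dim (edge_vector ` adjacency G)" "d \<ge> 4"
    and L0: "card (lattice_points (adjacency G) 0) = 1"
  shows "gamma_vector (symmetric_edge_polytope G) 2 = int (card (lattice_points (adjacency G) 2))
    - (2 * int d - 1) * int (card (lattice_points (adjacency G) 1)) + 2 * (int d)\<^sup>2 - 2 * int d - 2"
proof -
  let ?h = "h_star (symmetric_edge_polytope G)" and ?g = "gamma_vector (symmetric_edge_polytope G)"
  define L where "L m = int (card (lattice_points (adjacency G) m))" for m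
  have N: "2 \<le> d div 2" using d(2) by simp
  have L: "L m = (\<Sum>j=0..m. ?h j * int ((m + d - j) choose d))" if "m \<le> d" for m
  proof -
    have "L m = (\<Sum>j=0..d. ?h j * int ((m + d - j) choose d))"
      using h_star_expansion(3)[OF G] by (simp add: L_def d(1))
    also have "\<dots> = (\<Sum>j=0..m. ?h j * int ((m + d - j) choose d))"
      using that by (intro sum.mono_neutral_right) (auto simp: binomial_eq_0)
    finally show ?thesis .
  qed
  have h0: "?h 0 = 1" using L[of 0] L0 by (simp add: L_def)
  have L1: "L 1 = int d + 1 + ?h 1"
    using L[of 1] d(2) h0 choose_diff_two[of 1 d] by simp
  have "L 2 = int ((2 + d) choose 2) + ?h 1 * (int d + 1) + ?h 2"
    using L[of 2] d(2) h0 choose_diff_two[of 1 d] choose_diff_two[of 2 d]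
    by (simp add: numeral_2_eq_2 del: binomial_Suc_Suc)
  moreover have "?g 0 = 1"
    using gamma_vector_expansion(2)[OF G, of 0] sum_first_terms(1)[OF N] h0 by (simp flip: d(1))
  moreover have "?g 0 * int d + ?g 1 = ?h 1"
    using gamma_vector_expansion(2)[OF G, of 1] sum_first_terms(2)[OF N] d(2) by (simp flip: d(1))
  moreover have "?g 0 * int (d choose 2) + ?g 1 * (int d - 2) + ?g 2 = ?h 2"
    using gamma_vector_expansion(2)[OF G, of 2] sum_first_terms(3)[OF N] d(2) by (simp flip: d(1))
  moreover have "2 * int ((2 + d) choose 2) = (int d + 2) * (int d + 1)"
    using choose_two_int[of "2 + d"] by (simp add: algebra_simps)
  moreover note choose_two_int[of d] L1
  ultimately have "2 * ?g 2 = 2 * (L 2 - (2 * int d - 1) * L 1 + 2 * (int d)\<^sup>2 - 2 * int d - 2)"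
    by algebra
  thus ?thesis by (simp add: L_def)
qed

section \<open>Lattice points of length at most two\<close>

abbreviation basis_vec :: "'n \<Rightarrow> real ^ 'n::finite" where "basis_vec i \<equiv> axis i 1"

definition edge_vectors :: "'n set set \<Rightarrow> (real ^ 'n::finite) set" where
  "edge_vectors F = {basis_vec i - basis_vec j | i j. {i, j} \<in> F}"

text \<open>Balls of radius 1 and 2 in the word metric of the lattice generated by the edge vectors.\<close>

definition unit_ball :: "'n set set \<Rightarrow> (real ^ 'n::finite) set" where
  "unit_ball F = insert 0 (edge_vectors F)"

definition double_ball :: "'n set set \<Rightarrow> (real ^ 'n::finite) set" where
  "double_ball F = (\<lambda>(x, y). x + y) ` (unit_ball F \<times> unit_ball F)"

lemma edge_vectors_image: "edge_vectors F = edge_vector ` {(i, j). {i, j} \<in> F}"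
proof -
  have "edge_vectors F = (\<lambda>(i, j). basis_vec i - basis_vec j) ` {(i, j). {i, j} \<in> F}"
    by (auto simp: edge_vectors_def)
  also have "(\<lambda>(i, j). basis_vec i - basis_vec j) = edge_vector"
    by (auto simp: edge_vector_def fun_eq_iff)
  finally show ?thesis .
qed

lemma edge_vectors_eq: "edge_vectors (edges G) = edge_vector ` adjacency G"
  by (simp add: edge_vectors_image adjacency_def)

lemma lattice_point_imp_combination:
  assumes "sym E" "irrefl E" "x \<in> lattice_points E m"
  obtains f where "\<And>p. p \<notin> E \<Longrightarrow> f p = 0" "sum f E \<le> m" "x = (\<Sum>p\<in>E. real (f p) *\<^sub>R edge_vector p)"
proof -
  define \<eta> where "\<eta> = 1 / (real m + 1)"
  have \<eta>: "\<eta> > 0" "\<eta> * real m < 1" by (simp_all add: \<eta>_def add_nonneg_pos)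
  then obtain w :: "'a \<Rightarrow> 'a \<Rightarrow> real"
    where w: "generic w" "\<And>i j. 1 \<le> w i j" "\<And>i j. w i j \<le> 1 + \<eta>"
    using generic_weights_exist[of \<eta>] by metis
  define e where "e = 1 / (real CARD('a) + 1)"
  have e: "e > 0" "e * real CARD('a) < 1" by (simp_all add: e_def add_nonneg_pos)
  interpret weighted_relation E w e
    by unfold_locales (use assms w e in auto)
  obtain C f where C: "C \<in> facets" and f: "f \<in> fillings C (down_arcs C) m" and x: "x = net (flow_of f)"
    using lattice_point_has_filling[OF assms(3) w(3) \<eta>(2)] by metis
  have CE: "C \<subseteq> E" using facet_subset[OF C] by blast
  have f0: "f p = 0" if "p \<notin> C" for p using f that unfolding fillings_def by blast
  have "x = (\<Sum>p\<in>UNIV. real (f p) *\<^sub>R edge_vector p)"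
    unfolding x by (rule net_eq_combination) (simp add: flow_of_def)
  also have "\<dots> = (\<Sum>p\<in>E. real (f p) *\<^sub>R edge_vector p)"
    using f0 CE by (intro sum.mono_neutral_right) auto
  finally have "x = (\<Sum>p\<in>E. real (f p) *\<^sub>R edge_vector p)" .
  moreover have "sum f E = sum f C"
    using f0 CE by (intro sum.mono_neutral_right) auto
  hence "sum f E \<le> m" using f by (simp add: fillings_def)
  moreover have "f p = 0" if "p \<notin> E" for p using f0 CE that by blast
  ultimately show ?thesis using that by blast
qed

lemma lattice_points_0: "sym E \<Longrightarrow> irrefl E \<Longrightarrow> lattice_points E 0 = {0}"
proof
  show "lattice_points E 0 \<subseteq> {0}"
    using cost_eq_0 net_zero by (fastforce simp: lattice_points_def)
  show "{0} \<subseteq> lattice_points E 0"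
    using flows_zero[of E] net_zero by (auto simp: lattice_points_def cost_def intro!: bexI[of _ 0])
qed

lemma lattice_points_mono: "m \<le> m' \<Longrightarrow> lattice_points E m \<subseteq> lattice_points E m'"
proof
  fix x assume m: "m \<le> m'" and "x \<in> lattice_points E m"
  then obtain h where h: "\<forall>i. x $ i \<in> \<int>" "h \<in> flows E" "net h = x" "cost (\<lambda>_ _. 1) h \<le> real m"
    unfolding lattice_points_def by blast
  have "cost (\<lambda>_ _. 1) h \<le> real m'" by (rule order_trans[OF h(4)]) (use m in simp)
  thus "x \<in> lattice_points E m'" using h unfolding lattice_points_def by blast
qed

text \<open>A lattice point of the larger dilate has an integral flow, and taking one unit off some arc of it gives a
  point of the smaller dilate. By induction, the \<open>m\<close>-th dilate contains the sums of at most \<open>m\<close> edge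
  vectors and nothing else.\<close>

lemma lattice_points_Suc:
  assumes "sym E" "irrefl E"
  shows "lattice_points E (Suc m)
    = (\<lambda>(x, y). x + y) ` (lattice_points E m \<times> insert 0 (edge_vector ` E))" (is "?L = ?R")
proof
  show "?L \<subseteq> ?R"
  proof
    fix x assume "x \<in> ?L"
    then obtain f where f: "\<And>p. p \<notin> E \<Longrightarrow> f p = 0" "sum f E \<le> Suc m"
      "x = (\<Sum>p\<in>E. real (f p) *\<^sub>R edge_vector p)"
      using lattice_point_imp_combination[OF assms] by metis
    have comb: "(\<Sum>p\<in>E. real (g p) *\<^sub>R edge_vector p) \<in> lattice_points E k" if "sum g E \<le> k" for g k
    proof -
      let ?h = "\<Sum>p\<in>E. real (g p) *\<^sub>R unit_flow (fst p) (snd p)"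
      have "?h \<in> flows E"
        by (intro subspace_sum subspace_flows flows_scale unit_flow_in_flows assms) simp
      moreover have net: "net ?h = (\<Sum>p\<in>E. real (g p) *\<^sub>R edge_vector p)"
        by (simp add: linear_sum[OF linear_net] net_scale net_unit_flow edge_vector_def)
      moreover have "cost (\<lambda>_ _. 1) ?h \<le> real k"
      proof -
        have "cost (\<lambda>_ _. 1) (\<Sum>p\<in>A. real (g p) *\<^sub>R unit_flow (fst p) (snd p)) \<le> real (sum g A)"
          if "A \<subseteq> E" for A
          using finite[of A] that
        proof (induction A rule: finite_induct)
          case empty
          show ?case by (simp add: cost_def)
        next
          case (insert p A)
          have ne: "fst p \<noteq> snd p"
            using insert.prems assms(2) by (cases p) (auto simp: irrefl_def)
          have "cost (\<lambda>_ _. 1) (real (g p) *\<^sub>R unit_flow (fst p) (snd p)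
              + (\<Sum>p\<in>A. real (g p) *\<^sub>R unit_flow (fst p) (snd p)))
              \<le> real (g p) * 1 + real (sum g A)"
            using insert cost_unit_flow[OF ne] by (intro order_trans[OF cost_add_le] add_mono)
              (auto simp: cost_scale)
          thus ?case using insert.hyps by simp
        qed
        from this[OF subset_refl] show ?thesis
          by (rule order_trans) (use that in \<open>simp only: of_nat_le_iff\<close>)
      qed
      moreover have "(\<Sum>p\<in>E. real (g p) *\<^sub>R edge_vector p) $ i \<in> \<int>" for i
        by (auto simp: edge_vector_def axis_def intro!: Ints_mult)
      ultimately show ?thesis unfolding lattice_points_def by blast
    qed
    show "x \<in> ?R"
    proof (cases "\<exists>p\<in>E. f p > 0")
      case True
      then obtain p where p: "p \<in> E" "f p > 0" by blast
      define g where "g = f(p := f p - 1)"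
      have fp: "real (f p) = real (g p) + 1" using p by (simp add: g_def)
      have "sum f E = f p + sum f (E - {p})" using p by (intro sum.remove) auto
      moreover have "sum g E = g p + sum g (E - {p})" using p by (intro sum.remove) auto
      moreover have "sum g (E - {p}) = sum f (E - {p})" by (intro sum.cong) (auto simp: g_def)
      ultimately have "sum g E \<le> m" using f(2) p by (simp add: g_def)
      hence "(\<Sum>p\<in>E. real (g p) *\<^sub>R edge_vector p) \<in> lattice_points E m" by (rule comb)
      moreover have "x = (\<Sum>p\<in>E. real (g p) *\<^sub>R edge_vector p) + edge_vector p"
      proof -
        have "x = real (f p) *\<^sub>R edge_vector p + (\<Sum>q\<in>E - {p}. real (f q) *\<^sub>R edge_vector q)"
          unfolding f(3) using p by (intro sum.remove) auto
        moreover have "(\<Sum>q\<in>E. real (g q) *\<^sub>R edge_vector q)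
            = real (g p) *\<^sub>R edge_vector p + (\<Sum>q\<in>E - {p}. real (g q) *\<^sub>R edge_vector q :: real ^ 'a)"
          using p by (intro sum.remove) auto
        moreover have "(\<Sum>q\<in>E - {p}. real (g q) *\<^sub>R edge_vector q)
            = (\<Sum>q\<in>E - {p}. real (f q) *\<^sub>R edge_vector q :: real ^ 'a)"
          by (intro sum.cong) (auto simp: g_def)
        ultimately show ?thesis unfolding fp by (simp add: scaleR_add_left)
      qed
      ultimately show ?thesis
        using p(1) by (intro rev_image_eqI[of "(_, edge_vector p)"] SigmaI) auto
    next
      case False
      hence "x = 0" using f(3) by simp
      moreover have "0 \<in> lattice_points E m"
        using lattice_points_0[OF assms] lattice_points_mono[of 0 m E] by auto
      ultimately show ?thesis by (intro rev_image_eqI[of "(0, 0)"]) auto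
    qed
  qed
  show "?R \<subseteq> ?L"
  proof (clarify)
    fix x y assume x: "x \<in> lattice_points E m" and y: "y \<in> insert 0 (edge_vector ` E)"
    show "x + y \<in> ?L"
    proof (cases "y = 0")
      case True
      thus ?thesis using x lattice_points_mono[of m "Suc m" E] by auto
    next
      case False
      then obtain p where p: "p \<in> E" "y = edge_vector p" using y by auto
      have ne: "fst p \<noteq> snd p" using p assms(2) by (cases p) (auto simp: irrefl_def)
      obtain h where h: "h \<in> flows E" "net h = x" "cost (\<lambda>_ _. 1) h \<le> real m"
        using x by (auto simp: lattice_points_def)
      let ?k = "h + unit_flow (fst p) (snd p)"
      have "?k \<in> flows E" using h p assms by (intro flows_add unit_flow_in_flows) auto
      moreover have "net ?k = x + y"
        by (simp add: net_add h net_unit_flow p edge_vector_def)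
      moreover have "cost (\<lambda>_ _. 1) ?k \<le> real (Suc m)"
        using cost_add_le[of "\<lambda>_ _. 1" h "unit_flow (fst p) (snd p)"] cost_unit_flow[OF ne] h by simp
      moreover have "(x + y) $ i \<in> \<int>" for i
        using x p(2) by (auto simp: lattice_points_def edge_vector_def axis_def intro!: Ints_add)
      ultimately show ?thesis unfolding lattice_points_def by blast
    qed
  qed
qed

lemma lattice_points_1:
  assumes "simple_graph G"
  shows "lattice_points (adjacency G) 1 = unit_ball (edges G)"
  using lattice_points_Suc[OF sym_adjacency irrefl_adjacency[OF assms], of 0]
  by (simp add: lattice_points_0[OF sym_adjacency irrefl_adjacency[OF assms]] unit_ball_def
      edge_vectors_eq image_image split_def flip: insert_Times_insert)
    (force simp: image_iff)

lemma lattice_points_2: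
  assumes "simple_graph G"
  shows "lattice_points (adjacency G) 2 = double_ball (edges G)"
  using lattice_points_Suc[OF sym_adjacency irrefl_adjacency[OF assms], of 1]
    lattice_points_1[OF assms]
  by (simp add: double_ball_def unit_ball_def edge_vectors_eq numeral_2_eq_2)

subsection \<open>Sums of two basis vectors\<close>

lemma basis_sum_eqD:
  assumes "basis_vec a + basis_vec b = basis_vec c + (basis_vec d :: real ^ 'n::finite)"
  shows "(a = c \<and> b = d) \<or> (a = d \<and> b = c)"
proof -
  have eq: "(if k = a then 1 else 0) + (if k = b then 1 else 0)
      = (if k = c then 1 else 0) + (if k = d then 1 else (0::real))" for k
    using arg_cong[OF assms, of "\<lambda>x. x $ k"] by (simp add: axis_def eq_commute)
  show ?thesis using eq[of a] eq[of b] eq[of c] by (auto split: if_splits)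
qed

definition pair_sums :: "'n set \<Rightarrow> 'n set \<Rightarrow> (real ^ 'n::finite) set" where
  "pair_sums A B = (\<lambda>(i, j). basis_vec i + basis_vec j) ` (A \<times> B)"

text \<open>Only the pairs with two different entries in \<open>A \<inter> B\<close> give a sum twice.\<close>

lemma card_pair_sums:
  "card (pair_sums A B) + (card (A \<inter> B) choose 2) = card A * card B"
  for A B :: "'n::finite set"
proof -
  let ?f = "\<lambda>(i, j). basis_vec i + basis_vec j :: real ^ 'n"
  let ?I = "A \<inter> B"
  let ?X = "A \<times> B - ?I \<times> ?I" and ?D = "(\<lambda>i. (i, i)) ` ?I" and ?O = "?I \<times> ?I - (\<lambda>i. (i, i)) ` ?I"
  let ?P = "{s. s \<subseteq> ?I \<and> card s = 2}"
  have img: "pair_sums A B = ?f ` ?X \<union> ?f ` ?D \<union> ?f ` ?O"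
    unfolding pair_sums_def image_Un[symmetric] by (intro arg_cong[of _ _ "image ?f"]) auto
  have key: "q = p \<or> q = (snd p, fst p)" if "?f p = ?f q" for p q
    using basis_sum_eqD[of "fst p" "snd p" "fst q" "snd q"] that
    by (auto simp: split_def prod_eq_iff)
  have "inj_on ?f ?X"
  proof (rule inj_onI)
    fix p q assume "p \<in> ?X" "q \<in> ?X" "?f p = ?f q"
    thus "p = q" using key[of p q] by (cases p; cases q) auto
  qed
  hence X: "card (?f ` ?X) = card A * card B - card ?I * card ?I"
  proof (subst card_image)
    have "card ?X = card (A \<times> B) - card (?I \<times> ?I)" by (rule card_Diff_subset) auto
    thus "card ?X = card A * card B - card ?I * card ?I" by (simp add: card_cartesian_product)
  qed
  have "inj_on ?f ?D"
  proof (rule inj_onI)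
    fix p q assume "p \<in> ?D" "q \<in> ?D" "?f p = ?f q"
    thus "p = q" using key[of p q] by (cases p; cases q) auto
  qed
  hence D: "card (?f ` ?D) = card ?I"
    by (subst card_image) (auto simp: card_image inj_on_def)
  have "?f ` ?O = (\<lambda>s. \<Sum>i\<in>s. basis_vec i) ` ?P"
  proof
    show "?f ` ?O \<subseteq> (\<lambda>s. \<Sum>i\<in>s. basis_vec i) ` ?P"
    proof (clarify)
      fix i j assume "i \<in> A" "i \<in> B" "j \<in> A" "j \<in> B" "(i, j) \<notin> ?D"
      moreover from this have "i \<noteq> j" by auto
      ultimately show "basis_vec i + basis_vec j \<in> (\<lambda>s. \<Sum>i\<in>s. basis_vec i :: real ^ 'n) ` ?P"
        by (intro rev_image_eqI[of "{i, j}"]) auto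
    qed
    show "(\<lambda>s. \<Sum>i\<in>s. basis_vec i) ` ?P \<subseteq> ?f ` ?O"
    proof (clarify)
      fix s assume s: "s \<subseteq> ?I" "card s = 2"
      then obtain i j where ij: "s = {i, j}" "i \<noteq> j" by (auto simp: card_2_iff)
      show "(\<Sum>i\<in>s. basis_vec i) \<in> ?f ` ?O"
        using s ij by (intro rev_image_eqI[of "(i, j)"]) auto
    qed
  qed
  moreover have "inj_on (\<lambda>s. \<Sum>i\<in>s. basis_vec i :: real ^ 'n) ?P"
  proof (rule inj_onI)
    fix s t assume "(\<Sum>i\<in>s. basis_vec i) = (\<Sum>i\<in>t. basis_vec i :: real ^ 'n)"
    hence "(\<Sum>i\<in>s. basis_vec i) $ k = (\<Sum>i\<in>t. basis_vec i :: real ^ 'n) $ k" for k by simp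
    hence "(k \<in> s) = (k \<in> t)" for k
      by (simp add: axis_def split: if_splits) (metis zero_neq_one)
    thus "s = t" by blast
  qed
  ultimately have "card (?f ` ?O) = card ?P" by (simp only: card_image)
  also have "\<dots> = card ?I choose 2" by (rule n_subsets) simp
  finally have O: "card (?f ` ?O) = card ?I choose 2" .
  have d1: "?f ` ?X \<inter> ?f ` ?D = {}"
  proof (rule equals0I)
    fix x assume "x \<in> ?f ` ?X \<inter> ?f ` ?D"
    hence X: "x \<in> ?f ` ?X" and D: "x \<in> ?f ` ?D" by blast+
    from X obtain p where p: "x = ?f p" "p \<in> ?X" by (rule imageE)
    from D obtain q where q: "x = ?f q" "q \<in> ?D" by (rule imageE)
    have "q = p \<or> q = (snd p, fst p)" using p(1) q(1) by (intro key) (rule trans[OF HOL.sym])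
    thus False using p(2) q(2) by (cases p; cases q) auto
  qed
  have d2: "(?f ` ?X \<union> ?f ` ?D) \<inter> ?f ` ?O = {}"
  proof (rule equals0I)
    fix x assume "x \<in> (?f ` ?X \<union> ?f ` ?D) \<inter> ?f ` ?O"
    hence X: "x \<in> ?f ` (?X \<union> ?D)" and O: "x \<in> ?f ` ?O" unfolding image_Un by blast+
    from X obtain p where p: "x = ?f p" "p \<in> ?X \<union> ?D" by (rule imageE)
    from O obtain q where q: "x = ?f q" "q \<in> ?O" by (rule imageE)
    have "q = p \<or> q = (snd p, fst p)" using p(1) q(1) by (intro key) (rule trans[OF HOL.sym])
    thus False using p(2) q(2) by (cases p; cases q) auto
  qed
  have "card (pair_sums A B) = card (?f ` ?X) + card (?f ` ?D) + card (?f ` ?O)"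
    unfolding img using d1 d2 by (subst card_Un_disjoint; simp)+
  hence "card (pair_sums A B) + (card ?I choose 2)
      = card A * card B - card ?I * card ?I + (card ?I + 2 * (card ?I choose 2))"
    unfolding X D O by simp
  also have "card ?I + 2 * (card ?I choose 2) = card ?I * card ?I"
    using choose_two_int[of "card ?I"] by (simp add: algebra_simps flip: of_nat_eq_iff[where 'a=int])
  also have "card A * card B - card ?I * card ?I + card ?I * card ?I = card A * card B"
    by (intro le_add_diff_inverse2 mult_le_mono card_mono) auto
  finally show ?thesis .
qed

subsection \<open>Adding a vertex\<close>

definition induced :: "'n set set \<Rightarrow> 'n set \<Rightarrow> 'n set set" where
  "induced F U = {e \<in> F. e \<subseteq> U}"

definition nbs :: "'n set set \<Rightarrow> 'n set \<Rightarrow> 'n \<Rightarrow> 'n set" where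
  "nbs F U a = {b \<in> U. {a, b} \<in> F}"

lemma finite_edge_vectors: "finite (edge_vectors F)"
  by (simp add: edge_vectors_image)

lemma finite_unit_ball: "finite (unit_ball F)"
  by (simp add: unit_ball_def finite_edge_vectors)

lemma finite_double_ball: "finite (double_ball F)"
  by (simp add: double_ball_def finite_unit_ball)

lemma uminus_edge_vectors: "x \<in> edge_vectors F \<Longrightarrow> - x \<in> edge_vectors F"
  by (auto simp: edge_vectors_def) (metis insert_commute)

lemma uminus_unit_ball: "x \<in> unit_ball F \<Longrightarrow> - x \<in> unit_ball F"
  using uminus_edge_vectors by (auto simp: unit_ball_def)

lemma edge_vectorsI: "{i, j} \<in> F \<Longrightarrow> basis_vec i - basis_vec j \<in> edge_vectors F"
  by (auto simp: edge_vectors_def)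

lemma zero_in_unit_ball: "0 \<in> unit_ball F"
  by (simp add: unit_ball_def)

lemma unit_ball_edge: "{i, j} \<in> F \<Longrightarrow> basis_vec i - basis_vec j \<in> unit_ball F"
  by (simp add: unit_ball_def edge_vectorsI)

lemma double_ballI: "x \<in> unit_ball F \<Longrightarrow> y \<in> unit_ball F \<Longrightarrow> x + y \<in> double_ball F"
  by (auto simp: double_ball_def)

text \<open>Cancellation is only possible along a common neighbour.\<close>

lemma difference_in_double_ball_iff:
  assumes "i \<noteq> j"
  shows "basis_vec i - basis_vec j \<in> double_ball F
    \<longleftrightarrow> {i, j} \<in> F \<or> (\<exists>k. {i, k} \<in> F \<and> {k, j} \<in> F)" (is "?x \<in> _ \<longleftrightarrow> _")
proof
  have single: "{i, j} \<in> F" if "?x = basis_vec a - basis_vec b" "{a, b} \<in> F" for a b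
  proof -
    have "basis_vec i + basis_vec b = basis_vec a + (basis_vec j :: real ^ 'a)"
      using that(1) by (simp add: algebra_simps)
    from basis_sum_eqD[OF this] show ?thesis using assms that(2) by auto
  qed
  assume "?x \<in> double_ball F"
  then obtain y z where yz: "y \<in> unit_ball F" "z \<in> unit_ball F" "?x = y + z"
    by (auto simp: double_ball_def)
  have "?x \<noteq> 0" using assms by (simp add: axis_eq_axis)
  consider "y = 0" | "z = 0" | "y \<in> edge_vectors F" "z \<in> edge_vectors F"
    using yz by (auto simp: unit_ball_def)
  thus "{i, j} \<in> F \<or> (\<exists>k. {i, k} \<in> F \<and> {k, j} \<in> F)"
  proof cases
    case 1
    thus ?thesis using yz \<open>?x \<noteq> 0\<close> single by (auto simp: unit_ball_def edge_vectors_def)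
  next
    case 2
    thus ?thesis using yz \<open>?x \<noteq> 0\<close> single by (auto simp: unit_ball_def edge_vectors_def)
  next
    case 3
    then obtain a b c d where ab: "{a, b} \<in> F" "y = basis_vec a - basis_vec b"
      and cd: "{c, d} \<in> F" "z = basis_vec c - basis_vec d"
      by (auto simp: edge_vectors_def)
    have eq: "basis_vec i - basis_vec j
        = basis_vec a - basis_vec b + (basis_vec c - basis_vec d :: real ^ 'a)"
      using yz(3) ab cd by simp
    have "(if i = k then 1 else 0) - (if j = k then 1 else 0)
        = (if a = k then 1 else 0) - (if b = k then 1 else 0)
          + ((if c = k then 1 else 0) - (if d = k then 1 else (0::real)))" for k
      using arg_cong[OF eq, of "\<lambda>x. x $ k"] by (simp add: axis_def eq_commute)
    from this[of i] have "a = i \<or> c = i" using assms by (auto split: if_splits)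
    thus ?thesis
    proof
      assume a: "a = i"
      hence "basis_vec b + basis_vec d = basis_vec c + (basis_vec j :: real ^ 'a)"
        using eq by (simp add: algebra_simps)
      from basis_sum_eqD[OF this] show ?thesis
        using a ab cd by (auto simp: insert_commute)
    next
      assume c: "c = i"
      hence "basis_vec b + basis_vec d = basis_vec a + (basis_vec j :: real ^ 'a)"
        using eq by (simp add: algebra_simps)
      from basis_sum_eqD[OF this] show ?thesis
        using c ab cd by (auto simp: insert_commute)
    qed
  qed
next
  assume "{i, j} \<in> F \<or> (\<exists>k. {i, k} \<in> F \<and> {k, j} \<in> F)"
  thus "?x \<in> double_ball F"
  proof
    assume "{i, j} \<in> F"
    from double_ballI[OF unit_ball_edge[OF this] zero_in_unit_ball] show ?thesis by simp
  next
    assume "\<exists>k. {i, k} \<in> F \<and> {k, j} \<in> F"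
    then obtain k where "{i, k} \<in> F" "{k, j} \<in> F" by blast
    from double_ballI[OF unit_ball_edge[OF this(1)] unit_ball_edge[OF this(2)]] show ?thesis by simp
  qed
qed

text \<open>The new points are sorted by their coordinate at the new vertex \<open>v\<close>. A point with coordinate
  1 that is not a difference of two basis vectors has a second coordinate 1 at a unique vertex \<open>a\<close>,
  and what is subtracted is a sum of a neighbour of \<open>v\<close> and a neighbour of \<open>a\<close>. With coordinate 0
  the new points are the differences of two neighbours of \<open>v\<close> that were not reachable before.\<close>

lemma card_double_ball_insert:
  fixes F :: "'n::finite set set" and U :: "'n set"
  assumes simple: "\<And>e. e \<in> F \<Longrightarrow> card e = 2" and v: "v \<notin> U"
  defines "N \<equiv> nbs F U v"
  defines "W \<equiv> {w \<in> U - N. nbs F U w \<inter> N \<noteq> {}}"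
  defines "Q \<equiv> {(i, j) \<in> N \<times> N. i \<noteq> j \<and> ({i, j} \<in> F \<or> nbs F U i \<inter> nbs F U j \<noteq> {})}"
  shows "card (double_ball (induced F (insert v U)))
    = card (double_ball (induced F U)) + (card N * card N - card N - card Q)
      + 2 * (card N + card W + (\<Sum>a\<in>U. card (pair_sums (N - {a}) (nbs F U a))))
      + 2 * card (pair_sums N N)"
proof -
  let ?G = "induced F U" and ?G' = "induced F (insert v U)"
  define Z where "Z = unit_ball ?G"
  define P where "P = (\<lambda>i. basis_vec v - basis_vec i :: real ^ 'n) ` N"
  have loop: "{a, a} \<notin> F" for a using simple[of "{a, a}"] by auto
  have NU: "N \<subseteq> U" and WU: "W \<subseteq> U" by (auto simp: N_def W_def nbs_def)
  have vN: "v \<notin> N" "v \<notin> W" using NU WU v by auto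
  have Z: "unit_ball ?G' = Z \<union> P \<union> uminus ` P"
  proof
    show "unit_ball ?G' \<subseteq> Z \<union> P \<union> uminus ` P"
    proof
      fix x assume "x \<in> unit_ball ?G'"
      then consider "x = 0" | i j where "{i, j} \<in> F" "i \<in> insert v U" "j \<in> insert v U"
        "x = basis_vec i - basis_vec j"
        by (auto simp: unit_ball_def edge_vectors_def induced_def)
      thus "x \<in> Z \<union> P \<union> uminus ` P"
      proof cases
        case 1
        thus ?thesis by (simp add: Z_def zero_in_unit_ball)
      next
        case (2 i j)
        note ij = 2
        have "i \<noteq> j" using ij loop by auto
        consider "i = v" "j \<in> U" | "j = v" "i \<in> U" | "i \<in> U" "j \<in> U" using ij \<open>i \<noteq> j\<close> by auto
        thus ?thesis
        proof cases
          case 1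
          thus ?thesis using ij by (auto simp: P_def N_def nbs_def)
        next
          case 2
          hence "i \<in> N" using ij by (simp add: N_def nbs_def insert_commute)
          moreover have "x = - (basis_vec v - basis_vec i)" using 2 ij by simp
          ultimately show ?thesis unfolding P_def by blast
        next
          case 3
          hence "x \<in> Z" using ij unfolding Z_def by (simp add: unit_ball_edge induced_def)
          thus ?thesis by simp
        qed
      qed
    qed
    have "Z \<subseteq> unit_ball ?G'"
      by (auto simp: Z_def unit_ball_def edge_vectors_def induced_def)
    moreover have "P \<subseteq> unit_ball ?G'"
      using NU by (auto simp: P_def N_def nbs_def induced_def intro!: unit_ball_edge)
    moreover from this have "uminus ` P \<subseteq> unit_ball ?G'"
      using uminus_unit_ball by blast
    ultimately show "Z \<union> P \<union> uminus ` P \<subseteq> unit_ball ?G'" by blast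
  qed
  have negZ: "- z \<in> Z" if "z \<in> Z" for z using that uminus_unit_ball by (auto simp: Z_def)
  have Zv: "z $ v = 0" if "z \<in> Z" for z
    using that v by (auto simp: Z_def unit_ball_def edge_vectors_def induced_def axis_def)
  have Pv: "p $ v = 1" if "p \<in> P" for p
    using that vN by (auto simp: P_def axis_def)
  define D where "D = (\<lambda>(p, q). p - q) ` (P \<times> P)"
  define A0 where "A0 = double_ball ?G \<union> D"
  define A1 where "A1 = (\<lambda>(z, p). z + p) ` (Z \<times> P)"
  define A2 where "A2 = (\<lambda>(p, q). p + q) ` (P \<times> P)"
  have fin: "finite A0" "finite A1" "finite A2"
    by (simp_all add: A0_def A1_def A2_def D_def Z_def P_def finite_double_ball finite_unit_ball)
  have v0: "x $ v = 0" if "x \<in> A0" for x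
    using that Zv Pv by (fastforce simp: A0_def D_def double_ball_def Z_def)
  have v1: "x $ v = 1" if "x \<in> A1" for x
    using that Zv Pv by (fastforce simp: A1_def)
  have v2: "x $ v = 2" if "x \<in> A2" for x
    using that Pv by (fastforce simp: A2_def)
  have db: "double_ball ?G' = A0 \<union> A1 \<union> uminus ` A1 \<union> A2 \<union> uminus ` A2"
  proof
    show "double_ball ?G' \<subseteq> A0 \<union> A1 \<union> uminus ` A1 \<union> A2 \<union> uminus ` A2"
    proof
      fix x assume "x \<in> double_ball ?G'"
      then obtain y z where yz: "x = y + z" "y \<in> Z \<union> P \<union> uminus ` P" "z \<in> Z \<union> P \<union> uminus ` P"
        unfolding double_ball_def Z by auto
      have ZZ: "y + z \<in> A0" if "y \<in> Z" "z \<in> Z" for y z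
        using that by (simp add: A0_def Z_def double_ballI)
      have ZP: "y + z \<in> A1" "z + y \<in> A1" if "y \<in> Z" "z \<in> P" for y z
        using that unfolding A1_def by (auto simp: image_iff add.commute intro!: bexI[of _ "(y, z)"])
      have ZM: "y + - z \<in> uminus ` A1" "- z + y \<in> uminus ` A1" if "y \<in> Z" "z \<in> P" for y z
        using ZP(1)[OF negZ[OF that(1)] that(2)] by (auto simp: image_iff intro!: bexI[of _ "- y + z"])
      have PP: "y + z \<in> A2" "y + - z \<in> A0" "- z + y \<in> A0" if "y \<in> P" "z \<in> P" for y z
        using that by (auto simp: A2_def A0_def D_def)
      have MM: "- y + - z \<in> uminus ` A2" if "y \<in> P" "z \<in> P" for y z
        using PP(1)[OF that] by (auto simp: image_iff intro!: bexI[of _ "y + z"])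
      show "x \<in> A0 \<union> A1 \<union> uminus ` A1 \<union> A2 \<union> uminus ` A2"
        using yz(2,3) unfolding yz(1)
        by (elim UnE imageE) (simp_all only: Un_iff ZZ ZP ZM PP MM simp_thms)
    qed
    have sub: "A0 \<subseteq> double_ball ?G'" "A1 \<subseteq> double_ball ?G'" "A2 \<subseteq> double_ball ?G'"
    proof -
      have z: "z \<in> unit_ball ?G'" if "z \<in> Z" for z using that Z by blast
      have p: "p \<in> unit_ball ?G'" "- p \<in> unit_ball ?G'" if "p \<in> P" for p using that Z by blast+
      have "D \<subseteq> double_ball ?G'"
        using p double_ballI[of _ ?G' "- _"] by (auto simp: D_def)
      moreover have "double_ball ?G \<subseteq> double_ball ?G'"
        using z by (auto simp: double_ball_def Z_def)
      ultimately show "A0 \<subseteq> double_ball ?G'" by (simp add: A0_def)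
      show "A1 \<subseteq> double_ball ?G'" using z p by (auto simp: A1_def intro!: double_ballI)
      show "A2 \<subseteq> double_ball ?G'" using p by (auto simp: A2_def intro!: double_ballI)
    qed
    have "uminus ` double_ball ?G' \<subseteq> double_ball ?G'"
    proof (clarsimp simp: double_ball_def)
      fix y z assume "y \<in> unit_ball ?G'" "z \<in> unit_ball ?G'"
      thus "- z - y \<in> (\<lambda>(x, y). x + y) ` (unit_ball ?G' \<times> unit_ball ?G')"
        using uminus_unit_ball by (intro rev_image_eqI[of "(- z, - y)"]) auto
    qed
    thus "A0 \<union> A1 \<union> uminus ` A1 \<union> A2 \<union> uminus ` A2 \<subseteq> double_ball ?G'"
      using sub by blast
  qed
  have neg_card: "card (uminus ` A) = card A" for A :: "(real ^ 'n) set"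
    by (intro card_image) simp
  have "card (double_ball ?G') = card A0 + card A1 + card (uminus ` A1) + card A2 + card (uminus ` A2)"
  proof -
    have m1: "x $ v = -1" if "x \<in> uminus ` A1" for x using that v1 by force
    have m2: "x $ v = -2" if "x \<in> uminus ` A2" for x using that v2 by force
    have dis: "A \<inter> B = {}" if "\<And>x. x \<in> A \<Longrightarrow> x $ v = s" "\<And>x. x \<in> B \<Longrightarrow> x $ v = t" "s \<noteq> t"
      for A B :: "(real ^ 'n) set" and s t :: real
    proof (rule equals0I)
      fix x assume "x \<in> A \<inter> B"
      hence "x $ v = s" "x $ v = t" using that(1,2) by blast+
      thus False using that(3) by simp
    qed
    have "A0 \<inter> A1 = {}" "(A0 \<union> A1) \<inter> uminus ` A1 = {}" "(A0 \<union> A1 \<union> uminus ` A1) \<inter> A2 = {}"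
      "(A0 \<union> A1 \<union> uminus ` A1 \<union> A2) \<inter> uminus ` A2 = {}"
      by (simp_all add: Int_Un_distrib2 dis[OF v0 v1] dis[OF v0 m1] dis[OF v1 m1] dis[OF v0 v2]
          dis[OF v1 v2] dis[OF m1 v2] dis[OF v0 m2] dis[OF v1 m2] dis[OF m1 m2] dis[OF v2 m2])
    thus ?thesis unfolding db using fin by (subst card_Un_disjoint; simp)+
  qed
  hence total: "card (double_ball ?G') = card A0 + 2 * card A1 + 2 * card A2"
    by (simp add: neg_card)
  have "A2 = (\<lambda>x. 2 *\<^sub>R basis_vec v - x) ` pair_sums N N"
    unfolding A2_def P_def pair_sums_def by (auto simp: image_iff scaleR_2 algebra_simps) (force simp: algebra_simps)+
  hence A2: "card A2 = card (pair_sums N N)"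
    by (simp add: card_image inj_on_def)
  define B where "B a = (\<lambda>x. basis_vec v + basis_vec a - x) ` pair_sums (N - {a}) (nbs F U a)" for a
  define B0 where "B0 = (\<lambda>w. basis_vec v - basis_vec w :: real ^ 'n) ` (N \<union> W)"
  have B_elem: "\<exists>i b. i \<in> N \<and> i \<noteq> a \<and> b \<in> nbs F U a \<and> x = basis_vec v + basis_vec a - (basis_vec i + basis_vec b)"
    if mem: "x \<in> B a" for x a
  proof -
    have eq: "B a = (\<lambda>p. basis_vec v + basis_vec a - (basis_vec (fst p) + basis_vec (snd p)))
        ` ((N - {a}) \<times> nbs F U a)"
      by (simp add: B_def pair_sums_def image_image split_def)
    obtain p where p: "x = basis_vec v + basis_vec a - (basis_vec (fst p) + basis_vec (snd p))"
      "p \<in> (N - {a}) \<times> nbs F U a"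
      using mem unfolding eq by (rule imageE)
    from p(2) have "fst p \<in> N" "fst p \<noteq> a" "snd p \<in> nbs F U a" by auto
    thus ?thesis using p(1) by blast
  qed
  have A1_eq: "A1 = B0 \<union> (\<Union>a\<in>U. B a)"
  proof
    show "A1 \<subseteq> B0 \<union> (\<Union>a\<in>U. B a)"
    proof
      fix x assume "x \<in> A1"
      then obtain z i where z: "z \<in> Z" "i \<in> N" "x = z + (basis_vec v - basis_vec i)"
        by (auto simp: A1_def P_def)
      consider "z = 0" | a b where "{a, b} \<in> F" "a \<in> U" "b \<in> U" "z = basis_vec a - basis_vec b"
        using z(1) by (auto simp: Z_def unit_ball_def edge_vectors_def induced_def)
      thus "x \<in> B0 \<union> (\<Union>a\<in>U. B a)"
      proof cases
        case 1
        thus ?thesis using z by (simp add: B0_def)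
      next
        case (2 a b)
        show ?thesis
        proof (cases "i = a")
          case True
          hence "b \<in> N \<union> W" using 2 z(2) by (auto simp: W_def nbs_def insert_commute)
          moreover have "x = basis_vec v - basis_vec b" using True 2 z by simp
          ultimately show ?thesis unfolding B0_def by blast
        next
          case False
          hence "basis_vec i + basis_vec b \<in> pair_sums (N - {a}) (nbs F U a)"
            using 2 z(2) by (auto simp: pair_sums_def nbs_def)
          moreover have "x = basis_vec v + basis_vec a - (basis_vec i + basis_vec b)"
            using 2 z by simp
          ultimately have "x \<in> B a" unfolding B_def by blast
          thus ?thesis using 2 by blast
        qed
      qed
    qed
    have A1I: "x \<in> A1" if "z \<in> Z" "i \<in> N" "x = z + (basis_vec v - basis_vec i)" for x z i
      using that unfolding A1_def P_def by (intro rev_image_eqI[of "(z, basis_vec v - basis_vec i)"]) auto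
    have Zedge: "basis_vec a - basis_vec b \<in> Z" if "{a, b} \<in> F" "a \<in> U" "b \<in> U" for a b
      using that unfolding Z_def by (intro unit_ball_edge) (simp add: induced_def)
    show "B0 \<union> (\<Union>a\<in>U. B a) \<subseteq> A1"
    proof
      fix x assume "x \<in> B0 \<union> (\<Union>a\<in>U. B a)"
      then consider w where "w \<in> N \<union> W" "x = basis_vec v - basis_vec w" | a where "a \<in> U" "x \<in> B a"
        unfolding B0_def by blast
      then consider w where "w \<in> N" "x = basis_vec v - basis_vec w"
        | w where "w \<in> W" "x = basis_vec v - basis_vec w"
        | a i b where "a \<in> U" "i \<in> N" "b \<in> nbs F U a" "x = basis_vec v + basis_vec a - (basis_vec i + basis_vec b)"
        using B_elem by cases blast+
      thus "x \<in> A1"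
      proof cases
        case (1 w)
        thus ?thesis using A1I[of 0 w x] by (simp add: Z_def zero_in_unit_ball)
      next
        case (2 w)
        then obtain i where i: "i \<in> N" "i \<in> U" "{i, w} \<in> F" "w \<in> U"
          by (auto simp: W_def nbs_def insert_commute)
        show ?thesis by (rule A1I[OF Zedge[OF i(3,2,4)] i(1)]) (simp add: 2)
      next
        case (3 a i b)
        hence "{a, b} \<in> F" "b \<in> U" by (auto simp: nbs_def)
        thus ?thesis
          by (intro A1I[OF Zedge[OF _ 3(1)] 3(2)]) (simp_all add: 3(4) algebra_simps)
      qed
    qed
  qed
  have Ba: "x $ a = 1" if mem: "x \<in> B a" and "a \<in> U" for x a
  proof -
    obtain i b where "i \<in> N" "i \<noteq> a" "{a, b} \<in> F" "x = basis_vec v + basis_vec a - (basis_vec i + basis_vec b)"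
      using B_elem[OF mem] unfolding nbs_def by blast
    moreover from this have "b \<noteq> a" using loop by auto
    ultimately show ?thesis using that(2) v by (auto simp: axis_def)
  qed
  have Bb: "x $ a \<le> 0" if mem: "x \<in> B b" and "a \<in> U" "a \<noteq> b" for x a b
  proof -
    obtain i c where "x = basis_vec v + basis_vec b - (basis_vec i + basis_vec c)"
      using B_elem[OF mem] by blast
    moreover have "a \<noteq> v" using \<open>a \<in> U\<close> v by blast
    ultimately show ?thesis using \<open>a \<noteq> b\<close> by (simp add: axis_def)
  qed
  have B0a: "x $ a \<le> 0" if "x \<in> B0" "a \<in> U" for x a
    using that v by (auto simp: B0_def axis_def)
  have finB: "finite (B a)" for a by (simp add: B_def pair_sums_def)
  have "B0 \<inter> (\<Union>a\<in>U. B a) = {}"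
    using Ba B0a by (fastforce simp: disjoint_iff)
  moreover have "finite B0" by (simp add: B0_def)
  ultimately have "card A1 = card B0 + card (\<Union>a\<in>U. B a)"
    unfolding A1_eq using finB by (intro card_Un_disjoint) auto
  also have "card (\<Union>a\<in>U. B a) = (\<Sum>a\<in>U. card (B a))"
  proof (rule card_UN_disjoint)
    show "\<forall>a\<in>U. \<forall>b\<in>U. a \<noteq> b \<longrightarrow> B a \<inter> B b = {}"
      using Ba Bb by (fastforce simp: disjoint_iff)
  qed (use finB in auto)
  also have "(\<Sum>a\<in>U. card (B a)) = (\<Sum>a\<in>U. card (pair_sums (N - {a}) (nbs F U a)))"
    by (intro sum.cong refl) (simp add: B_def card_image inj_on_def)
  also have "card B0 = card N + card W"
  proof -
    have "card B0 = card (N \<union> W)"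
      unfolding B0_def by (intro card_image) (simp add: inj_on_def axis_eq_axis)
    also have "\<dots> = card N + card W" by (intro card_Un_disjoint) (auto simp: W_def)
    finally show ?thesis .
  qed
  finally have A1: "card A1 = card N + card W + (\<Sum>a\<in>U. card (pair_sums (N - {a}) (nbs F U a)))" .
  let ?f = "\<lambda>(i, j). basis_vec i - basis_vec j :: real ^ 'n"
  let ?R = "N \<times> N - (\<lambda>i. (i, i)) ` N - Q"
  have iff: "basis_vec i - basis_vec j \<in> double_ball ?G \<longleftrightarrow> (i, j) \<in> Q" if "i \<in> N" "j \<in> N" "i \<noteq> j" for i j
  proof -
    have "(\<exists>k. {i, k} \<in> ?G \<and> {k, j} \<in> ?G) \<longleftrightarrow> nbs F U i \<inter> nbs F U j \<noteq> {}"
      using that NU by (auto simp: nbs_def induced_def insert_commute)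
    moreover have "{i, j} \<in> ?G \<longleftrightarrow> {i, j} \<in> F" using that NU by (auto simp: induced_def)
    ultimately show ?thesis
      unfolding difference_in_double_ball_iff[OF that(3)] using that by (auto simp: Q_def)
  qed
  have DR: "D - double_ball ?G = ?f ` ?R"
  proof -
    have D: "D = ?f ` (N \<times> N)"
    proof -
      have "D = (\<lambda>(i, j). basis_vec j - basis_vec i) ` (N \<times> N)"
      proof -
        have "P \<times> P = (\<lambda>(i, j). (basis_vec v - basis_vec i, basis_vec v - basis_vec j)) ` (N \<times> N)"
          unfolding P_def by auto
        thus ?thesis unfolding D_def by (simp only: image_image) (simp add: split_def)
      qed
      also have "\<dots> = ?f ` (prod.swap ` (N \<times> N))" unfolding image_image by (simp add: split_def)
      also have "\<dots> = ?f ` (N \<times> N)" by (simp only: product_swap)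
      finally show ?thesis .
    qed
    have "0 \<in> double_ball ?G"
      using double_ballI[OF zero_in_unit_ball zero_in_unit_ball, of ?G] by simp
    hence "?f p \<in> double_ball ?G \<longleftrightarrow> p \<notin> ?R" if "p \<in> N \<times> N" for p
      using that iff[of "fst p" "snd p"] by (cases "fst p = snd p") auto
    thus ?thesis unfolding D by auto
  qed
  have "inj_on ?f ?R"
  proof (rule inj_onI, clarify)
    fix i j k l
    assume ij: "i \<in> N" "j \<in> N" "(i, j) \<notin> (\<lambda>i. (i, i)) ` N" and eq: "basis_vec i - basis_vec j = (basis_vec k - basis_vec l :: real ^ 'n)"
    have "i \<noteq> j" using ij by auto
    have "basis_vec i + basis_vec l = basis_vec k + (basis_vec j :: real ^ 'n)"
      using eq by (simp add: algebra_simps)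
    from basis_sum_eqD[OF this] show "i = k \<and> j = l" using \<open>i \<noteq> j\<close> by auto
  qed
  hence "card (D - double_ball ?G) = card ?R" unfolding DR by (rule card_image)
  also have "\<dots> = card (N \<times> N - (\<lambda>i. (i, i)) ` N) - card Q"
    by (rule card_Diff_subset) (auto simp: Q_def)
  also have "card (N \<times> N - (\<lambda>i. (i, i)) ` N) = card (N \<times> N) - card ((\<lambda>i. (i, i)) ` N)"
    by (rule card_Diff_subset) auto
  also have "card ((\<lambda>i. (i, i)) ` N) = card N" by (intro card_image) (simp add: inj_on_def)
  also have "card (N \<times> N) = card N * card N" by (rule card_cartesian_product)
  finally have Dcard: "card (D - double_ball ?G) = card N * card N - card N - card Q" .
  have "A0 = double_ball ?G \<union> (D - double_ball ?G)" by (auto simp: A0_def)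
  moreover have "finite D" by (simp add: D_def P_def)
  ultimately have "card A0 = card (double_ball ?G) + card (D - double_ball ?G)"
    using finite_double_ball[of ?G] by (simp only:) (intro card_Un_disjoint, auto)
  thus ?thesis unfolding total A1 A2 Dcard by (simp add: algebra_simps)
qed

section \<open>Rank and nullity of edge sets\<close>

definition edge_rank :: "'n::finite set set \<Rightarrow> nat" where
  "edge_rank F = dim (edge_vectors F)"

text \<open>The nullity is the dimension of the cycle space.\<close>

definition nullity :: "'n::finite set set \<Rightarrow> int" where
  "nullity F = int (card F) - int (edge_rank F)"

text \<open>Equivalently, \<open>F\<close> connects \<open>a\<close> and \<open>b\<close>.\<close>

definition linked :: "'n::finite set set \<Rightarrow> 'n \<Rightarrow> 'n \<Rightarrow> bool" where
  "linked F a b \<longleftrightarrow> basis_vec a - basis_vec b \<in> span (edge_vectors F)"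

lemma edge_vectors_mono: "F \<subseteq> F' \<Longrightarrow> edge_vectors F \<subseteq> edge_vectors F'"
  by (auto simp: edge_vectors_def)

lemma linked_mono: "linked F a b \<Longrightarrow> F \<subseteq> F' \<Longrightarrow> linked F' a b"
  unfolding linked_def by (meson edge_vectors_mono span_mono subsetD)

lemma linked_refl: "linked F a a"
  by (simp add: linked_def span_zero)

lemma linked_sym: "linked F a b \<Longrightarrow> linked F b a"
  unfolding linked_def by (metis minus_diff_eq span_neg)

lemma linked_trans: "linked F a b \<Longrightarrow> linked F b c \<Longrightarrow> linked F a c"
  unfolding linked_def by (drule (1) span_add) simp

lemma linked_edge: "{a, b} \<in> F \<Longrightarrow> linked F a b"
  unfolding linked_def by (intro span_base edge_vectorsI)

lemma edge_vectors_insert: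
  "edge_vectors (insert {i, j} F)
    = insert (basis_vec i - basis_vec j) (insert (basis_vec j - basis_vec i) (edge_vectors F))"
  by (auto simp: edge_vectors_def doubleton_eq_iff)

lemma edge_rank_insert: "edge_rank (insert {i, j} F) = (if linked F i j then edge_rank F else edge_rank F + 1)"
proof -
  have "basis_vec j - basis_vec i \<in> span (insert (basis_vec i - basis_vec j) (edge_vectors F))"
    using span_neg[OF span_base[of "basis_vec i - basis_vec j" "insert (basis_vec i - basis_vec j) (edge_vectors F)"]]
    by simp
  hence "span (edge_vectors (insert {i, j} F))
      = span (insert (basis_vec i - basis_vec j) (edge_vectors F))"
    unfolding edge_vectors_insert insert_commute[of "basis_vec i - basis_vec j"]
    by (rule span_redundant)
  hence "edge_rank (insert {i, j} F) = dim (insert (basis_vec i - basis_vec j) (edge_vectors F))"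
    unfolding edge_rank_def by (rule span_eq_dim)
  thus ?thesis by (simp add: dim_insert linked_def edge_rank_def)
qed

lemma nullity_insert:
  assumes "{i, j} \<notin> F"
  shows "nullity (insert {i, j} F) = nullity F + of_bool (linked F i j)"
  using assms by (simp add: nullity_def edge_rank_insert)

lemma nullity_remove:
  assumes "{i, j} \<in> F" "linked (F - {{i, j}}) i j"
  shows "nullity F = nullity (F - {{i, j}}) + 1"
  using nullity_insert[of i j "F - {{i, j}}"] assms by (simp add: insert_absorb)

text \<open>Adding the same edges to a larger graph closes at least as many cycles.\<close>

lemma nullity_supermodular:
  assumes "A \<subseteq> A'" "C \<inter> A' = {}" "\<And>e. e \<in> C \<Longrightarrow> card e = 2"
  shows "nullity (A \<union> C) - nullity A \<le> nullity (A' \<union> C) - nullity A'"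
  using finite[of C] assms(2,3)
proof (induction C rule: finite_induct)
  case (insert e C)
  obtain i j where e: "e = {i, j}" using insert.prems(2)[of e] by (auto simp: card_2_iff)
  have "e \<notin> A \<union> C" "e \<notin> A' \<union> C" using insert assms(1) by auto
  hence "nullity (A \<union> insert e C) = nullity (A \<union> C) + of_bool (linked (A \<union> C) i j)"
    "nullity (A' \<union> insert e C) = nullity (A' \<union> C) + of_bool (linked (A' \<union> C) i j)"
    by (simp_all add: e nullity_insert)
  moreover have "linked (A \<union> C) i j \<Longrightarrow> linked (A' \<union> C) i j"
    using assms(1) by (auto intro: linked_mono)
  moreover have "nullity (A \<union> C) - nullity A \<le> nullity (A' \<union> C) - nullity A'"
    using insert by (intro insert.IH) auto
  ultimately show ?case by (cases "linked (A \<union> C) i j") auto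
qed simp

lemma nullity_mono:
  assumes "A \<subseteq> A'" "\<And>e. e \<in> A' \<Longrightarrow> card e = 2"
  shows "nullity A \<le> nullity A'"
proof -
  have "nullity A \<le> nullity (A \<union> C)" if "C \<subseteq> A' - A" for C
    using finite[of C] that
  proof (induction C rule: finite_induct)
    case (insert e C)
    obtain i j where e: "e = {i, j}" using insert.prems assms(2)[of e] by (auto simp: card_2_iff)
    have "e \<notin> A \<union> C" using insert by auto
    hence "nullity (A \<union> insert e C) = nullity (A \<union> C) + of_bool (linked (A \<union> C) i j)"
      by (simp add: e nullity_insert)
    thus ?case using insert by simp
  qed simp
  from this[of "A' - A"] assms(1) show ?thesis by (simp add: Un_absorb1)
qed

lemma nullity_empty: "nullity {} = 0"
  by (simp add: nullity_def edge_rank_def edge_vectors_def)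

lemma nullity_nonneg: "(\<And>e. e \<in> F \<Longrightarrow> card e = 2) \<Longrightarrow> 0 \<le> nullity F"
  using nullity_mono[of "{}" F] by (simp add: nullity_empty)

text \<open>A set of edges with a cycle contains an edge whose ends stay linked without it.\<close>

lemma nonbridge_exists:
  assumes "nullity F > 0" "\<And>e. e \<in> F \<Longrightarrow> card e = 2"
  obtains i j where "{i, j} \<in> F" "linked (F - {{i, j}}) i j"
proof -
  have "\<exists>i j. {i, j} \<in> F \<and> linked (F - {{i, j}}) i j"
    using finite[of F] assms
  proof (induction F rule: finite_induct)
    case empty
    thus ?case by (simp add: nullity_empty)
  next
    case (insert e F)
    obtain i j where e: "e = {i, j}" using insert.prems(2)[of e] by (auto simp: card_2_iff)
    show ?case
    proof (cases "linked F i j")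
      case True
      thus ?thesis using e insert.hyps by (intro exI[of _ i] exI[of _ j]) simp
    next
      case False
      hence "nullity F > 0" using insert.prems(1) insert.hyps e by (simp add: nullity_insert)
      then obtain k l where kl: "{k, l} \<in> F" "linked (F - {{k, l}}) k l"
        using insert.IH insert.prems(2) by blast
      moreover have "F - {{k, l}} \<subseteq> insert e F - {{k, l}}" by blast
      ultimately show ?thesis using linked_mono by blast
    qed
  qed
  thus ?thesis using that by blast
qed

text \<open>The coordinates in \<open>A\<close> show that the vectors from \<open>a\<close> to \<open>p a\<close> are independent.\<close>

lemma edge_rank_ge:
  fixes F :: "'n::finite set set"
  assumes "\<And>a. a \<in> A \<Longrightarrow> p a \<notin> A" "\<And>a. a \<in> A \<Longrightarrow> linked F a (p a)"
  shows "card A \<le> edge_rank F"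
proof -
  let ?f = "\<lambda>a. basis_vec a - basis_vec (p a) :: real ^ 'n"
  have coord: "?f a $ b = of_bool (a = b)" if "a \<in> A" "b \<in> A" for a b
    using assms(1)[OF that(1)] that by (auto simp: axis_def)
  have inj: "inj_on ?f A"
  proof (rule inj_onI)
    fix a b assume "a \<in> A" "b \<in> A" "?f a = ?f b"
    hence "?f a $ a = ?f b $ a" "a \<in> A" "b \<in> A" by simp_all
    thus "a = b" by (simp only: coord) (simp split: if_splits)
  qed
  have "independent (?f ` A)"
  proof (rule independent_if_scalars_zero)
    fix u x assume u: "(\<Sum>x\<in>?f ` A. u x *\<^sub>R x) = 0" and "x \<in> ?f ` A"
    then obtain b where b: "b \<in> A" "x = ?f b" by blast
    have "(\<Sum>a\<in>A. u (?f a) *\<^sub>R ?f a) = 0" using u by (simp add: sum.reindex[OF inj])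
    moreover have "(\<Sum>a\<in>A. u (?f a) *\<^sub>R ?f a) $ b = (\<Sum>a\<in>A. u (?f a) * ?f a $ b)"
      by (simp only: sum_component vector_scaleR_component real_scaleR_def)
    ultimately have "(\<Sum>a\<in>A. u (?f a) * ?f a $ b) = 0" by (simp only: zero_index)
    also have "(\<Sum>a\<in>A. u (?f a) * ?f a $ b) = (\<Sum>a\<in>A. if a = b then u (?f a) else 0)"
      using b by (intro sum.cong refl) (simp only: coord, simp)
    also have "\<dots> = u x" using b by simp
    finally show "u x = 0" .
  qed simp
  moreover have "?f ` A \<subseteq> span (edge_vectors F)" using assms(2) by (auto simp: linked_def)
  ultimately have "card (?f ` A) \<le> dim (span (edge_vectors F))" by (intro independent_card_le_dim)
  thus ?thesis by (simp add: card_image[OF inj] edge_rank_def)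
qed

lemma edge_rank_le:
  fixes F :: "'n::finite set set"
  assumes "\<And>e. e \<in> F \<Longrightarrow> e \<subseteq> X" "x0 \<in> X"
  shows "edge_rank F \<le> card X - 1"
proof -
  let ?B = "(\<lambda>y. basis_vec y - basis_vec x0 :: real ^ 'n) ` (X - {x0})"
  have B: "basis_vec y - basis_vec x0 \<in> span ?B" if "y \<in> X" for y
    using that by (cases "y = x0") (auto simp: span_zero intro: span_base)
  have "edge_vectors F \<subseteq> span ?B"
  proof (clarsimp simp: edge_vectors_def)
    fix i j assume "{i, j} \<in> F"
    hence "i \<in> X" "j \<in> X" using assms(1) by blast+
    from span_diff[OF B[OF this(1)] B[OF this(2)]]
    show "basis_vec i - basis_vec j \<in> span ?B" by simp
  qed
  hence "edge_rank F \<le> card ?B" unfolding edge_rank_def by (intro dim_le_card) auto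
  also have "\<dots> \<le> card (X - {x0})" by (rule card_image_le) simp
  finally show ?thesis using assms(2) by simp
qed

text \<open>Vertices of \<open>W\<close> and vertices of \<open>N\<close> that are not the representative of their component each
  contribute 1 to the rank. If \<open>q\<close> vertices of \<open>N\<close> are not representatives, then at most \<open>q (q - 1)\<close>
  ordered pairs of linked vertices avoid the representatives, and at most \<open>2 q\<close> contain one.\<close>

lemma linked_bounds:
  assumes NW: "N \<inter> W = {}" and W: "\<And>w. w \<in> W \<Longrightarrow> \<exists>x\<in>N. linked F x w"
  shows "card {(x, y) \<in> N \<times> N. x \<noteq> y \<and> linked F x y} \<le> (edge_rank F - card W) * (edge_rank F - card W + 1)"
    and "\<lbrakk>Y \<subseteq> N; \<And>x y. x \<in> Y \<Longrightarrow> y \<in> Y \<Longrightarrow> linked F x y\<rbrakk> \<Longrightarrow> card Y \<le> edge_rank F - card W + 1"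
    and "card W \<le> edge_rank F"
proof -
  define rep where "rep x = (SOME y. y \<in> N \<and> linked F x y)" for x
  have rep: "rep x \<in> N" "linked F x (rep x)" if "\<exists>y\<in>N. linked F x y" for x
  proof -
    have "rep x \<in> N \<and> linked F x (rep x)"
      unfolding rep_def by (rule someI_ex) (use that in blast)
    thus "rep x \<in> N" "linked F x (rep x)" by blast+
  qed
  have rep_eq: "rep x = rep y" if "linked F x y" for x y
  proof -
    have "(\<lambda>z. z \<in> N \<and> linked F x z) = (\<lambda>z. z \<in> N \<and> linked F y z)"
      using that by (auto intro: linked_trans linked_sym)
    thus ?thesis by (simp add: rep_def)
  qed
  define Q where "Q = {x \<in> N. rep x \<noteq> x}"
  have rep_idem: "rep (rep x) = rep x" if "\<exists>y\<in>N. linked F x y" for x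
    using rep_eq[OF rep(2)[OF that]] by simp
  have W': "\<exists>y\<in>N. linked F w y" if "w \<in> W" for w using W[OF that] linked_sym by blast
  have "card (W \<union> Q) \<le> edge_rank F"
  proof (rule edge_rank_ge[where p = rep])
    fix a assume "a \<in> W \<union> Q"
    hence ex: "\<exists>y\<in>N. linked F a y" using W' linked_refl by (auto simp: Q_def)
    show "rep a \<notin> W \<union> Q" using rep(1)[OF ex] rep_idem[OF ex] NW by (auto simp: Q_def)
    show "linked F a (rep a)" by (rule rep(2)[OF ex])
  qed
  moreover have "card (W \<union> Q) = card W + card Q"
    using NW by (intro card_Un_disjoint) (auto simp: Q_def)
  ultimately have WQ: "card W + card Q \<le> edge_rank F" by simp
  thus "card W \<le> edge_rank F" by simp
  let ?L = "{(x, y) \<in> N \<times> N. x \<noteq> y \<and> linked F x y}"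
  have "?L \<subseteq> (Q \<times> Q - (\<lambda>x. (x, x)) ` Q) \<union> ((\<lambda>x. (x, rep x)) ` Q \<union> (\<lambda>x. (rep x, x)) ` Q)"
  proof (rule subsetI)
    fix p assume "p \<in> ?L"
    then obtain x y where xy: "p = (x, y)" "x \<in> N" "y \<in> N" "x \<noteq> y" "linked F x y" by blast
    have eq: "rep x = rep y" by (rule rep_eq) fact
    have "x \<in> Q \<or> rep x = x" "y \<in> Q \<or> rep y = y" using xy(2,3) unfolding Q_def by blast+
    hence "(x \<in> Q \<and> y \<in> Q) \<or> (x \<in> Q \<and> y = rep x) \<or> (y \<in> Q \<and> x = rep y)"
      using eq xy(4) by argo
    thus "p \<in> (Q \<times> Q - (\<lambda>x. (x, x)) ` Q) \<union> ((\<lambda>x. (x, rep x)) ` Q \<union> (\<lambda>x. (rep x, x)) ` Q)"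
      unfolding xy(1) using xy(4) by blast
  qed
  hence "card ?L \<le> card ((Q \<times> Q - (\<lambda>x. (x, x)) ` Q) \<union> ((\<lambda>x. (x, rep x)) ` Q \<union> (\<lambda>x. (rep x, x)) ` Q))"
    by (intro card_mono) auto
  also have "\<dots> \<le> card (Q \<times> Q - (\<lambda>x. (x, x)) ` Q) + (card ((\<lambda>x. (x, rep x)) ` Q) + card ((\<lambda>x. (rep x, x)) ` Q))"
    by (intro order_trans[OF card_Un_le] add_mono card_Un_le order_refl)
  also have "card (Q \<times> Q - (\<lambda>x. (x, x)) ` Q) = card Q * card Q - card Q"
  proof -
    have "card (Q \<times> Q - (\<lambda>x. (x, x)) ` Q) = card (Q \<times> Q) - card ((\<lambda>x. (x, x)) ` Q)"
      by (rule card_Diff_subset) auto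
    moreover have "card ((\<lambda>x. (x, x)) ` Q) = card Q" by (intro card_image) (simp add: inj_on_def)
    ultimately show ?thesis by (simp add: card_cartesian_product)
  qed
  also have "card Q * card Q - card Q + (card ((\<lambda>x. (x, rep x)) ` Q) + card ((\<lambda>x. (rep x, x)) ` Q))
      \<le> card Q * card Q - card Q + (card Q + card Q)"
    by (intro add_mono card_image_le order_refl) auto
  also have "\<dots> = card Q * (card Q + 1)"
    by (cases "card Q") auto
  also have "\<dots> \<le> (edge_rank F - card W) * (edge_rank F - card W + 1)"
    using WQ by (intro mult_le_mono) auto
  finally show "card ?L \<le> (edge_rank F - card W) * (edge_rank F - card W + 1)" .
  assume Y: "Y \<subseteq> N" "\<And>x y. x \<in> Y \<Longrightarrow> y \<in> Y \<Longrightarrow> linked F x y"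
  have "card (Y - Q) \<le> 1"
  proof -
    have "x = y" if "x \<in> Y - Q" "y \<in> Y - Q" for x y
      using rep_eq[OF Y(2)[of x y]] that Y(1) by (auto simp: Q_def)
    thus ?thesis by (simp only: One_nat_def card_le_Suc0_iff_eq[OF finite]) blast
  qed
  moreover have "card Y \<le> card Q + card (Y - Q)"
    using card_mono[of "Q \<union> (Y - Q)" Y] card_Un_le[of Q "Y - Q"] by auto
  ultimately show "card Y \<le> edge_rank F - card W + 1" using WQ by linarith
qed

section \<open>The local inequality\<close>

abbreviation choose2_int :: "nat \<Rightarrow> int" where
  "choose2_int n \<equiv> int (n choose 2)"

lemma choose2_Suc: "choose2_int (Suc n) = choose2_int n + int n"
  by (simp add: numeral_2_eq_2)

text \<open>The common neighbours of \<open>z\<close> and a vertex that is adjacent to exactly the vertices in \<open>N\<close>.\<close>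

definition link :: "'n set set \<Rightarrow> 'n set \<Rightarrow> 'n \<Rightarrow> 'n set" where
  "link F N z = {x \<in> N. {x, z} \<in> F}"

lemma card_pairs_distinct: "finite A \<Longrightarrow> int (card {(x, y) \<in> A \<times> A. x \<noteq> y}) = int (card A) * (int (card A) - 1)"
proof -
  assume A: "finite A"
  have "{(x, y) \<in> A \<times> A. x \<noteq> y} = A \<times> A - (\<lambda>x. (x, x)) ` A" by auto
  moreover have "card (A \<times> A - (\<lambda>x. (x, x)) ` A) = card (A \<times> A) - card ((\<lambda>x. (x, x)) ` A)"
    using A by (intro card_Diff_subset) auto
  moreover have "card ((\<lambda>x. (x, x)) ` A) = card A" by (intro card_image) (simp add: inj_on_def)
  ultimately have "card {(x, y) \<in> A \<times> A. x \<noteq> y} = card A * card A - card A"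
    by (simp add: card_cartesian_product)
  thus ?thesis by (simp add: algebra_simps)
qed

text \<open>Two vertices of a forest have at most one common neighbour, and none if they are adjacent.\<close>

lemma forest_common_neighbour:
  assumes simple: "\<And>e. e \<in> F \<Longrightarrow> card e = 2" and forest: "nullity F = 0" and "x \<noteq> y"
  shows "{x, z} \<in> F \<Longrightarrow> {y, z} \<in> F \<Longrightarrow> {x, z'} \<in> F \<Longrightarrow> {y, z'} \<in> F \<Longrightarrow> z = z'"
    and "{x, z} \<in> F \<Longrightarrow> {y, z} \<in> F \<Longrightarrow> {x, y} \<notin> F"
proof -
  have loop: "a \<noteq> b" if "{a, b} \<in> F" for a b using simple[OF that] by auto
  have no: "\<not> linked (F - {{a, b}}) a b" if "{a, b} \<in> F" for a b
  proof
    assume "linked (F - {{a, b}}) a b"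
    from nullity_remove[OF that this] nullity_nonneg[of "F - {{a, b}}"] forest simple
    show False by auto
  qed
  {
    assume e: "{x, z} \<in> F" "{y, z} \<in> F" "{x, z'} \<in> F" "{y, z'} \<in> F"
    show "z = z'"
    proof (rule ccontr)
      assume "z \<noteq> z'"
      let ?F = "F - {{x, z'}}"
      have "linked ?F x z" "linked ?F y z" "linked ?F y z'"
        using e loop[OF e(1)] loop[OF e(3)] \<open>z \<noteq> z'\<close> \<open>x \<noteq> y\<close>
        by (auto intro!: linked_edge simp: doubleton_eq_iff)
      hence "linked ?F x z'" by (meson linked_sym linked_trans)
      thus False using no[OF e(3)] by blast
    qed
  }
  assume e: "{x, z} \<in> F" "{y, z} \<in> F"
  show "{x, y} \<notin> F"
  proof
    assume xy: "{x, y} \<in> F"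
    let ?F = "F - {{x, y}}"
    have "linked ?F x z" "linked ?F y z"
      using e loop[OF e(1)] loop[OF e(2)] \<open>x \<noteq> y\<close> by (auto intro!: linked_edge simp: doubleton_eq_iff)
    hence "linked ?F x y" by (meson linked_sym linked_trans)
    thus False using no[OF xy] by blast
  qed
qed

text \<open>Every edge gives two ordered pairs.\<close>

lemma handshake_pairs:
  fixes F :: "'n::finite set set"
  assumes simple: "\<And>e. e \<in> F \<Longrightarrow> card e = 2"
  shows "int (card {(x, y) \<in> N \<times> N. {x, y} \<in> F}) = 2 * int (card {e \<in> F. e \<subseteq> N})"
proof -
  let ?P = "{(x, y) \<in> N \<times> N. {x, y} \<in> F}"
  have "card ?P = (\<Sum>e\<in>{e \<in> F. e \<subseteq> N}. card {p \<in> ?P. (\<lambda>(x, y). {x, y}) p = e})"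
    by (subst card_eq_sum, subst sum.group[symmetric, of _ "{e \<in> F. e \<subseteq> N}" "\<lambda>(x, y). {x, y}"]) auto
  also have "\<dots> = (\<Sum>e\<in>{e \<in> F. e \<subseteq> N}. 2)"
  proof (intro sum.cong refl)
    fix e assume e: "e \<in> {e \<in> F. e \<subseteq> N}"
    then obtain a b where ab: "e = {a, b}" "a \<noteq> b" using simple[of e] by (auto simp: card_2_iff)
    have "{p \<in> ?P. (\<lambda>(x, y). {x, y}) p = e} = {(a, b), (b, a)}"
      using e ab by (auto simp: doubleton_eq_iff insert_commute)
    thus "card {p \<in> ?P. (\<lambda>(x, y). {x, y}) p = e} = 2" using ab by simp
  qed
  finally show ?thesis by simp
qed

text \<open>Edges between vertices of \<open>N\<close> or between \<open>N\<close> and \<open>W\<close>; \<open>s\<close> counts the vertices of \<open>N\<close> minus the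
  components. For a forest both sides are compared through the pairs of linked vertices in \<open>N\<close>:
  every edge inside \<open>N\<close> and every pair in a link accounts for a different one. An edge on a cycle
  changes the left side by at most \<open>4 s\<close>, which is what the right side changes by.\<close>

lemma local_inequality:
  fixes F :: "'n::finite set set"
  assumes simple: "\<And>e. e \<in> F \<Longrightarrow> card e = 2" and NW: "N \<inter> W = {}"
    and F: "\<And>e. e \<in> F \<Longrightarrow> e \<subseteq> N \<union> W \<and> e \<inter> N \<noteq> {}"
    and W: "\<And>w. w \<in> W \<Longrightarrow> link F N w \<noteq> {}"
  defines "s \<equiv> int (edge_rank F) - int (card W)" and "M \<equiv> int (card F) - int (card W)"
  shows "2 * int (card {e \<in> F. e \<subseteq> N}) + 2 * M + 2 * (\<Sum>z\<in>N \<union> W. choose2_int (card (link F N z)))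
      + s * (s + 1) \<le> 2 * s * (2 * M - s + 2)"
  unfolding s_def M_def
  using assms(1-4)
proof (induction "card F" arbitrary: F rule: less_induct)
  case less
  note simple = less.prems(1) and F = less.prems(3)
  have Wl: "\<exists>x\<in>N. linked F x w" if "w \<in> W" for w
    using less.prems(4)[OF that] linked_edge by (force simp: link_def)
  note bounds = linked_bounds[OF NW Wl]
  define s where "s = int (edge_rank F) - int (card W)"
  define M where "M = int (card F) - int (card W)"
  define S where "S F = (\<Sum>z\<in>N \<union> W. choose2_int (card (link F N z)))" for F
  define eN where "eN F = int (card {e \<in> F. e \<subseteq> N})" for F
  have s_nat: "s = int (edge_rank F - card W)" using bounds(3) by (simp add: s_def)
  have loop: "a \<noteq> b" if "{a, b} \<in> F" for a b using simple[OF that] by auto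
  have link_bound: "int (card Y) \<le> s + 1" if "Y \<subseteq> N" "\<And>x. x \<in> Y \<Longrightarrow> linked F x z" for Y z
  proof -
    have "linked F x y" if "x \<in> Y" "y \<in> Y" for x y
      using \<open>\<And>x. x \<in> Y \<Longrightarrow> linked F x z\<close> that by (meson linked_sym linked_trans)
    hence "card Y \<le> edge_rank F - card W + 1" using that(1) by (intro bounds(2))
    thus ?thesis by (simp add: s_nat)
  qed
  have "2 * eN F + 2 * M + 2 * S F + s * (s + 1) \<le> 2 * s * (2 * M - s + 2)"
  proof (cases "nullity F = 0")
    case True
    let ?L = "{(x, y) \<in> N \<times> N. x \<noteq> y \<and> linked F x y}"
    let ?A = "{(x, y) \<in> N \<times> N. {x, y} \<in> F}"
    let ?B = "\<lambda>z. {(x, y) \<in> link F N z \<times> link F N z. x \<noteq> y}"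
    have B: "int (card (?B z)) = 2 * choose2_int (card (link F N z))" for z
      unfolding choose_two_int by (rule card_pairs_distinct) simp
    have "card (\<Union>z\<in>N \<union> W. ?B z) = (\<Sum>z\<in>N \<union> W. card (?B z))"
    proof (rule card_UN_disjoint)
      show "\<forall>z\<in>N \<union> W. \<forall>z'\<in>N \<union> W. z \<noteq> z' \<longrightarrow> ?B z \<inter> ?B z' = {}"
      proof (intro ballI impI equals0I)
        fix z z' p assume "z \<noteq> z'" "p \<in> ?B z \<inter> ?B z'"
        thus False
          using forest_common_neighbour(1)[of F "fst p" "snd p" z z', OF simple True]
          by (auto simp: link_def)
      qed
    qed auto
    hence cU: "int (card (\<Union>z\<in>N \<union> W. ?B z)) = 2 * S F"
      by (simp only: of_nat_sum B S_def sum_distrib_left)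
    have "?A \<inter> (\<Union>z\<in>N \<union> W. ?B z) = {}"
    proof (rule equals0I)
      fix p assume "p \<in> ?A \<inter> (\<Union>z\<in>N \<union> W. ?B z)"
      thus False
        using forest_common_neighbour(2)[of F "fst p" "snd p", OF simple True]
        by (auto simp: link_def)
    qed
    hence "card (?A \<union> (\<Union>z\<in>N \<union> W. ?B z)) = card ?A + card (\<Union>z\<in>N \<union> W. ?B z)"
      by (intro card_Un_disjoint) auto
    hence "int (card (?A \<union> (\<Union>z\<in>N \<union> W. ?B z))) = 2 * eN F + 2 * S F"
      using cU handshake_pairs[of F N, OF simple] by (simp add: eN_def)
    moreover have "?A \<union> (\<Union>z\<in>N \<union> W. ?B z) \<subseteq> ?L"
    proof -
      have "?A \<subseteq> ?L" using linked_edge loop by blast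
      moreover have "?B z \<subseteq> ?L" for z
        using linked_edge[of _ z F] by (auto simp: link_def intro: linked_trans linked_sym)
      ultimately show ?thesis by blast
    qed
    hence "card (?A \<union> (\<Union>z\<in>N \<union> W. ?B z)) \<le> card ?L" by (intro card_mono) auto
    moreover have "int (card ?L) \<le> s * (s + 1)"
    proof -
      have "int (card ?L) \<le> int ((edge_rank F - card W) * (edge_rank F - card W + 1))"
        using bounds(1) by (simp only: of_nat_le_iff)
      also have "\<dots> = s * (s + 1)" by (simp only: s_nat of_nat_mult of_nat_add of_nat_1)
      finally show ?thesis .
    qed
    ultimately have "2 * eN F + 2 * S F \<le> s * (s + 1)" by linarith
    moreover have "M = s" using True by (simp add: M_def s_def nullity_def)
    ultimately show ?thesis by (simp add: algebra_simps)
  next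
    case False
    hence "nullity F > 0" using nullity_nonneg[OF simple] by force
    then obtain i j where ij: "{i, j} \<in> F" "linked (F - {{i, j}}) i j"
      using nonbridge_exists[of F] simple by metis
    define F' where "F' = F - {{i, j}}"
    have F_eq: "F = insert {i, j} F'" "{i, j} \<notin> F'" using ij by (auto simp: F'_def)
    have "linked F' i j" using ij(2) by (simp add: F'_def)
    hence rank': "edge_rank F' = edge_rank F" using edge_rank_insert[of i j F'] F_eq(1) by simp
    have card': "int (card F) = int (card F') + 1" using F_eq by simp
    have symcase: "2 * eN F + 2 * M + 2 * S F + s * (s + 1) \<le> 2 * s * (2 * M - s + 2)"
      if x: "{i, j} = {x, y}" "x \<in> N" "y \<in> N \<union> W" "linked F' x y" for x y
    proof -
      have xy: "{x, y} \<in> F" "x \<noteq> y" using ij x loop by auto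
      have Fxy: "F = insert {x, y} F'" "{x, y} \<notin> F'" "{y, x} \<notin> F'"
        using F_eq unfolding x(1) by (simp_all add: insert_commute)
      have IH: "2 * eN F' + 2 * (M - 1) + 2 * S F' + s * (s + 1) \<le> 2 * s * (2 * (M - 1) - s + 2)"
        if "\<And>w. w \<in> W \<Longrightarrow> link F' N w \<noteq> {}"
      proof -
        have "2 * eN F' + 2 * (int (card F') - int (card W)) + 2 * S F'
            + (int (edge_rank F') - int (card W)) * ((int (edge_rank F') - int (card W)) + 1)
            \<le> 2 * (int (edge_rank F') - int (card W)) * (2 * (int (card F') - int (card W)) - (int (edge_rank F') - int (card W)) + 2)"
          unfolding eN_def S_def
          by (rule less.hyps) (use that card' simple F NW in \<open>auto simp: F'_def\<close>)
        thus ?thesis unfolding rank' s_def M_def card' by simp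
      qed
      have link_y: "link F N y = insert x (link F' N y)" "x \<notin> link F' N y"
        using x(2,3) xy(2) Fxy by (auto simp: link_def doubleton_eq_iff)
      have link_other: "link F N z = link F' N z" if "z \<noteq> x" "z \<noteq> y" for z
        using x(2,3) xy(2) Fxy that by (auto simp: link_def doubleton_eq_iff)
      have c: "int (card (link F N y)) = int (card (link F' N y)) + 1"
        using link_y by simp
      have ch: "choose2_int (card (link F N y)) = choose2_int (card (link F' N y)) + int (card (link F' N y))"
        using link_y by (simp add: choose2_Suc)
      show ?thesis
      proof (cases "y \<in> W")
        case True
        hence yN: "y \<notin> N" using NW by blast
        have link_x: "link F N x = link F' N x"
          using x(2,3) xy(2) Fxy yN by (auto simp: link_def doubleton_eq_iff)
        have ne: "link F' N y \<noteq> {}"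
        proof
          assume empty: "link F' N y = {}"
          have "v $ y = 0" if v: "v \<in> edge_vectors F'" for v
          proof -
            obtain a b where ab: "{a, b} \<in> F'" "v = basis_vec a - basis_vec b"
              using v unfolding edge_vectors_def by blast
            have "{a, b} \<in> F" using ab F_eq by blast
            hence "{a, b} \<inter> N \<noteq> {}" using F by blast
            hence "a \<noteq> y \<and> b \<noteq> y"
              using empty ab(1) yN by (auto simp: link_def insert_commute)
            thus ?thesis using ab(2) by (auto simp: axis_def)
          qed
          hence "edge_vectors F' \<subseteq> {v. v $ y = 0}" by blast
          moreover have "subspace {v :: real ^ 'n. v $ y = 0}" by (simp add: subspace_def)
          ultimately have "span (edge_vectors F') \<subseteq> {v. v $ y = 0}" by (rule span_minimal)
          hence "(basis_vec x - basis_vec y :: real ^ 'n) $ y = 0"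
            using x(4) by (auto simp: linked_def)
          thus False using xy(2) by (simp add: axis_def)
        qed
        have "link F' N w \<noteq> {}" if "w \<in> W" for w
          using ne less.prems(4)[OF that] link_other[of w] link_x that by (cases "w = x"; cases "w = y") auto
        note IH' = IH[OF this]
        have "S F = choose2_int (card (link F N y)) + (\<Sum>z\<in>N \<union> W - {y}. choose2_int (card (link F N z)))"
          unfolding S_def using x(3) by (intro sum.remove) auto
        moreover have "S F' = choose2_int (card (link F' N y)) + (\<Sum>z\<in>N \<union> W - {y}. choose2_int (card (link F' N z)))"
          unfolding S_def using x(3) by (intro sum.remove) auto
        moreover have "(\<Sum>z\<in>N \<union> W - {y}. choose2_int (card (link F N z)))
            = (\<Sum>z\<in>N \<union> W - {y}. choose2_int (card (link F' N z)))"
          using link_other link_x by (intro sum.cong refl) (metis DiffD2 singletonI)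
        ultimately have SF: "S F = S F' + int (card (link F' N y))" using ch by linarith
        have "{e \<in> F. e \<subseteq> N} = {e \<in> F'. e \<subseteq> N}" using Fxy x(2,3) yN by auto
        hence eF: "eN F = eN F'" by (simp add: eN_def)
        have "int (card (link F N y)) \<le> s + 1"
          by (rule link_bound[of _ y]) (auto simp: link_def intro: linked_edge)
        hence "int (card (link F' N y)) \<le> s" using c by linarith
        moreover have "card (link F' N y) > 0" using ne by (simp add: card_gt_0_iff)
        hence "int (card (link F' N y)) \<ge> 1" by simp
        ultimately show ?thesis using IH' SF eF by (simp add: algebra_simps)
      next
        case False
        hence yN: "y \<in> N" using x(3) by blast
        have link_x: "link F N x = insert y (link F' N x)" "y \<notin> link F' N x"
          using x(2,3) xy(2) Fxy yN by (auto simp: link_def doubleton_eq_iff)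
        have "link F' N w \<noteq> {}" if "w \<in> W" for w
          using less.prems(4)[OF that] link_other[of w] that x(2) NW False by (metis IntI empty_iff)
        note IH' = IH[OF this]
        have chx: "choose2_int (card (link F N x)) = choose2_int (card (link F' N x)) + int (card (link F' N x))"
          using link_x by (simp add: choose2_Suc)
        have split: "S G = choose2_int (card (link G N x)) + (choose2_int (card (link G N y))
            + (\<Sum>z\<in>N \<union> W - {x} - {y}. choose2_int (card (link G N z))))" for G
        proof -
          have "S G = choose2_int (card (link G N x)) + (\<Sum>z\<in>N \<union> W - {x}. choose2_int (card (link G N z)))"
            unfolding S_def using x(2) by (intro sum.remove) auto
          also have "(\<Sum>z\<in>N \<union> W - {x}. choose2_int (card (link G N z)))
              = choose2_int (card (link G N y)) + (\<Sum>z\<in>N \<union> W - {x} - {y}. choose2_int (card (link G N z)))"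
            using yN xy(2) by (intro sum.remove) auto
          finally show ?thesis .
        qed
        have "(\<Sum>z\<in>N \<union> W - {x} - {y}. choose2_int (card (link F N z)))
            = (\<Sum>z\<in>N \<union> W - {x} - {y}. choose2_int (card (link F' N z)))"
          using link_other by (intro sum.cong refl) (metis DiffD2 DiffD1 singletonI)
        hence SF: "S F = S F' + int (card (link F' N x)) + int (card (link F' N y))"
          using split[of F] split[of F'] ch chx by linarith
        have "{e \<in> F. e \<subseteq> N} = insert {x, y} {e \<in> F'. e \<subseteq> N}" using Fxy x(2,3) yN by auto
        hence eF: "eN F = eN F' + 1" using Fxy by (simp add: eN_def)
        have "int (card (insert y (link F N y))) \<le> s + 1"
          using yN by (intro link_bound[of _ y]) (auto simp: link_def intro: linked_edge linked_refl)
        moreover have "y \<notin> link F N y" using loop[of y y] by (auto simp: link_def)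
        ultimately have bdy: "int (card (link F' N y)) + 1 \<le> s" using c by simp
        have "int (card (insert x (link F N x))) \<le> s + 1"
          using x(2) by (intro link_bound[of _ x]) (auto simp: link_def intro: linked_edge linked_refl)
        moreover have "x \<notin> link F N x" using loop[of x x] by (auto simp: link_def)
        moreover have "int (card (link F N x)) = int (card (link F' N x)) + 1"
          using link_x by simp
        ultimately have bx: "int (card (link F' N x)) + 1 \<le> s" by simp
        show ?thesis using IH' SF eF bdy bx by (simp add: algebra_simps)
      qed
    qed
    have "{i, j} \<subseteq> N \<union> W" "{i, j} \<inter> N \<noteq> {}" using F[OF ij(1)] by blast+
    then consider "i \<in> N" "j \<in> N \<union> W" | "j \<in> N" "i \<in> N \<union> W" by blast
    thus ?thesis
    proof cases
      case 1
      show ?thesis by (rule symcase[of i j]) (use 1 ij in \<open>auto simp: F'_def\<close>)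
    next
      case 2
      show ?thesis
        by (rule symcase[of j i]) (use 2 ij linked_sym in \<open>auto simp: F'_def\<close>)
    qed
  qed
  thus ?case unfolding s_def M_def eN_def S_def .
qed

section \<open>Deleting a vertex\<close>

text \<open>The defect is the number of coincidences among the sums of two edge vectors: if there were
  none, then \<open>double_ball F\<close> would have \<open>2 E\<^sup>2 + 2 E + 1\<close> elements for \<open>E\<close> edges.\<close>

definition defect :: "'n::finite set set \<Rightarrow> int" where
  "defect F = 2 * (int (card F))\<^sup>2 + 2 * int (card F) + 1 - int (card (double_ball F))"

text \<open>If the dimension is at least 4, this is the coefficient \<open>\<gamma>\<^sub>2\<close>.\<close>

definition gap :: "'n::finite set set \<Rightarrow> int" where
  "gap F = 2 * nullity F * (nullity F + 2) - defect F"

locale vertex_deletion =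
  fixes F :: "'n::finite set set" and U :: "'n set" and v :: 'n
  assumes simple: "\<And>e. e \<in> F \<Longrightarrow> card e = 2" and v: "v \<notin> U"
begin

text \<open>The neighbours of \<open>v\<close> and the vertices at distance two.\<close>

definition N where "N = nbs F U v"
definition W where "W = {w \<in> U - N. nbs F U w \<inter> N \<noteq> {}}"

text \<open>The pairs whose basis vectors already have a difference of length at most two without \<open>v\<close>.\<close>

definition Q where "Q = {(i, j) \<in> N \<times> N. i \<noteq> j \<and> ({i, j} \<in> F \<or> nbs F U i \<inter> nbs F U j \<noteq> {})}"

text \<open>Together with \<open>v\<close>, the pairs of common neighbours of \<open>v\<close> and \<open>a\<close> give the cycles of length four
  through \<open>v\<close> and \<open>a\<close>.\<close>

definition d where "d a = card (nbs F U a \<inter> N)"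
definition eN where "eN = card {e \<in> F. e \<subseteq> N}"

text \<open>\<open>M\<close> is the nullity of \<open>H\<close> together with the edges at \<open>v\<close>, and \<open>s\<close> is the number of independent
  cycles that the edges at \<open>v\<close> add to those of \<open>H\<close>.\<close>

definition H where "H = {e \<in> induced F U. e \<inter> N \<noteq> {}}"
definition s where "s = int (edge_rank H) - int (card W)"
definition M where "M = int eN + (\<Sum>w\<in>W. int (d w) - 1)"

abbreviation "before \<equiv> induced F U"
abbreviation "after \<equiv> induced F (insert v U)"

lemma loop: "{a, a} \<notin> F"
  using simple[of "{a, a}"] by auto

lemma NU: "N \<subseteq> U" and WU: "W \<subseteq> U" and NW: "N \<inter> W = {}"
  by (auto simp: N_def W_def nbs_def)

lemma after_eq: "after = before \<union> (\<lambda>i. {v, i}) ` N"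
proof
  show "after \<subseteq> before \<union> (\<lambda>i. {v, i}) ` N"
  proof
    fix e assume e: "e \<in> after"
    then obtain a b where ab: "e = {a, b}" "a \<noteq> b" "e \<in> F" "e \<subseteq> insert v U"
      using simple[of e] by (auto simp: induced_def card_2_iff)
    show "e \<in> before \<union> (\<lambda>i. {v, i}) ` N"
    proof (cases "v \<in> e")
      case True
      then obtain i where "e = {v, i}" "i \<noteq> v" using ab by auto
      thus ?thesis using ab by (auto simp: N_def nbs_def)
    next
      case False
      thus ?thesis using ab by (auto simp: induced_def)
    qed
  qed
  show "before \<union> (\<lambda>i. {v, i}) ` N \<subseteq> after"
    by (auto simp: induced_def N_def nbs_def)
qed

lemma star_disjoint: "(\<lambda>i. {v, i}) ` N \<inter> before = {}"
  using v by (auto simp: induced_def)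

lemma card_star: "card ((\<lambda>i. {v, i}) ` N) = card N"
  by (intro card_image) (auto simp: inj_on_def doubleton_eq_iff)

lemma card_after: "card after = card before + card N"
  unfolding after_eq using star_disjoint by (subst card_Un_disjoint) (auto simp: card_star)

lemma sum_deg:
  assumes "A \<subseteq> U"
  shows "(\<Sum>a\<in>A. int (card (nbs F U a \<inter> A))) = 2 * int (card {e \<in> F. e \<subseteq> A})"
proof -
  have "{(x, y) \<in> A \<times> A. {x, y} \<in> F} = (SIGMA a:A. nbs F U a \<inter> A)"
    using assms by (auto simp: nbs_def)
  hence "card {(x, y) \<in> A \<times> A. {x, y} \<in> F} = (\<Sum>a\<in>A. card (nbs F U a \<inter> A))"
    by simp
  thus ?thesis using handshake_pairs[of F A, OF simple] by simp
qed

lemma sum_cross: "(\<Sum>x\<in>N. int (card (nbs F U x \<inter> W))) = (\<Sum>w\<in>W. int (d w))"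
proof -
  have "(\<Sum>x\<in>N. int (card (nbs F U x \<inter> W))) = (\<Sum>x\<in>N. \<Sum>w\<in>W. of_bool ({x, w} \<in> F))"
  proof (intro sum.cong refl)
    fix x
    have "nbs F U x \<inter> W = {w \<in> W. {x, w} \<in> F}" using WU by (auto simp: nbs_def)
    thus "int (card (nbs F U x \<inter> W)) = (\<Sum>w\<in>W. of_bool ({x, w} \<in> F))"
      by (simp add: sum.If_cases of_bool_def Collect_conj_eq Int_commute)
  qed
  also have "\<dots> = (\<Sum>w\<in>W. \<Sum>x\<in>N. of_bool ({x, w} \<in> F))" by (rule sum.swap)
  also have "\<dots> = (\<Sum>w\<in>W. int (d w))"
  proof (intro sum.cong refl)
    fix w
    have "nbs F U w \<inter> N = {x \<in> N. {x, w} \<in> F}" using NU by (auto simp: nbs_def insert_commute)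
    thus "(\<Sum>x\<in>N. of_bool ({x, w} \<in> F)) = int (d w)"
      by (simp add: d_def sum.If_cases of_bool_def Collect_conj_eq Int_commute)
  qed
  finally show ?thesis .
qed

lemma sum_deg_N: "(\<Sum>x\<in>N. int (card (nbs F U x))) = 2 * int eN + (\<Sum>w\<in>W. int (d w))"
proof -
  have "int (card (nbs F U x)) = int (card (nbs F U x \<inter> N)) + int (card (nbs F U x \<inter> W))" if "x \<in> N" for x
  proof -
    have "nbs F U x = (nbs F U x \<inter> N) \<union> (nbs F U x \<inter> W)"
      using that NU by (auto simp: W_def nbs_def insert_commute)
    hence "card (nbs F U x) = card ((nbs F U x \<inter> N) \<union> (nbs F U x \<inter> W))" by simp
    also have "\<dots> = card (nbs F U x \<inter> N) + card (nbs F U x \<inter> W)"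
      using NW by (intro card_Un_disjoint) auto
    finally show ?thesis by simp
  qed
  hence "(\<Sum>x\<in>N. int (card (nbs F U x)))
      = (\<Sum>x\<in>N. int (card (nbs F U x \<inter> N))) + (\<Sum>x\<in>N. int (card (nbs F U x \<inter> W)))"
    by (simp add: sum.distrib)
  thus ?thesis using sum_deg[OF NU] sum_cross by (simp add: eN_def)
qed

text \<open>The number of new points is a sum over \<open>a\<close> of the products of the degrees of \<open>v\<close> and \<open>a\<close>, up to
  corrections. The products add up to what the growth of the number of edges accounts for, so that
  only the corrections remain.\<close>

lemma defect_after:
  "defect after = defect before + 4 * int eN + 2 * (\<Sum>w\<in>W. int (d w) - 1)
     + 2 * (\<Sum>a\<in>U. choose2_int (d a)) + int (card Q)"
proof -
  define k where "k = int (card N)"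
  define T where "T = (\<Sum>a\<in>U. choose2_int (d a))"
  define E where "E = int (card before)"
  define B where "B = int (card (double_ball before))"
  have Q: "int (card N * card N - card N - card Q) = k * k - k - int (card Q)"
  proof -
    have "card Q \<le> card {(x, y) \<in> N \<times> N. x \<noteq> y}" by (intro card_mono) (auto simp: Q_def)
    hence "int (card Q) \<le> k * (k - 1)" using card_pairs_distinct[of N] by (simp add: k_def)
    hence "int (card Q) \<le> k * k - k" by (simp add: algebra_simps)
    moreover have "card N \<le> card N * card N" by simp
    hence "int (card N * card N - card N) = k * k - k" by (simp add: k_def)
    ultimately have "card Q \<le> card N * card N - card N" by linarith
    from of_nat_diff[OF this, where 'a = int]
    show ?thesis using \<open>int (card N * card N - card N) = k * k - k\<close> by (simp only:)
  qed
  have pair: "int (card (pair_sums (N - {a}) (nbs F U a)))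
      = k * int (card (nbs F U a)) - of_bool (a \<in> N) * int (card (nbs F U a)) - choose2_int (d a)" for a
  proof -
    have "a \<notin> nbs F U a" using loop by (simp add: nbs_def)
    hence "(N - {a}) \<inter> nbs F U a = nbs F U a \<inter> N" by blast
    hence "int (card (pair_sums (N - {a}) (nbs F U a))) + choose2_int (d a)
        = int (card (N - {a})) * int (card (nbs F U a))"
      using card_pair_sums[of "N - {a}" "nbs F U a"] unfolding d_def
      by (simp only: of_nat_add[symmetric] of_nat_mult[symmetric] of_nat_eq_iff)
    moreover have "int (card (N - {a})) = k - of_bool (a \<in> N)"
      using card_Suc_Diff1[of N a] by (cases "a \<in> N") (auto simp: k_def)
    ultimately have "int (card (pair_sums (N - {a}) (nbs F U a))) + choose2_int (d a)
        = (k - of_bool (a \<in> N)) * int (card (nbs F U a))" by simp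
    thus ?thesis by (simp add: left_diff_distrib)
  qed
  have "(\<Sum>a\<in>U. of_bool (a \<in> N) * int (card (nbs F U a))) = (\<Sum>a\<in>N. int (card (nbs F U a)))"
    using NU by (intro sum.mono_neutral_cong_right) auto
  moreover have "(\<Sum>a\<in>U. int (card (nbs F U a))) = 2 * E"
  proof -
    have "nbs F U a \<inter> U = nbs F U a" for a by (auto simp: nbs_def)
    thus ?thesis using sum_deg[of U] by (simp add: E_def induced_def)
  qed
  ultimately have pairs: "(\<Sum>a\<in>U. int (card (pair_sums (N - {a}) (nbs F U a))))
      = k * (2 * E) - (2 * int eN + (\<Sum>w\<in>W. int (d w))) - T"
    by (simp add: pair sum_subtractf T_def sum_deg_N flip: sum_distrib_left)
  have PN: "2 * int (card (pair_sums N N)) = 2 * k * k - k * (k - 1)"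
  proof -
    have "int (card (pair_sums N N) + (card (N \<inter> N) choose 2)) = int (card N * card N)"
      unfolding card_pair_sums ..
    hence "int (card (pair_sums N N)) + choose2_int (card N) = k * k" by (simp add: k_def)
    thus ?thesis using choose_two_int[of "card N"] unfolding k_def[symmetric] by linarith
  qed
  have "int (card (double_ball after)) = B + (k * k - k - int (card Q))
      + 2 * (k + int (card W) + (k * (2 * E) - (2 * int eN + (\<Sum>w\<in>W. int (d w))) - T))
      + (2 * k * k - k * (k - 1))"
  proof -
    have "card (double_ball after) = card (double_ball before) + (card N * card N - card N - card Q)
        + 2 * (card N + card W + (\<Sum>a\<in>U. card (pair_sums (N - {a}) (nbs F U a))))
        + 2 * card (pair_sums N N)"
      unfolding N_def W_def Q_def by (rule card_double_ball_insert[OF simple v])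
    hence "int (card (double_ball after)) = B + int (card N * card N - card N - card Q)
        + 2 * (k + int (card W) + (\<Sum>a\<in>U. int (card (pair_sums (N - {a}) (nbs F U a)))))
        + 2 * int (card (pair_sums N N))"
      unfolding B_def k_def by simp
    thus ?thesis unfolding Q pairs PN .
  qed
  moreover have "int (card after) = E + k" by (simp add: card_after E_def k_def)
  moreover have "(\<Sum>w\<in>W. int (d w) - 1) = (\<Sum>w\<in>W. int (d w)) - int (card W)"
    by (simp add: sum_subtractf)
  ultimately show ?thesis
    unfolding defect_def by (simp add: E_def[symmetric] B_def[symmetric] T_def[symmetric] power2_eq_square algebra_simps)
qed

lemma H_edges: "e \<in> H \<Longrightarrow> e \<subseteq> N \<union> W \<and> e \<inter> N \<noteq> {}"
proof -
  assume e: "e \<in> H"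
  then obtain a b where ab: "e = {a, b}" "a \<in> N" "b \<in> U" "{a, b} \<in> F"
  proof -
    obtain a b where "e = {a, b}" using e simple[of e] by (auto simp: H_def induced_def card_2_iff)
    thus ?thesis using e that[of a b] that[of b a] by (auto simp: H_def induced_def insert_commute)
  qed
  have "b \<in> N \<union> W" using ab NU by (auto simp: W_def nbs_def insert_commute)
  thus ?thesis using ab by auto
qed

lemma link_H: "z \<in> U \<Longrightarrow> link H N z = nbs F U z \<inter> N"
  using NU by (auto simp: link_def H_def induced_def nbs_def insert_commute)

lemma card_H: "int (card H) = M + int (card W)"
proof -
  let ?A = "{e \<in> F. e \<subseteq> N}" and ?B = "(\<lambda>(w, x). {x, w}) ` (SIGMA w:W. nbs F U w \<inter> N)"
  have "H = ?A \<union> ?B"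
  proof
    show "H \<subseteq> ?A \<union> ?B"
    proof
      fix e assume e: "e \<in> H"
      then obtain a b where ab: "e = {a, b}" "a \<in> N" "e \<subseteq> U" "e \<in> F"
      proof -
        obtain a b where "e = {a, b}" using e simple[of e] by (auto simp: H_def induced_def card_2_iff)
        thus ?thesis using e that[of a b] that[of b a] by (auto simp: H_def induced_def insert_commute)
      qed
      show "e \<in> ?A \<union> ?B"
      proof (cases "b \<in> N")
        case True
        thus ?thesis using ab by auto
      next
        case False
        hence "b \<in> W" using H_edges[OF e] ab by auto
        hence "e \<in> ?B" using ab by (intro rev_image_eqI[of "(b, a)"]) (auto simp: nbs_def insert_commute)
        thus ?thesis by blast
      qed
    qed
    have "e \<noteq> {}" if "e \<in> F" for e using simple[OF that] by auto
    thus "?A \<union> ?B \<subseteq> H"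
      using NU WU by (auto simp: H_def induced_def nbs_def insert_commute) blast+
  qed
  moreover have "?A \<inter> ?B = {}" using NW by auto
  ultimately have "card H = card ?A + card ?B" by (simp add: card_Un_disjoint)
  also have "card ?B = card (SIGMA w:W. nbs F U w \<inter> N)"
    using NW by (intro card_image inj_onI) (auto simp: doubleton_eq_iff)
  also have "\<dots> = (\<Sum>w\<in>W. d w)" by (simp add: d_def)
  finally show ?thesis by (simp add: M_def eN_def sum_subtractf)
qed

lemma H_nullity: "nullity H = M - s"
  by (simp add: nullity_def s_def card_H)

lemma H_linked: "w \<in> W \<Longrightarrow> \<exists>x\<in>N. linked H x w"
proof -
  assume w: "w \<in> W"
  hence "link H N w \<noteq> {}" using link_H[of w] WU by (auto simp: W_def)
  thus ?thesis using linked_edge by (force simp: link_def)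
qed

lemma s_nonneg: "0 \<le> s" and Q_le: "int (card Q) \<le> s * (s + 1)"
proof -
  note bounds = linked_bounds[OF NW H_linked]
  have s: "s = int (edge_rank H - card W)" using bounds(3) by (simp add: s_def)
  thus "0 \<le> s" by simp
  have edge: "linked H a b" if "a \<in> N" "b \<in> U" "{a, b} \<in> F" for a b
    using that NU by (intro linked_edge) (auto simp: H_def induced_def)
  have "Q \<subseteq> {(x, y) \<in> N \<times> N. x \<noteq> y \<and> linked H x y}"
  proof (clarsimp simp: Q_def)
    fix i j assume ij: "i \<in> N" "j \<in> N" "{i, j} \<in> F \<or> nbs F U i \<inter> nbs F U j \<noteq> {}"
    from ij(3) show "linked H i j"
    proof
      assume "{i, j} \<in> F"
      thus ?thesis using ij NU by (intro edge) auto
    next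
      assume "nbs F U i \<inter> nbs F U j \<noteq> {}"
      then obtain z where "z \<in> U" "{i, z} \<in> F" "{j, z} \<in> F" by (auto simp: nbs_def)
      thus ?thesis using edge[of i z] edge[of j z] ij by (meson linked_sym linked_trans)
    qed
  qed
  hence "card Q \<le> card {(x, y) \<in> N \<times> N. x \<noteq> y \<and> linked H x y}" by (intro card_mono) auto
  also have "\<dots> \<le> (edge_rank H - card W) * (edge_rank H - card W + 1)" by (rule bounds(1))
  finally have "int (card Q) \<le> int ((edge_rank H - card W) * (edge_rank H - card W + 1))"
    by (simp only: of_nat_le_iff)
  thus "int (card Q) \<le> s * (s + 1)" by (simp only: s of_nat_mult of_nat_add of_nat_1)
qed

lemma simple_H: "e \<in> H \<Longrightarrow> card e = 2"
  using simple by (auto simp: H_def induced_def)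

lemma simple_induced: "e \<in> induced F A \<Longrightarrow> card e = 2"
  using simple by (auto simp: induced_def)

lemma eN_H: "{e \<in> H. e \<subseteq> N} = {e \<in> F. e \<subseteq> N}"
proof -
  have "e \<noteq> {}" if "e \<in> F" for e using simple[OF that] by auto
  thus ?thesis using NU by (auto simp: H_def induced_def)
qed

text \<open>This is the local inequality for \<open>H\<close>; the pairs in \<open>Q\<close> are linked by \<open>H\<close>, which bounds their number.\<close>

lemma defect_increase: "defect after - defect before \<le> 2 * s * (2 * M - s + 2)"
proof -
  have "(\<Sum>a\<in>U. choose2_int (d a)) = (\<Sum>z\<in>N \<union> W. choose2_int (d z))"
  proof (rule sum.mono_neutral_right)
    show "\<forall>a\<in>U - (N \<union> W). choose2_int (d a) = 0" by (auto simp: W_def d_def)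
  qed (use NU WU in auto)
  also have "\<dots> = (\<Sum>z\<in>N \<union> W. choose2_int (card (link H N z)))"
  proof (intro sum.cong refl)
    fix z assume "z \<in> N \<union> W"
    hence "z \<in> U" using NU WU by blast
    thus "choose2_int (d z) = choose2_int (card (link H N z))" by (simp add: d_def link_H)
  qed
  finally have T: "(\<Sum>a\<in>U. choose2_int (d a)) = (\<Sum>z\<in>N \<union> W. choose2_int (card (link H N z)))" .
  have "2 * int (card {e \<in> H. e \<subseteq> N}) + 2 * (int (card H) - int (card W))
      + 2 * (\<Sum>z\<in>N \<union> W. choose2_int (card (link H N z)))
      + (int (edge_rank H) - int (card W)) * ((int (edge_rank H) - int (card W)) + 1)
      \<le> 2 * (int (edge_rank H) - int (card W)) * (2 * (int (card H) - int (card W)) - (int (edge_rank H) - int (card W)) + 2)"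
  proof (rule local_inequality[OF simple_H NW H_edges])
    show "link H N w \<noteq> {}" if "w \<in> W" for w using that link_H[of w] WU by (auto simp: W_def)
  qed
  hence "2 * int eN + 2 * M + 2 * (\<Sum>a\<in>U. choose2_int (d a)) + s * (s + 1) \<le> 2 * s * (2 * M - s + 2)"
    unfolding T eN_H by (simp add: s_def card_H eN_def)
  thus ?thesis using Q_le by (simp add: defect_after M_def)
qed

lemma nullity_star: "M \<le> nullity (H \<union> (\<lambda>i. {v, i}) ` N)"
proof -
  have "edge_rank (H \<union> (\<lambda>i. {v, i}) ` N) \<le> card (insert v (N \<union> W)) - 1"
    by (rule edge_rank_le[of _ _ v]) (use H_edges in auto)
  also have "card (insert v (N \<union> W)) = Suc (card N + card W)"
    using v NU WU NW by (subst card_insert_disjoint) (auto simp: card_Un_disjoint)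
  finally have "edge_rank (H \<union> (\<lambda>i. {v, i}) ` N) \<le> card N + card W" by simp
  moreover have "H \<subseteq> before" by (auto simp: H_def)
  hence "card (H \<union> (\<lambda>i. {v, i}) ` N) = card H + card N"
    using star_disjoint by (subst card_Un_disjoint) (auto simp: card_star)
  ultimately show ?thesis using card_H by (simp add: nullity_def)
qed

lemma simple_star: "e \<in> (\<lambda>i. {v, i}) ` N \<Longrightarrow> card e = 2"
  using simple by (auto simp: N_def nbs_def)

lemma nullity_increase: "s \<le> nullity after - nullity before"
proof -
  have "H \<subseteq> before" by (auto simp: H_def)
  from nullity_supermodular[OF this star_disjoint simple_star]
  show ?thesis using nullity_star H_nullity by (simp add: after_eq)
qed

lemma nullity_before: "M - s \<le> nullity before" "0 \<le> M - s"
proof -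
  show "M - s \<le> nullity before"
    unfolding H_nullity[symmetric] using simple_induced by (intro nullity_mono) (auto simp: H_def)
  show "0 \<le> M - s"
    unfolding H_nullity[symmetric] using simple_H by (intro nullity_nonneg)
qed

text \<open>With \<open>\<delta>\<close> the growth of the nullity from the value \<open>c\<close>, the first term of the gap grows by
  \<open>2 \<delta> (\<delta> + 2 c + 2)\<close>, which is monotone in \<open>\<delta> \<ge> s\<close> and \<open>c \<ge> M - s\<close>. For positive \<open>\<delta>\<close> it is strictly
  monotone, so that equality determines both.\<close>

lemma gap_mono: "gap before \<le> gap after"
  and gap_eqD: "gap after = gap before \<Longrightarrow> nullity before < nullity after \<Longrightarrow>
    nullity after = M \<and> nullity after - nullity before = s
      \<and> defect after - defect before = 2 * s * (2 * M - s + 2)"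
proof -
  define \<delta> c L where "\<delta> = nullity after - nullity before" and "c = nullity before" and "L = M - s"
  have ge: "s \<le> \<delta>" "L \<le> c" "0 \<le> L" "0 \<le> s"
    using nullity_increase nullity_before s_nonneg by (simp_all add: \<delta>_def c_def L_def)
  have diff: "gap after - gap before = 2 * (\<delta> * (\<delta> + 2 * c + 2)) - (defect after - defect before)"
    by (simp add: gap_def \<delta>_def c_def algebra_simps)
  have bound: "defect after - defect before \<le> 2 * (s * (s + 2 * L + 2))"
    using defect_increase by (simp add: L_def algebra_simps)
  have mono: "s * (s + 2 * L + 2) \<le> s * (\<delta> + 2 * c + 2)"
    "s * (\<delta> + 2 * c + 2) \<le> \<delta> * (\<delta> + 2 * c + 2)"
    using ge by (intro mult_left_mono mult_right_mono; simp)+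
  show "gap before \<le> gap after" using diff bound mono by linarith
  assume eq: "gap after = gap before" and "nullity before < nullity after"
  hence pos: "\<delta> > 0" by (simp add: \<delta>_def)
  have eqs: "s * (s + 2 * L + 2) = \<delta> * (\<delta> + 2 * c + 2)"
    "defect after - defect before = 2 * (s * (s + 2 * L + 2))"
    using diff bound mono eq by linarith+
  have "\<delta> = s"
  proof (rule ccontr)
    assume "\<delta> \<noteq> s"
    hence "s * (\<delta> + 2 * c + 2) < \<delta> * (\<delta> + 2 * c + 2)"
      using ge pos by (intro mult_strict_right_mono) auto
    thus False using eqs mono by linarith
  qed
  moreover from this have "L = c" using eqs(1) pos by simp
  ultimately show "nullity after = M \<and> nullity after - nullity before = s
      \<and> defect after - defect before = 2 * s * (2 * M - s + 2)"
    using eqs(2) by (simp add: \<delta>_def c_def L_def algebra_simps)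
qed

end

lemma defect_empty: "defect {} = 0"
  by (simp add: defect_def double_ball_def unit_ball_def edge_vectors_def)

theorem gap_nonneg:
  assumes "\<And>e. e \<in> F \<Longrightarrow> card e = 2"
  shows "0 \<le> gap (induced F U)"
  using finite[of U]
proof (induction U rule: finite_induct)
  case empty
  have "induced F {} = {}" using assms by (force simp: induced_def)
  thus ?case by (simp add: gap_def nullity_empty defect_empty)
next
  case (insert v U)
  interpret vertex_deletion F U v
    by unfold_locales (use assms insert in auto)
  show ?case using gap_mono insert.IH by linarith
qed

section \<open>Graphs without bridges\<close>

text \<open>If \<open>e\<close> is not an edge, the condition says that the graph is connected.\<close>

definition bridgeless_connected :: "'n::finite set \<Rightarrow> 'n set set \<Rightarrow> bool" where
  "bridgeless_connected V F \<longleftrightarrow> (\<forall>e. \<forall>x\<in>V. \<forall>y\<in>V. linked (F - {e}) x y)"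

lemma linked_path_segment:
  assumes "a \<le> b" "\<And>k. a \<le> k \<Longrightarrow> k < b \<Longrightarrow> {p ! k, p ! Suc k} \<in> F"
  shows "linked F (p ! a) (p ! b)"
  using assms
proof (induction b rule: dec_induct)
  case base
  show ?case by (rule linked_refl)
next
  case (step b)
  have "linked F (p ! a) (p ! b)" using step by simp
  moreover have "linked F (p ! b) (p ! Suc b)" using step by (intro linked_edge) simp
  ultimately show ?case by (rule linked_trans)
qed

lemma path_edge_eqD:
  assumes "distinct p" "{p ! i, p ! Suc i} = {p ! k, p ! Suc k}" "Suc i < length p" "Suc k < length p"
  shows "i = k"
  using assms by (auto simp: doubleton_eq_iff nth_eq_iff_index_eq)

text \<open>Without one edge a path falls into at most two pieces, one at each end.\<close>

lemma linked_path_minus_edge: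
  assumes p: "distinct p" "j < length p" and F: "path_edges p - {e} \<subseteq> F"
  shows "linked F (p ! 0) (p ! j) \<or> (e \<in> path_edges p \<and> linked F (p ! j) (last p))"
proof (cases "e \<in> path_edges p")
  case False
  hence "{p ! k, p ! Suc k} \<in> F" if "k < j" for k
    using that p(2) F by (force simp: path_edges_def)
  hence "linked F (p ! 0) (p ! j)" by (intro linked_path_segment) auto
  thus ?thesis ..
next
  case True
  then obtain i where i: "e = {p ! i, p ! Suc i}" "Suc i < length p" by (auto simp: path_edges_def)
  have edge: "{p ! k, p ! Suc k} \<in> F" if "Suc k < length p" "k \<noteq> i" for k
  proof -
    have "{p ! k, p ! Suc k} \<noteq> e" using path_edge_eqD[OF p(1), of k i] that i by blast
    thus ?thesis using that(1) F by (auto simp: path_edges_def)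
  qed
  show ?thesis
  proof (cases "j \<le> i")
    case True
    hence "linked F (p ! 0) (p ! j)" using i(2) edge by (intro linked_path_segment) auto
    thus ?thesis ..
  next
    case False
    hence "linked F (p ! j) (p ! (length p - 1))"
      using p(2) edge by (intro linked_path_segment) auto
    moreover have "last p = p ! (length p - 1)" using p(2) by (intro last_conv_nth) auto
    ultimately show ?thesis using True by simp
  qed
qed

text \<open>Removing an edge cuts a path into two pieces. In a cycle the closing edge joins them, and in an ear each
  of them has an end in the old graph.\<close>

lemma two_connected_imp_bridgeless:
  fixes G :: "('n::finite) ugraph"
  assumes "two_connected G"
  shows "bridgeless_connected (verts G) (edges G)"
  using assms
proof (induction rule: two_connected.induct)
  case (cycle p)
  have p0: "p \<noteq> []" using cycle by auto
  have "linked (cycle_edges p - {e}) (p ! 0) x" if x: "x \<in> set p" for e x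
  proof -
    let ?F = "cycle_edges p - {e}"
    from x obtain j where j: "x = p ! j" "j < length p" unfolding in_set_conv_nth by blast
    have "path_edges p - {e} \<subseteq> ?F" by (auto simp: cycle_edges_def)
    from linked_path_minus_edge[OF cycle(1) j(2) this] show ?thesis
    proof
      assume "linked ?F (p ! 0) (p ! j)"
      thus ?thesis using j by simp
    next
      assume e: "e \<in> path_edges p \<and> linked ?F (p ! j) (last p)"
      then obtain i where i: "e = {p ! i, p ! Suc i}" "Suc i < length p" by (auto simp: path_edges_def)
      have "{last p, hd p} \<noteq> e"
      proof
        assume "{last p, hd p} = e"
        hence "{p ! (length p - 1), p ! 0} = {p ! i, p ! Suc i}"
          using p0 i by (simp add: last_conv_nth hd_conv_nth)
        thus False
          using cycle i(2) p0 by (auto simp: doubleton_eq_iff nth_eq_iff_index_eq)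
      qed
      hence "{last p, hd p} \<in> ?F" by (simp add: cycle_edges_def)
      hence "linked ?F (last p) (p ! 0)" using p0 by (simp add: linked_edge hd_conv_nth)
      thus ?thesis using e j by (meson linked_sym linked_trans)
    qed
  qed
  thus ?case
    unfolding bridgeless_connected_def fst_conv snd_conv by (blast intro: linked_trans[OF linked_sym])
next
  case (ear V E u v xs)
  let ?p = "u # xs @ [v]"
  have dist: "distinct ?p" using ear by auto
  have "linked (E \<union> path_edges ?p - {e}) u x" if x: "x \<in> V \<union> set xs" for e x
  proof -
    let ?F = "E \<union> path_edges ?p - {e}"
    have IH: "linked ?F a b" if "a \<in> V" "b \<in> V" for a b
      using ear.IH that by (auto simp: bridgeless_connected_def intro: linked_mono)
    show ?thesis
    proof (cases "x \<in> V")
      case True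
      thus ?thesis using IH ear by simp
    next
      case False
      hence "x \<in> set ?p" using x by auto
      then obtain j where j: "x = ?p ! j" "j < length ?p" unfolding in_set_conv_nth by blast
      have "path_edges ?p - {e} \<subseteq> ?F" by auto
      from linked_path_minus_edge[OF dist j(2) this] have "linked ?F u x \<or> linked ?F x v"
        unfolding j(1) by auto
      thus ?thesis using IH[of u v] ear by (meson linked_sym linked_trans)
    qed
  qed
  thus ?case
    unfolding bridgeless_connected_def fst_conv snd_conv by (blast intro: linked_trans[OF linked_sym])
qed

text \<open>Otherwise all vectors in the span vanish at the coordinate \<open>v\<close>.\<close>

lemma linked_imp_incident_edge:
  assumes "linked F v x" "x \<noteq> v"
  obtains i where "{v, i} \<in> F"
proof (rule ccontr)
  assume "\<not> thesis"
  hence no: "{v, i} \<notin> F" for i using that by blast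
  have z: "z $ v = 0" if z: "z \<in> edge_vectors F" for z
  proof -
    obtain a b where ab: "{a, b} \<in> F" "z = basis_vec a - basis_vec b"
      using z unfolding edge_vectors_def by blast
    have "a \<noteq> v \<and> b \<noteq> v" using ab(1) no[of a] no[of b] by (auto simp: insert_commute)
    thus ?thesis using ab(2) by (auto simp: axis_def)
  qed
  have "span (edge_vectors F) \<subseteq> {z. z $ v = 0}"
    using z by (intro span_minimal) (auto simp: subspace_def)
  hence "(basis_vec v - basis_vec x :: real ^ 'a) $ v = 0"
    using assms(1) by (auto simp: linked_def)
  thus False using assms(2) by (simp add: axis_def)
qed

section \<open>Graphs with vanishing gap\<close>

text \<open>The complete bipartite graph with the parts \<open>{p, q}\<close> and \<open>- {p, q}\<close>.\<close>

definition book :: "'n \<Rightarrow> 'n \<Rightarrow> 'n set set" where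
  "book p q = (\<Union>x\<in>- {p, q}. {{p, x}, {q, x}})"

locale vanishing_gap =
  fixes F :: "'n::finite set set"
  assumes simple: "\<And>e. e \<in> F \<Longrightarrow> card e = 2" and bridgeless: "bridgeless_connected UNIV F"
    and vanishing: "gap F = 0" and five: "CARD('n) \<ge> 5"
begin

lemma induced_UNIV: "induced F UNIV = F"
  by (simp add: induced_def)

lemma linked_minus: "linked (F - {e}) x y"
  using bridgeless by (simp add: bridgeless_connected_def)

lemma edge_avoiding: obtains i where "{v, i} \<in> F - {e}"
proof -
  have "UNIV \<noteq> {v}"
  proof
    assume "UNIV = {v}"
    hence "CARD('n) = card {v}" by (rule arg_cong)
    thus False using five by simp
  qed
  then obtain x where "x \<noteq> v" by blast
  from linked_imp_incident_edge[OF linked_minus[of e v x] this] show ?thesis using that by blast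
qed

text \<open>No edge is a bridge, so each edge outside the cycles counted by \<open>M\<close> would raise
  the nullity above \<open>M\<close>.\<close>

lemma deletion:
  fixes v :: 'n
  defines "U \<equiv> UNIV - {v}"
  shows "nullity F = vertex_deletion.M F U v"
    and "nullity F - nullity (induced F U) = vertex_deletion.s F U v"
    and "defect F - defect (induced F U) = 2 * vertex_deletion.s F U v *
      (2 * vertex_deletion.M F U v - vertex_deletion.s F U v + 2)"
    and "\<And>e. e \<in> F \<Longrightarrow> v \<notin> e \<Longrightarrow> \<exists>i\<in>e. {v, i} \<in> F"
proof -
  interpret vertex_deletion F U v
    by unfold_locales (use simple in \<open>auto simp: U_def\<close>)
  have after: "after = F"
  proof -
    have "insert v U = UNIV" by (auto simp: U_def)
    thus ?thesis by (simp add: induced_UNIV)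
  qed
  have "gap before \<le> gap F" using gap_mono by (simp add: after)
  moreover have "0 \<le> gap before" using simple by (rule gap_nonneg)
  ultimately have eq: "gap after = gap before" using vanishing by (simp add: after)
  obtain i where i: "{v, i} \<in> F" using edge_avoiding[of v "{}"] by auto
  have "nullity before \<le> nullity (F - {{v, i}})"
    using simple by (intro nullity_mono) (auto simp: induced_def U_def)
  hence "nullity before < nullity after"
    using nullity_remove[OF i linked_minus] by (simp add: after)
  note * = gap_eqD[OF eq this, unfolded after]
  show "nullity F = M" "nullity F - nullity before = s"
    "defect F - defect before = 2 * s * (2 * M - s + 2)" using * by blast+
  fix e assume e: "e \<in> F" "v \<notin> e"
  show "\<exists>i\<in>e. {v, i} \<in> F"
  proof (rule ccontr)
    assume no: "\<not> (\<exists>i\<in>e. {v, i} \<in> F)"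
    obtain a b where ab: "e = {a, b}" using simple[OF e(1)] by (auto simp: card_2_iff)
    have "H \<union> (\<lambda>i. {v, i}) ` N \<subseteq> F - {e}"
      using no e(2) by (auto simp: H_def induced_def N_def nbs_def)
    hence "nullity (H \<union> (\<lambda>i. {v, i}) ` N) \<le> nullity (F - {e})"
      using simple by (intro nullity_mono) auto
    hence "M \<le> nullity (F - {e})" using nullity_star by linarith
    moreover have "nullity F = nullity (F - {e}) + 1"
      using nullity_remove[of a b F] linked_minus[of e a b] e(1) ab by simp
    ultimately show False using * by linarith
  qed
qed

lemma loopless: "{a, a} \<notin> F"
  using simple[of "{a, a}"] by auto

text \<open>Hence the graph is complete multipartite.\<close>

lemma non_adjacent_trans:
  assumes "a \<noteq> c" "{a, b} \<notin> F" "{b, c} \<notin> F"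
  shows "{a, c} \<notin> F"
proof
  assume ac: "{a, c} \<in> F"
  hence "b \<notin> {a, c}" using assms by (auto simp: insert_commute)
  from deletion(4)[OF ac this] show False using assms by (auto simp: insert_commute)
qed

lemma neighbours:
  fixes v :: 'n
  defines "U \<equiv> UNIV - {v}"
  shows "vertex_deletion.N F U v = {x. {v, x} \<in> F}"
    and "vertex_deletion.W F U v = {x. x \<noteq> v \<and> {v, x} \<notin> F}"
    and "2 \<le> card {x. {v, x} \<in> F}"
proof -
  interpret vertex_deletion F U v
    by unfold_locales (use simple in \<open>auto simp: U_def\<close>)
  have mem: "x \<in> U \<longleftrightarrow> x \<noteq> v" for x by (simp add: U_def)
  show N': "N = {x. {v, x} \<in> F}" using loopless[of v] by (auto simp: N_def nbs_def mem)
  have "z \<in> W" if z: "z \<noteq> v" "{v, z} \<notin> F" for z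
  proof -
    obtain b where b: "{z, b} \<in> F" using edge_avoiding[of z "{}"] by auto
    hence "v \<notin> {z, b}" using z by (auto simp: insert_commute)
    from deletion(4)[OF b this] have "{v, b} \<in> F" "b \<noteq> v"
      using z loopless[of v] by auto
    hence "b \<in> nbs F U z \<inter> N" using b N' by (simp add: nbs_def mem)
    thus ?thesis using z N' by (auto simp: W_def mem)
  qed
  thus "W = {x. x \<noteq> v \<and> {v, x} \<notin> F}" using N' WU by (auto simp: W_def mem)
  obtain i where i: "{v, i} \<in> F" using edge_avoiding[of v "{}"] by auto
  obtain j where j: "{v, j} \<in> F - {{v, i}}" using edge_avoiding[of v "{v, i}"] by auto
  have "card {i, j} \<le> card {x. {v, x} \<in> F}" using i j by (intro card_mono) auto
  thus "2 \<le> card {x. {v, x} \<in> F}" using j by (cases "i = j") auto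
qed

text \<open>For the complete graph the equality at a vertex of degree \<open>k\<close> reads \<open>(k - 1) (k - 2) (k - 3) = 0\<close>.\<close>

lemma not_complete: "\<exists>v w. v \<noteq> w \<and> {v, w} \<notin> F"
proof (rule ccontr)
  assume "\<not> (\<exists>v w. v \<noteq> w \<and> {v, w} \<notin> F)"
  hence complete: "{v, w} \<in> F" if "v \<noteq> w" for v w using that by blast
  obtain v :: 'n where True by blast
  define U where "U = UNIV - {v}"
  interpret vertex_deletion F U v
    by unfold_locales (use simple in \<open>auto simp: U_def\<close>)
  define k where "k = int (card N)"
  have mem: "x \<in> U \<longleftrightarrow> x \<noteq> v" for x by (simp add: U_def)
  have cardU: "card U = CARD('n) - 1" by (simp add: U_def)
  have "N = {x. {v, x} \<in> F}" using neighbours(1)[of v] by (simp only: U_def)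
  hence N': "N = U" using complete loopless[of v] by (auto simp: mem)
  have "W = {x. x \<noteq> v \<and> {v, x} \<notin> F}" using neighbours(2)[of v] by (simp only: U_def)
  hence W': "W = {}" using complete by auto
  have k4: "k \<ge> 4" using five by (simp add: k_def N' cardU)
  have nbs: "nbs F U a \<inter> N = N - {a}" if "a \<in> U" for a
    using complete loopless by (auto simp: nbs_def N')
  have da: "int (d a) = k - 1" if "a \<in> U" for a
    using that nbs[OF that] card_Suc_Diff1[of N a] by (simp add: d_def k_def N')
  have "2 * int eN = k * (k - 1)"
    using sum_deg[OF NU] da by (simp add: eN_def d_def N' k_def)
  hence M': "2 * M = k * (k - 1)" by (simp add: M_def W')
  have T: "2 * (\<Sum>a\<in>U. choose2_int (d a)) = k * ((k - 1) * (k - 2))"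
  proof -
    have "2 * choose2_int (d a) = (k - 1) * (k - 2)" if "a \<in> U" for a
      unfolding choose_two_int da[OF that] by simp
    hence "(\<Sum>a\<in>U. 2 * choose2_int (d a)) = (\<Sum>a\<in>U. (k - 1) * (k - 2))" by (intro sum.cong) auto
    thus ?thesis by (simp add: sum_distrib_left k_def N')
  qed
  have "Q = {(x, y) \<in> N \<times> N. x \<noteq> y}" using complete by (auto simp: Q_def)
  hence Q': "int (card Q) = k * (k - 1)" by (simp only: k_def card_pairs_distinct finite)
  have "insert v U = UNIV" by (auto simp: U_def)
  hence after: "after = F" by (simp add: induced_UNIV)
  have "defect after - defect before = 2 * s * (2 * M - s + 2)"
    using deletion(3)[of v] unfolding after by (simp only: U_def)
  hence D: "2 * s * (2 * M - s + 2) = 2 * (k * (k - 1)) + k * ((k - 1) * (k - 2)) + k * (k - 1)"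
    using defect_after \<open>2 * int eN = k * (k - 1)\<close> T Q' unfolding W' by simp
  have "card N \<le> edge_rank H - card W + 1"
  proof (rule linked_bounds(2)[OF NW H_linked])
    show "linked H x y" if "x \<in> N" "y \<in> N" for x y
      using that complete[of x y] linked_refl[of H x]
      by (cases "x = y") (auto intro!: linked_edge simp: H_def induced_def N')
  qed auto
  moreover have "edge_rank H \<le> card N - 1"
  proof -
    have "N \<noteq> {}" using k4 by (auto simp: k_def)
    then obtain x where "x \<in> N" by blast
    thus ?thesis using H_edges W' by (intro edge_rank_le[of _ _ x]) auto
  qed
  ultimately have s': "s = k - 1" using k4 by (simp add: s_def W' k_def of_nat_diff)
  have "2 * (k - 1) * (k * (k - 1) - (k - 1) + 2)
      = 2 * (k * (k - 1)) + k * ((k - 1) * (k - 2)) + k * (k - 1)"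
    using D unfolding s' M' .
  hence "(k - 1) * ((k - 2) * (k - 3)) = 0" by (simp add: algebra_simps)
  thus False using k4 by auto
qed

text \<open>Every neighbour of \<open>v\<close> is adjacent to all \<open>m\<close> non-neighbours. With \<open>x\<close> edges among the \<open>k\<close> neighbours
  of \<open>v\<close>, the equality at \<open>v\<close> therefore implies \<open>2 (k - 2) x + 3 (k - 1) (k - 2) (m - 1) \<le> 0\<close>.\<close>

lemma deletion_counts:
  fixes v w :: 'n
  defines "U \<equiv> UNIV - {v}"
  assumes vw: "v \<noteq> w" "{v, w} \<notin> F"
  defines "k \<equiv> card {x. {v, x} \<in> F}" and "m \<equiv> card {x. x \<noteq> v \<and> {v, x} \<notin> F}"
  assumes "k \<noteq> 2"
  shows "m = 1" and "{e \<in> F. e \<subseteq> {x. {v, x} \<in> F}} = {}"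
proof -
  interpret vertex_deletion F U v
    by unfold_locales (use simple in \<open>auto simp: U_def\<close>)
  have N': "N = {x. {v, x} \<in> F}" and W': "W = {x. x \<noteq> v \<and> {v, x} \<notin> F}"
    using neighbours(1,2)[of v] by (simp_all only: U_def)
  have k3: "int k \<ge> 3" using neighbours(3)[of v] \<open>k \<noteq> 2\<close> by (simp add: k_def)
  have kN: "card N = k" and mW: "card W = m" by (simp_all add: k_def m_def N' W')
  have w: "w \<in> W" using vw W' by auto
  hence m1: "int m \<ge> 1" using mW card_gt_0_iff[of W] by fastforce
  have cross: "{x, y} \<in> F" if "x \<in> N" "y \<in> W" for x y
  proof (rule ccontr)
    assume "{x, y} \<notin> F"
    moreover have "v \<noteq> x" using that(1) loopless[of v] by (auto simp: N')
    ultimately have "{v, x} \<notin> F"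
      using non_adjacent_trans[of v x y] that(2) by (auto simp: W' insert_commute)
    thus False using that N' by simp
  qed
  have dw: "d y = k" if "y \<in> W" for y
  proof -
    have "nbs F U y \<inter> N = N" using cross that NU by (auto simp: nbs_def insert_commute)
    thus ?thesis by (simp add: d_def kN)
  qed
  have dx: "int (d x) \<le> int k - 1" if "x \<in> N" for x
  proof -
    have "d x \<le> card (N - {x})" unfolding d_def using loopless by (intro card_mono) (auto simp: nbs_def)
    moreover have "Suc (card (N - {x})) = k" using that kN card_Suc_Diff1[of N x] by simp
    ultimately show ?thesis by linarith
  qed
  have M': "M = int eN + int m * (int k - 1)"
    using dw by (simp add: M_def mW)
  have Q': "int (card Q) = int k * (int k - 1)"
  proof -
    have "nbs F U i \<inter> nbs F U j \<noteq> {}" if "i \<in> N" "j \<in> N" for i j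
    proof -
      have "w \<in> nbs F U i \<inter> nbs F U j" using cross that w WU by (auto simp: nbs_def)
      thus ?thesis by blast
    qed
    hence "Q = {(x, y) \<in> N \<times> N. x \<noteq> y}" by (auto simp: Q_def)
    thus ?thesis using card_pairs_distinct[of N] by (simp add: kN)
  qed
  have "2 * (\<Sum>a\<in>U. choose2_int (d a)) \<le> int m * (int k * (int k - 1)) + (int k - 2) * (2 * int eN)"
  proof -
    have "x \<in> U \<longleftrightarrow> x \<in> W \<union> N" for x
    proof -
      have "x \<in> U \<longleftrightarrow> x \<noteq> v" by (simp add: U_def)
      thus ?thesis using loopless[of v] unfolding N' W' by auto
    qed
    hence U': "U = W \<union> N" by blast
    have "(\<Sum>a\<in>W \<union> N. choose2_int (d a)) = (\<Sum>a\<in>W. choose2_int (d a)) + (\<Sum>a\<in>N. choose2_int (d a))"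
      using NW by (intro sum.union_disjoint) auto
    hence "(\<Sum>a\<in>U. choose2_int (d a)) = (\<Sum>a\<in>W. choose2_int (d a)) + (\<Sum>a\<in>N. choose2_int (d a))"
      by (simp only: flip: U')
    moreover have "2 * (\<Sum>a\<in>W. choose2_int (d a)) = int m * (int k * (int k - 1))"
      using dw choose_two_int[of k] by (simp add: mW)
    moreover have "2 * (\<Sum>a\<in>N. choose2_int (d a)) \<le> (int k - 2) * (2 * int eN)"
    proof -
      have "2 * (\<Sum>a\<in>N. choose2_int (d a)) = (\<Sum>a\<in>N. int (d a) * (int (d a) - 1))"
        by (simp add: sum_distrib_left choose_two_int)
      also have "\<dots> \<le> (\<Sum>a\<in>N. int (d a) * (int k - 2))"
        using dx by (intro sum_mono mult_left_mono) force+
      also have "\<dots> = (int k - 2) * (2 * int eN)"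
        using sum_deg[OF NU] by (simp add: eN_def d_def mult.commute flip: sum_distrib_left sum_distrib_right)
      finally show ?thesis .
    qed
    ultimately show ?thesis by linarith
  qed
  moreover have "(\<Sum>w\<in>W. int (d w) - 1) = int m * (int k - 1)" using dw by (simp add: mW)
  moreover have "defect after - defect before = 2 * s * (2 * M - s + 2)"
  proof -
    have "insert v U = UNIV" by (auto simp: U_def)
    hence "after = F" by (simp add: induced_UNIV)
    thus ?thesis using deletion(3)[of v] by (simp add: U_def)
  qed
  ultimately have le: "2 * s * (2 * M - s + 2)
      \<le> 4 * int eN + 2 * (int m * (int k - 1)) + (int m * (int k * (int k - 1)) + (int k - 2) * (2 * int eN))
        + int k * (int k - 1)"
    using defect_after Q' by linarith
  have "card N \<le> edge_rank H - card W + 1"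
  proof (rule linked_bounds(2)[OF NW H_linked])
    show "linked H x y" if "x \<in> N" "y \<in> N" for x y
    proof -
      have "linked H x w" "linked H y w"
        using cross[OF _ w] that NU w WU by (auto intro!: linked_edge simp: H_def induced_def)
      thus ?thesis by (meson linked_sym linked_trans)
    qed
  qed auto
  moreover have "edge_rank H \<le> card (N \<union> W) - 1"
    using H_edges w by (intro edge_rank_le[of _ _ w]) auto
  moreover have "card (N \<union> W) = k + m" using NW by (simp add: card_Un_disjoint kN mW)
  ultimately have s': "s = int k - 1" using k3 m1 by (simp add: s_def kN mW)
  have "2 * (int k - 2) * int eN + 3 * ((int k - 1) * (int k - 2)) * (int m - 1) \<le> 0"
    using le unfolding s' M' by (simp add: algebra_simps)
  moreover have "0 \<le> 2 * (int k - 2) * int eN" using k3 by simp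
  moreover have "0 \<le> 3 * ((int k - 1) * (int k - 2)) * (int m - 1)" using k3 m1 by simp
  ultimately have "2 * (int k - 2) * int eN = 0" "3 * ((int k - 1) * (int k - 2)) * (int m - 1) = 0"
    by linarith+
  hence "eN = 0" "m = 1" using k3 by auto
  thus "m = 1" "{e \<in> F. e \<subseteq> {x. {v, x} \<in> F}} = {}" by (simp_all add: eN_def N')
qed

text \<open>If \<open>v\<close> has a non-neighbour and degree 2, then its two neighbours are the part of size two; if the
  degree is larger, then \<open>v\<close> and its only non-neighbour are.\<close>

theorem book_structure: "\<exists>p q. p \<noteq> q \<and> (F = book p q \<or> F = insert {p, q} (book p q))"
proof -
  obtain v w where vw: "v \<noteq> w" "{v, w} \<notin> F" using not_complete by blast
  let ?N = "{x. {v, x} \<in> F}" and ?W = "{x. x \<noteq> v \<and> {v, x} \<notin> F}"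
  have cross: "{x, y} \<in> F" if "x \<in> ?N" "y \<in> ?W" for x y
  proof -
    have "v \<noteq> x" using that(1) loopless[of v] by auto
    thus ?thesis using non_adjacent_trans[of v x y] that by (auto simp: insert_commute)
  qed
  have indep: "{x, y} \<notin> F" if "x \<in> ?W" "y \<in> ?W" for x y
    using non_adjacent_trans[of x y v] that loopless by (cases "x = y") (auto simp: insert_commute)
  show ?thesis
  proof (cases "card ?N = 2")
    case True
    then obtain p q where pq: "?N = {p, q}" "p \<noteq> q" by (auto simp: card_2_iff)
    have out: "{v, x} \<in> F \<longleftrightarrow> x \<in> {p, q}" for x using pq(1) by blast
    have adj: "{p, x} \<in> F" "{q, x} \<in> F" if "x \<notin> {p, q}" for x
    proof -
      have "x = v \<or> x \<in> ?W" using that out by blast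
      thus "{p, x} \<in> F" "{q, x} \<in> F"
        using cross[of p x] cross[of q x] out[of p] out[of q] pq by (auto simp: insert_commute)
    qed
    have non: "{x, y} \<notin> F" if "x \<notin> {p, q}" "y \<notin> {p, q}" for x y
      using that out[of x] out[of y] indep[of x y] loopless[of v]
      by (cases "x = v"; cases "y = v") (auto simp: insert_commute)
    have bk: "F - {{p, q}} = book p q"
    proof
      show "F - {{p, q}} \<subseteq> book p q"
      proof
        fix e assume e: "e \<in> F - {{p, q}}"
        then obtain a b where ab: "e = {a, b}" "a \<noteq> b" using simple[of e] by (auto simp: card_2_iff)
        hence "a \<in> {p, q} \<or> b \<in> {p, q}" using non[of a b] e by blast
        thus "e \<in> book p q" using e ab unfolding book_def by (auto simp: insert_commute)
      qed
      show "book p q \<subseteq> F - {{p, q}}"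
        using adj by (auto simp: book_def doubleton_eq_iff)
    qed
    have "F = book p q \<or> F = insert {p, q} (book p q)"
    proof (cases "{p, q} \<in> F")
      case True
      from insert_Diff[OF this] show ?thesis unfolding bk by simp
    next
      case False
      thus ?thesis using bk by simp
    qed
    with pq(2) show ?thesis by (intro exI conjI)
  next
    case False
    note counts = deletion_counts[OF vw False]
    have "w \<in> ?W" using vw by auto
    obtain z where z: "?W = {z}" using counts(1) by (rule card_1_singletonE)
    have "w \<in> {z}" unfolding z[symmetric] by fact
    hence W: "?W = {w}" using z by simp
    have "F = book v w"
    proof
      show "F \<subseteq> book v w"
      proof
        fix e assume e: "e \<in> F"
        then obtain a b where ab: "e = {a, b}" "a \<noteq> b" using simple[of e] by (auto simp: card_2_iff)
        have "\<not> e \<subseteq> ?N" using counts(2) e by blast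
        hence "a \<in> {v, w} \<or> b \<in> {v, w}" using ab W by auto
        moreover have "e \<noteq> {v, w}" using e vw by auto
        ultimately show "e \<in> book v w" using ab unfolding book_def by (auto simp: insert_commute)
      qed
      show "book v w \<subseteq> F"
      proof -
        have "{v, x} \<in> F" "{w, x} \<in> F" if "x \<notin> {v, w}" for x
        proof -
          show "{v, x} \<in> F" using that W by blast
          thus "{w, x} \<in> F" using cross[of x w] \<open>w \<in> ?W\<close> by (simp add: insert_commute)
        qed
        thus ?thesis by (auto simp: book_def)
      qed
    qed
    with vw(1) show ?thesis by (intro exI conjI disjI1)
  qed
qed

end

section \<open>Books\<close>

lemma book_edge_iff:
  assumes "p \<noteq> q" "F = book p q \<or> F = insert {p, q} (book p q)"
  shows "{x, y} \<in> F \<longleftrightarrow> (x \<in> {p, q} \<and> y \<notin> {p, q}) \<or> (y \<in> {p, q} \<and> x \<notin> {p, q})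
    \<or> ({x, y} = {p, q} \<and> {p, q} \<in> F)"
proof -
  have "{x, y} \<in> book p q \<longleftrightarrow> (x \<in> {p, q} \<and> y \<notin> {p, q}) \<or> (y \<in> {p, q} \<and> x \<notin> {p, q})"
    using assms(1) by (auto simp: book_def doubleton_eq_iff)
  moreover have "{p, q} \<notin> book p q" using assms(1) by (auto simp: book_def doubleton_eq_iff)
  ultimately show ?thesis using assms(2) by auto
qed

lemma simple_book:
  assumes "p \<noteq> q" "F = book p q \<or> F = insert {p, q} (book p q)" "e \<in> F"
  shows "card e = 2"
  using assms by (auto simp: book_def)

text \<open>Adding a vertex to \<open>Y\<close> attaches it to \<open>p\<close> and \<open>q\<close> and puts it at distance two from every other vertex
  of \<open>Y\<close>. The last term corrects the case of two isolated vertices.\<close>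

lemma defect_book:
  fixes p q :: "'n::finite"
  assumes pq: "p \<noteq> q" and F: "F = book p q \<or> F = insert {p, q} (book p q)" and Y: "Y \<subseteq> - {p, q}"
  defines "b \<equiv> of_bool ({p, q} \<in> F) :: int"
  shows "defect (induced F ({p, q} \<union> Y)) = 2 * (int (card Y) + b)\<^sup>2 - 2 + 2 * of_bool (int (card Y) + b = 0)"
  using finite[of Y] Y
proof (induction Y rule: finite_induct)
  case empty
  interpret vertex_deletion F "{p}" q
    by unfold_locales (use simple_book[OF pq F] pq in auto)
  note edge = book_edge_iff[OF pq F]
  have N1: "N \<subseteq> {p}" by (rule NU)
  have nbs_p: "nbs F {p} p = {}" using loop[of p] by (auto simp: nbs_def)
  have "{e \<in> F. e \<subseteq> N} = {}"
  proof (rule equals0I)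
    fix e assume e: "e \<in> {e \<in> F. e \<subseteq> N}"
    hence "card e \<le> card {p}" using N1 by (intro card_mono) auto
    thus False using e simple[of e] by auto
  qed
  hence "eN = 0" by (simp add: eN_def)
  moreover have "W = {}" using nbs_p by (auto simp: W_def)
  moreover have "(\<Sum>a\<in>{p}. choose2_int (d a)) = 0" by (simp add: d_def nbs_p)
  moreover have "Q = {}" using N1 by (auto simp: Q_def)
  moreover have "before = {}"
  proof (rule equals0I)
    fix e assume e: "e \<in> before"
    hence "card e \<le> card {p}" by (intro card_mono) (auto simp: induced_def)
    thus False using e simple[of e] by (auto simp: induced_def)
  qed
  ultimately have "defect after = 0" using defect_after by (simp add: defect_empty)
  moreover have "insert q {p} = {p, q} \<union> {}" by auto
  ultimately show ?case by (simp add: b_def insert_commute)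
next
  case (insert v Y)
  define U where "U = {p, q} \<union> Y"
  have mem: "x \<in> U \<longleftrightarrow> x = p \<or> x = q \<or> x \<in> Y" for x by (simp add: U_def)
  interpret vertex_deletion F U v
    by unfold_locales (use simple_book[OF pq F] insert mem in auto)
  note edge = book_edge_iff[OF pq F]
  have Y': "y \<notin> {p, q}" if "y \<in> Y" for y using insert.prems that by auto
  have v': "v \<notin> {p, q}" using insert.prems by auto
  have "x \<in> N \<longleftrightarrow> x \<in> {p, q}" for x
    using v' edge[of v x] by (auto simp: N_def nbs_def mem doubleton_eq_iff)
  hence N': "N = {p, q}" by blast
  have nbsY: "nbs F U y \<inter> N = {p, q}" if "y \<in> Y" for y
    using edge[of y p] edge[of y q] Y'[OF that] pq by (auto simp: nbs_def N' mem)
  have nbs_p: "nbs F U p \<inter> N = (if {p, q} \<in> F then {q} else {})"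
    using loop[of p] pq by (auto simp: nbs_def N' mem)
  have nbs_q: "nbs F U q \<inter> N = (if {p, q} \<in> F then {p} else {})"
    using loop[of q] pq by (auto simp: nbs_def N' mem insert_commute)
  have "{e \<in> F. e \<subseteq> N} = (if {p, q} \<in> F then {{p, q}} else {})"
  proof -
    have "e = {p, q}" if "e \<in> F" "e \<subseteq> {p, q}" for e
      using simple[OF that(1)] that(2) pq by (intro card_seteq) auto
    thus ?thesis by (auto simp: N')
  qed
  hence eN': "int eN = b" by (simp add: eN_def b_def)
  have W': "W = Y"
  proof -
    have "w \<in> W" if "w \<in> Y" for w using nbsY[OF that] Y'[OF that] that by (auto simp: W_def N' mem)
    thus ?thesis by (auto simp: W_def N' mem)
  qed
  have dY: "d y = 2" if "y \<in> Y" for y using nbsY[OF that] pq by (simp add: d_def)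
  have "d p \<le> 1" "d q \<le> 1" unfolding d_def nbs_p nbs_q by simp_all
  hence "choose2_int (d p) = 0" "choose2_int (d q) = 0" by (simp_all add: binomial_eq_0)
  moreover have "(\<Sum>a\<in>{p, q}. choose2_int (d a)) = choose2_int (d p) + choose2_int (d q)"
    using pq by simp
  moreover have "(\<Sum>a\<in>Y. choose2_int (d a)) = int (card Y)" using dY by simp
  moreover have "(\<Sum>a\<in>U. choose2_int (d a)) = (\<Sum>a\<in>{p, q}. choose2_int (d a)) + (\<Sum>a\<in>Y. choose2_int (d a))"
    unfolding U_def using Y' by (intro sum.union_disjoint) auto
  ultimately have T: "(\<Sum>a\<in>U. choose2_int (d a)) = int (card Y)" by linarith
  have "{p, q} \<in> F \<or> nbs F U p \<inter> nbs F U q \<noteq> {} \<longleftrightarrow> {p, q} \<in> F \<or> Y \<noteq> {}"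
  proof
    assume "{p, q} \<in> F \<or> nbs F U p \<inter> nbs F U q \<noteq> {}"
    thus "{p, q} \<in> F \<or> Y \<noteq> {}" using loop[of p] loop[of q] by (auto simp: nbs_def mem insert_commute)
  next
    assume "{p, q} \<in> F \<or> Y \<noteq> {}"
    thus "{p, q} \<in> F \<or> nbs F U p \<inter> nbs F U q \<noteq> {}"
    proof
      assume "Y \<noteq> {}"
      then obtain y where y: "y \<in> Y" by blast
      have "y \<in> nbs F U p \<inter> nbs F U q"
        using edge[of p y] edge[of q y] Y'[OF y] y by (simp add: nbs_def mem)
      thus ?thesis by blast
    qed simp
  qed
  hence "Q = (if {p, q} \<in> F \<or> Y \<noteq> {} then {(p, q), (q, p)} else {})"
    using pq by (auto simp: Q_def N' insert_commute Int_commute)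
  hence Q': "int (card Q) = (if {p, q} \<in> F \<or> Y \<noteq> {} then 2 else 0)" using pq by simp
  have "(\<Sum>w\<in>W. int (d w) - 1) = int (card Y)" using dY by (simp add: W')
  hence "defect after = defect before + 4 * b + 2 * int (card Y) + 2 * int (card Y) + int (card Q)"
    using defect_after T eN' by simp
  moreover have "insert v U = {p, q} \<union> insert v Y" by (auto simp: U_def)
  moreover have "defect before = 2 * (int (card Y) + b)\<^sup>2 - 2 + 2 * of_bool (int (card Y) + b = 0)"
    using insert unfolding U_def by auto
  moreover have "Y \<noteq> {} \<longleftrightarrow> card Y \<noteq> 0" by simp
  ultimately show ?case
    using insert.hyps unfolding Q'
    by (cases "{p, q} \<in> F"; cases "Y = {}") (auto simp: b_def power2_eq_square algebra_simps)
qed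

text \<open>As the gap is nonnegative, an upper bound on the nullity is enough.\<close>

lemma gap_book:
  fixes p q :: "'n::finite"
  assumes pq: "p \<noteq> q" and F: "F = book p q \<or> F = insert {p, q} (book p q)" and n: "CARD('n) \<ge> 3"
  shows "gap F = 0"
proof -
  define b where "b = (of_bool ({p, q} \<in> F) :: int)"
  let ?Y = "- {p, q}"
  note simple = simple_book[OF pq F]
  have F_UNIV: "induced F UNIV = F" by (simp add: induced_def)
  have cardY: "int (card ?Y) = int CARD('n) - 2"
    using pq n by (simp add: Compl_eq_Diff_UNIV card_Diff_subset)
  have "{p, q} \<union> ?Y = UNIV" by auto
  hence defect: "defect F = 2 * (int (card ?Y) + b)\<^sup>2 - 2"
    using defect_book[OF pq F, of ?Y] cardY n by (simp add: F_UNIV b_def)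
  have cardF: "int (card F) = 2 * int (card ?Y) + b"
  proof -
    have "book p q = (\<lambda>x. {p, x}) ` ?Y \<union> (\<lambda>x. {q, x}) ` ?Y" by (auto simp: book_def)
    moreover have "card ((\<lambda>x. {p, x}) ` ?Y) = card ?Y" "card ((\<lambda>x. {q, x}) ` ?Y) = card ?Y"
      by (intro card_image; auto simp: inj_on_def doubleton_eq_iff)+
    moreover have "(\<lambda>x. {p, x}) ` ?Y \<inter> (\<lambda>x. {q, x}) ` ?Y = {}"
      using pq by (auto simp: doubleton_eq_iff)
    ultimately have "card (book p q) = 2 * card ?Y" by (simp add: card_Un_disjoint)
    moreover have "{p, q} \<notin> book p q" using pq by (auto simp: book_def doubleton_eq_iff)
    ultimately show ?thesis using F by (auto simp: b_def)
  qed
  note edge = book_edge_iff[OF pq F]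
  have "card (UNIV - {p}) \<le> edge_rank F"
  proof (rule edge_rank_ge[where p = "\<lambda>_. p"])
    fix a assume a: "a \<in> UNIV - {p}"
    show "linked F a p"
    proof (cases "a = q")
      case True
      have "?Y \<noteq> {}"
      proof
        assume "?Y = {}"
        hence "card ?Y = 0" by (simp only: card.empty)
        thus False using cardY n by simp
      qed
      then obtain y where "y \<notin> {p, q}" by blast
      hence "linked F p y" "linked F q y" using edge[of p y] edge[of q y] by (auto intro: linked_edge)
      thus ?thesis using True by (meson linked_sym linked_trans)
    next
      case False
      thus ?thesis using a edge[of a p] by (auto intro: linked_edge)
    qed
  qed auto
  hence "int CARD('n) - 1 \<le> int (edge_rank F)" by simp
  hence "nullity F \<le> int (card ?Y) + b - 1" using cardF cardY by (simp add: nullity_def)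
  moreover have "0 \<le> nullity F" using simple by (rule nullity_nonneg)
  ultimately have "nullity F * (nullity F + 2) \<le> (int (card ?Y) + b - 1) * (int (card ?Y) + b - 1 + 2)"
    by (intro mult_mono) auto
  also have "\<dots> = (int (card ?Y) + b)\<^sup>2 - 1" by (simp add: power2_eq_square algebra_simps)
  finally have "gap F \<le> 0" unfolding gap_def defect by linarith
  moreover have "0 \<le> gap F" using gap_nonneg[of F UNIV, OF simple] by (simp add: F_UNIV)
  ultimately show ?thesis by linarith
qed

lemma image_book:
  fixes f :: "'n::finite \<Rightarrow> nat"
  assumes "bij_betw f UNIV {1..n}" "f p = 1" "f q = 2"
  shows "(\<lambda>e. f ` e) ` book p q = (\<Union>k\<in>{3..n}. {{1, k}, {2, k}})"
proof -
  have "f ` (- {p, q}) = f ` UNIV - f ` {p, q}"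
    using assms(1) unfolding Compl_eq_Diff_UNIV
    by (intro inj_on_image_set_diff[of f UNIV]) (auto simp: bij_betw_def)
  also have "\<dots> = {1..n} - {1, 2}" using assms by (simp add: bij_betw_def)
  also have "\<dots> = {3..n}" by auto
  finally have "{3..n} = f ` (- {p, q})" ..
  thus ?thesis using assms(2,3) by (simp add: book_def image_UN)
qed

text \<open>An isomorphism maps \<open>p\<close> and \<open>q\<close> to 1 and 2, and any bijection with this property is one. The set \<open>B\<close>
  decides whether \<open>p\<close> and \<open>q\<close> are adjacent.\<close>

lemma isomorphic_book_iff:
  fixes G :: "('n::finite) ugraph" and B :: "nat set set"
  assumes V: "verts G = UNIV" and n: "n = CARD('n)" "n \<ge> 2" and B: "B = {} \<or> B = {{1, 2}}"
  shows "graph_isomorphic G ({1..n}, B \<union> (\<Union>k\<in>{3..n}. {{1, k}, {2, k}}))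
    \<longleftrightarrow> (\<exists>p q. p \<noteq> q \<and> edges G = (if B = {} then {} else {{p, q}}) \<union> book p q)"
    (is "?L \<longleftrightarrow> ?R")
proof -
  have img: "(\<lambda>e. f ` e) ` ((if B = {} then {} else {{p, q}}) \<union> book p q)
      = B \<union> (\<Union>k\<in>{3..n}. {{1, k}, {2, k}})"
    if "bij_betw f UNIV {1..n}" "f p = 1" "f q = 2" for f and p q :: 'n
    unfolding image_Un image_book[OF that] using B that(2,3) by auto
  show ?thesis
  proof
    assume ?L
    then obtain f where f: "bij_betw f UNIV {1..n}"
      "(\<lambda>e. f ` e) ` edges G = B \<union> (\<Union>k\<in>{3..n}. {{1, k}, {2, k}})"
      using V by (auto simp: graph_isomorphic_def)
    have "1 \<in> f ` UNIV" "2 \<in> f ` UNIV" using f(1) n by (auto simp: bij_betw_def)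
    then obtain p q where "1 = f p" "2 = f q" unfolding image_iff by blast
    hence pq: "f p = 1" "f q = 2" by simp_all
    have inj: "inj (\<lambda>e. f ` e)"
      using f(1) by (intro injI) (simp add: bij_betw_def inj_image_eq_iff)
    have "(\<lambda>e. f ` e) ` edges G = (\<lambda>e. f ` e) ` ((if B = {} then {} else {{p, q}}) \<union> book p q)"
      by (rule trans[OF f(2) img[OF f(1) pq, symmetric]])
    hence "edges G = (if B = {} then {} else {{p, q}}) \<union> book p q"
      by (simp only: inj_image_eq_iff[OF inj])
    moreover have "p \<noteq> q" using pq by auto
    ultimately show ?R by (intro exI conjI)
  next
    assume ?R
    then obtain p q where pq: "p \<noteq> q" "edges G = (if B = {} then {} else {{p, q}}) \<union> book p q" by blast
    have "card (- {p, q}) = card {3..n}"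
      using pq(1) n by (simp add: Compl_eq_Diff_UNIV card_Diff_subset)
    then obtain h where h: "bij_betw h (- {p, q}) {3..n}"
      using finite_same_card_bij[of "- {p, q}" "{3..n}"] by auto
    define f where "f x = (if x \<in> {p, q} then (if x = p then 1 else 2) else h x)" for x
    have "bij_betw f (- {p, q} \<union> {p, q}) ({3..n} \<union> {1, 2})"
    proof (rule bij_betw_combine)
      show "bij_betw f (- {p, q}) {3..n}"
        using h by (subst bij_betw_cong[of _ _ h]) (auto simp: f_def)
      show "bij_betw f {p, q} {1, 2}" using pq(1) by (auto simp: bij_betw_def f_def)
    qed auto
    moreover have "- {p, q} \<union> {p, q} = UNIV" by auto
    moreover have "{3..n} \<union> {1, 2} = {1..n}" using n by auto
    ultimately have f: "bij_betw f UNIV {1..n}" by (simp only:)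
    have "f p = 1" "f q = 2" using pq(1) by (simp_all add: f_def)
    from img[OF f this] show ?L
      using f unfolding graph_isomorphic_def
      by (intro exI[of _ f] conjI) (simp_all only: fst_conv snd_conv V pq(2))
  qed
qed

lemma complete_bipartite_2:
  assumes "n \<ge> 2"
  shows "complete_bipartite 2 (n - 2) = ({1..n}, {} \<union> (\<Union>k\<in>{3..n}. {{1, k}, {2, k}}))"
proof -
  have "{{i, j} |i j. i \<in> {1..2} \<and> j \<in> {2 + 1..2 + (n - 2)}} = (\<Union>k\<in>{3..n}. {{1, k}, {2, k}})"
    (is "?L = ?R")
  proof
    show "?L \<subseteq> ?R"
    proof (clarify)
      fix i j assume "i \<in> {1..2::nat}" "j \<in> {2 + 1..2 + (n - 2)}"
      hence "i = 1 \<or> i = 2" "j \<in> {3..n}" using assms by auto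
      thus "{i, j} \<in> ?R" by blast
    qed
    show "?R \<subseteq> ?L"
    proof
      fix e assume "e \<in> ?R"
      then obtain k where k: "k \<in> {3..n}" "e = {1, k} \<or> e = {2, k}" by blast
      have "(1::nat) \<in> {1..2}" "(2::nat) \<in> {1..2}" "k \<in> {2 + 1..2 + (n - 2)}" using k(1) by auto
      thus "e \<in> ?L" using k(2) by blast
    qed
  qed
  thus ?thesis using assms by (simp add: complete_bipartite_def)
qed

section \<open>The coefficient \<open>\<gamma>\<^sub>2\<close>\<close>

lemma card_unit_ball:
  fixes F :: "'n::finite set set"
  assumes simple: "\<And>e. e \<in> F \<Longrightarrow> card e = 2"
  shows "int (card (unit_ball F)) = 2 * int (card F) + 1"
proof -
  have loop: "a \<noteq> b" if "{a, b} \<in> F" for a b using simple[OF that] by auto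
  let ?A = "{(i, j). {i, j} \<in> F}"
  have "inj_on (edge_vector :: 'n \<times> 'n \<Rightarrow> real ^ 'n) ?A"
  proof (rule inj_onI)
    fix x y assume "x \<in> ?A" "y \<in> ?A" and eq: "edge_vector x = (edge_vector y :: real ^ 'n)"
    hence "fst x \<noteq> snd x" using loop by auto
    have "basis_vec (fst x) + basis_vec (snd y) = basis_vec (fst y) + (basis_vec (snd x) :: real ^ 'n)"
      using eq by (simp add: edge_vector_def algebra_simps)
    from basis_sum_eqD[OF this] show "x = y" using \<open>fst x \<noteq> snd x\<close> by (auto simp: prod_eq_iff)
  qed
  hence "card (edge_vectors F) = card ?A" unfolding edge_vectors_image by (rule card_image)
  moreover have "int (card ?A) = 2 * int (card F)"
    using handshake_pairs[of F UNIV, OF simple] by simp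
  moreover have "0 \<notin> edge_vectors F"
    using simple[of "{_}"] by (auto simp: edge_vectors_def axis_eq_axis)
  ultimately show ?thesis by (simp add: unit_ball_def finite_edge_vectors)
qed

theorem gamma_2_eq_gap:
  assumes "simple_graph G" "edge_rank (edges G) \<ge> 4"
  shows "gamma_vector (symmetric_edge_polytope G) 2 = gap (edges G)"
proof -
  have simple: "card e = 2" if "e \<in> edges G" for e using assms(1) that by (simp add: simple_graph_def)
  have rank: "edge_rank (edges G) = dim (edge_vector ` adjacency G)"
    by (simp add: edge_rank_def edge_vectors_eq)
  have "card (lattice_points (adjacency G) 0) = 1"
    using lattice_points_0[OF sym_adjacency irrefl_adjacency[OF assms(1)]] by simp
  from gamma_2_lattice_points[OF assms(1) rank assms(2) this]
  show ?thesis
    unfolding lattice_points_1[OF assms(1)] lattice_points_2[OF assms(1)]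
    by (simp add: card_unit_ball[of "edges G", OF simple] gap_def defect_def nullity_def power2_eq_square algebra_simps)
qed

lemma gamma_2_low_rank:
  assumes "simple_graph G" "edge_rank (edges G) < 4"
  shows "gamma_vector (symmetric_edge_polytope G) 2 = 0"
  using assms by (intro gamma_2_small_dim) (simp_all add: edge_rank_def edge_vectors_eq)

theorem theoremA:
  fixes G :: "('n::finite) ugraph" and n :: nat
  assumes "simple_graph G" and "verts G = UNIV" and "n = CARD('n)"
  shows "gamma_vector (symmetric_edge_polytope G) 2 \<ge> 0 \<and>
    (two_connected G \<longrightarrow>
      (gamma_vector (symmetric_edge_polytope G) 2 = 0 \<longleftrightarrow>
        n < 5 \<or>
        (n \<ge> 5 \<and> (graph_isomorphic G (graph_Gn n) \<or>
                   graph_isomorphic G (complete_bipartite 2 (n - 2))))))"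
proof (intro conjI impI)
  have simple: "card e = 2" if "e \<in> edges G" for e using assms(1) that by (simp add: simple_graph_def)
  have induced: "induced (edges G) UNIV = edges G" by (simp add: induced_def)
  show "gamma_vector (symmetric_edge_polytope G) 2 \<ge> 0"
    using gamma_2_low_rank[OF assms(1)] gamma_2_eq_gap[OF assms(1)] gap_nonneg[of "edges G" UNIV, OF simple]
    by (cases "edge_rank (edges G) < 4") (simp_all add: induced)
  assume "two_connected G"
  hence bridgeless: "bridgeless_connected UNIV (edges G)"
    using two_connected_imp_bridgeless assms(2) by metis
  show "gamma_vector (symmetric_edge_polytope G) 2 = 0 \<longleftrightarrow>
      n < 5 \<or> (n \<ge> 5 \<and> (graph_isomorphic G (graph_Gn n) \<or>
                 graph_isomorphic G (complete_bipartite 2 (n - 2))))"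
  proof (cases "n < 5")
    case True
    have "edge_rank (edges G) \<le> CARD('n) - 1" by (rule edge_rank_le[of _ UNIV]) auto
    hence "edge_rank (edges G) < 4" using True assms(3) by simp
    thus ?thesis using True gamma_2_low_rank[OF assms(1)] by simp
  next
    case False
    obtain v :: 'n where True by blast
    have "card (UNIV - {v}) \<le> edge_rank (edges G)"
    proof (rule edge_rank_ge[where p = "\<lambda>_. v"])
      show "linked (edges G) a v" for a
        using bridgeless linked_mono[of "edges G - {{}}" a v "edges G"]
        unfolding bridgeless_connected_def by blast
    qed simp
    hence rank: "edge_rank (edges G) \<ge> 4" using False assms(3) by simp
    have Gn: "graph_isomorphic G (graph_Gn n) \<longleftrightarrow> (\<exists>p q. p \<noteq> q \<and> edges G = insert {p, q} (book p q))"
      using isomorphic_book_iff[OF assms(2,3), of "{{1, 2}}"] False by (simp add: graph_Gn_def)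
    have K: "graph_isomorphic G (complete_bipartite 2 (n - 2)) \<longleftrightarrow> (\<exists>p q. p \<noteq> q \<and> edges G = book p q)"
      using isomorphic_book_iff[OF assms(2,3), of "{}"] complete_bipartite_2[of n] False by simp
    have "gap (edges G) = 0 \<longleftrightarrow> (\<exists>p q. p \<noteq> q \<and> (edges G = book p q \<or> edges G = insert {p, q} (book p q)))"
    proof
      assume "gap (edges G) = 0"
      then interpret vanishing_gap "edges G"
        by unfold_locales (use simple bridgeless False assms(3) in auto)
      show "\<exists>p q. p \<noteq> q \<and> (edges G = book p q \<or> edges G = insert {p, q} (book p q))"
        by (rule book_structure)
    next
      assume "\<exists>p q. p \<noteq> q \<and> (edges G = book p q \<or> edges G = insert {p, q} (book p q))"
      thus "gap (edges G) = 0" using gap_book[of _ _ "edges G"] False assms(3) by auto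
    qed
    thus ?thesis using False Gn K by (simp add: gamma_2_eq_gap[OF assms(1) rank]) blast
  qed
qed



end
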